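(* Let $s\in(0,1)$, and let $L$ be any stable operator of order $2s$ on $\mathbb{R}^n$ with ellipticity constants $0<\lambda\le\Lambda<\infty$. Let $u$ be any weak solution to $$\partial_t u-Lu=f\quad\text{in }(-1,0)\times B_1 .$$ Let $0<\epsilon<2s$ and $$C_0:=\|u\|_{L^\infty((-1,0)\times\mathbb{R}^n)}+\|f\|_{L^\infty((-1,0)\times B_1)} .$$ Then $$\|u\|_{C^{1-\frac{\epsilon}{2s}}_t\left(\left(-\frac12,0\right)\times B_{1/2}\right)}+\|u\|_{C^{2s-\epsilon}_x\left(\left(-\frac12,0\right)\times B_{1/2}\right)}\le C\,C_0,$$ for some constant $C$ depending only on $n$, $s$, $\epsilon$, $\lambda$ and $\Lambda$.
   Context: $B_r\subset\mathbb{R}^n$ is the ball of radius $r$ centred at the origin. A stable operator of order $2s$ with ellipticity constants $0<\lambda\le\Lambda<\infty$ is an operator of the form $$Lw(t,x)=\int_{S^{n-1}}\int_{-\infty}^{\infty}\bigl(w(t,x+\theta r)+w(t,x-\theta r)-2w(t,x)\bigr)\frac{dr}{|r|^{1+2s}}\,d\mu(\theta),$$ where the spectral measure $\mu$ is a nonnegative measure on $S^{n-1}$ (possibly singular) with $$\lambda\le\inf_{\nu\in S^{n-1}}\int_{S^{n-1}}|\nu\cdot\theta|^{2s}\,d\mu(\theta),\qquad \int_{S^{n-1}}d\mu\le\Lambda .$$ Weak solution: $\partial_tu-Lu=f$ in $I\times D$ means $\int_{I\times\mathbb{R}^n}u(-\partial_t\eta-L\eta)\,dx\,dt=\int_{I\times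 D}f\eta\,dx\,dt$ for all $\eta\in C_c^\infty(I\times D)$. Regularity of $u$ is understood after modification on a null set. Norms: for $\gamma>0$, $\|u\|_{C^\gamma_x(I\times D)}=\sup_{t\in I}\|u(t,\cdot)\|_{C^\gamma(D)}$ and $\|u\|_{C^\gamma_t(I\times D)}=\sup_{x\in D}\|u(\cdot,x)\|_{C^\gamma(I)}$, where $C^\gamma$ is the usual Hölder space ($C^{\lfloor\gamma\rfloor,\gamma-\lfloor\gamma\rfloor}$ for non-integer $\gamma$). *)

theory Defs
  imports "HOL-Analysis.Analysis" "HOL-Probability.Essential_Supremum"
begin

text \<open>
  Space-time is \<open>real \<times> 'a\<close>, where \<open>'a\<close> is a Euclidean space of dimension at least one.
  Norms take values in \<^typ>\<open>ennreal\<close>: a finite norm expresses membership in the space.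
\<close>

text \<open>Functions of class $C^k$ on an open set.\<close>

fun C_k_on :: "nat \<Rightarrow> 'a::euclidean_space set \<Rightarrow> ('a \<Rightarrow> real) \<Rightarrow> bool" where
  "C_k_on 0 D g \<longleftrightarrow> continuous_on D g"
| "C_k_on (Suc k) D g \<longleftrightarrow>
     (\<forall>x\<in>D. g differentiable (at x)) \<and>
     (\<forall>b\<in>Basis. C_k_on k D (\<lambda>x. frechet_derivative g (at x) b))"

text \<open>
  Test functions on an open set \<open>S\<close> are represented by their extension by zero, which is
  smooth on the whole space; this is the function to which the nonlocal operator is applied.
\<close>

definition test_function :: "'a::euclidean_space set \<Rightarrow> ('a \<Rightarrow> real) \<Rightarrow> bool" where
  "test_function S \<eta> \<longleftrightarrow>
     (\<forall>k. C_k_on k UNIV \<eta>) \<and>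
     compact (closure {z. \<eta> z \<noteq> 0}) \<and> closure {z. \<eta> z \<noteq> 0} \<subseteq> S"

definition spectral_measure :: "real \<Rightarrow> real \<Rightarrow> real \<Rightarrow> 'a::euclidean_space measure \<Rightarrow> bool" where
  "spectral_measure s lam Lam \<mu> \<longleftrightarrow>
     sets \<mu> = sets (restrict_space borel (sphere 0 1)) \<and>
     ennreal lam \<le> (INF \<nu>\<in>sphere 0 1. \<integral>\<^sup>+\<theta>. ennreal (\<bar>\<nu> \<bullet> \<theta>\<bar> powr (2 * s)) \<partial>\<mu>) \<and>
     emeasure \<mu> (sphere 0 1) \<le> ennreal Lam"

definition stable_op ::
    "real \<Rightarrow> 'a::euclidean_space measure \<Rightarrow> (real \<times> 'a \<Rightarrow> real) \<Rightarrow> real \<times> 'a \<Rightarrow> real" where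
  "stable_op s \<mu> w = (\<lambda>(t, x).
     \<integral>\<theta>. (\<integral>r. (w (t, x + r *\<^sub>R \<theta>) + w (t, x - r *\<^sub>R \<theta>) - 2 * w (t, x))
               / \<bar>r\<bar> powr (1 + 2 * s) \<partial>lborel) \<partial>\<mu>)"

definition is_stable_operator ::
    "real \<Rightarrow> real \<Rightarrow> real \<Rightarrow> ((real \<times> 'a::euclidean_space \<Rightarrow> real) \<Rightarrow> real \<times> 'a \<Rightarrow> real) \<Rightarrow> bool" where
  "is_stable_operator s lam Lam L \<longleftrightarrow> (\<exists>\<mu>. spectral_measure s lam Lam \<mu> \<and> L = stable_op s \<mu>)"

text \<open>
  Integrability is part of the definition because the Bochner integral of a non-integrable
  function is 0 by convention. It is automatic when \<open>u\<close> and \<open>f\<close> are essentially bounded.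
\<close>

definition weak_solution ::
    "((real \<times> 'a::euclidean_space \<Rightarrow> real) \<Rightarrow> real \<times> 'a \<Rightarrow> real) \<Rightarrow> real set \<Rightarrow> 'a set \<Rightarrow>
     (real \<times> 'a \<Rightarrow> real) \<Rightarrow> (real \<times> 'a \<Rightarrow> real) \<Rightarrow> bool" where
  "weak_solution L I D u f \<longleftrightarrow>
     u \<in> borel_measurable (lebesgue_on (I \<times> UNIV)) \<and>
     f \<in> borel_measurable (lebesgue_on (I \<times> D)) \<and>
     (\<forall>\<eta>. test_function (I \<times> D) \<eta> \<longrightarrow>
        integrable (lebesgue_on (I \<times> UNIV))
          (\<lambda>(t, x). u (t, x) * (- deriv (\<lambda>\<tau>. \<eta> (\<tau>, x)) t - L \<eta> (t, x))) \<and>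
        integrable (lebesgue_on (I \<times> D)) (\<lambda>z. f z * \<eta> z) \<and>
        (\<integral>(t, x). u (t, x) * (- deriv (\<lambda>\<tau>. \<eta> (\<tau>, x)) t - L \<eta> (t, x))
            \<partial>lebesgue_on (I \<times> UNIV))
          = (\<integral>z. f z * \<eta> z \<partial>lebesgue_on (I \<times> D)))"

definition Linf_norm :: "'a::euclidean_space set \<Rightarrow> ('a \<Rightarrow> real) \<Rightarrow> ennreal" where
  "Linf_norm S g = esssup (lebesgue_on S) (\<lambda>z. ennreal \<bar>g z\<bar>)"

text \<open>Iterated partial derivatives along a list of coordinate directions.\<close>

fun partial_deriv :: "'a::euclidean_space list \<Rightarrow> ('a \<Rightarrow> real) \<Rightarrow> 'a \<Rightarrow> real" where
  "partial_deriv [] g = g"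
| "partial_deriv (b # bs) g = (\<lambda>x. frechet_derivative (partial_deriv bs g) (at x) b)"

definition holder_seminorm :: "real \<Rightarrow> 'a::euclidean_space set \<Rightarrow> ('a \<Rightarrow> real) \<Rightarrow> ennreal" where
  "holder_seminorm \<alpha> D g =
     (SUP x\<in>D. SUP y\<in>D - {x}. ennreal (\<bar>g x - g y\<bar> / dist x y powr \<alpha>))"

text \<open>
  The norm of $C^{k,\alpha}(D)$ with $k = \lfloor\gamma\rfloor$ and $\alpha = \gamma - k$:
  $\sum_{j \le k} \sup_{|\beta| = j} \sup_D |D^\beta g| + \sup_{|\beta| = k} [D^\beta g]_{C^\alpha(D)}$.
  A list of \<open>j\<close> basis vectors encodes a multi-index $\beta$ of order \<open>j\<close>. For integer \<open>\<gamma>\<close> the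
  seminorm is an oscillation, and the result is equivalent to the norm of $C^k$.
\<close>

definition holder_norm :: "real \<Rightarrow> 'a::euclidean_space set \<Rightarrow> ('a \<Rightarrow> real) \<Rightarrow> ennreal" where
  "holder_norm \<gamma> D g = (let k = nat \<lfloor>\<gamma>\<rfloor> in
     if C_k_on k D g then
       (\<Sum>j\<le>k. SUP bs\<in>{bs. set bs \<subseteq> Basis \<and> length bs = j}. SUP x\<in>D. ennreal \<bar>partial_deriv bs g x\<bar>)
       + (SUP bs\<in>{bs. set bs \<subseteq> Basis \<and> length bs = k}.
            holder_seminorm (\<gamma> - real k) D (partial_deriv bs g))
     else top)"

definition holder_norm_x ::
    "real \<Rightarrow> real set \<Rightarrow> 'a::euclidean_space set \<Rightarrow> (real \<times> 'a \<Rightarrow> real) \<Rightarrow> ennreal" where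
  "holder_norm_x \<gamma> I D u = (SUP t\<in>I. holder_norm \<gamma> D (\<lambda>x. u (t, x)))"

definition holder_norm_t ::
    "real \<Rightarrow> real set \<Rightarrow> 'a::euclidean_space set \<Rightarrow> (real \<times> 'a \<Rightarrow> real) \<Rightarrow> ennreal" where
  "holder_norm_t \<gamma> I D u = (SUP x\<in>D. holder_norm \<gamma> I (\<lambda>t. u (t, x)))"

end

theory Submission
  imports Defs "HOL-Computational_Algebra.Polynomial"
begin

text \<open>A maximum principle argument by blow-up. Fix \<gamma> with 2s - \<epsilon> < \<gamma> < 2s. If the weighted \<gamma>-Hoelder quotient of the
spatial second differences of a smooth solution is large, zoom in where it is almost attained and normalise. In
the limit regime the second difference g in a unit direction e satisfies g \<le> 1 + \<delta> on a huge cylinder, almost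
solves the equation, and has g(0,0) \<ge> 1 - \<delta>. Touching g from above with a small paraboloid shows that g is close to 1
at almost all jump targets from a nearby point, along some direction not nearly orthogonal to any prescribed vector.
Jumping to the orthogonal projection of a target z reduces the distance to z by a fixed factor, so after
finitely many jumps g is close to 1 on a whole ball of radius 2^m. Adding up second differences dyadically gives
4^m / 2 \<le> D2 W(0, 2^m e) \<le> 2 * 2^(m \<gamma>), which is false for large m because \<gamma> < 2.

Second differences of order \<gamma> control the spatial Hoelder norms, and comparison at parabolic scales turns
them into time regularity of order \<gamma> / (2s). The estimates depend only on sup norms, so they pass from the mollifications
of a weak solution, which are smooth solutions on slightly smaller cylinders, to their pointwise limit.\<close>

section \<open>Second differences and jump integrals\<close>

text \<open>The spectral measure may be singular, for instance carried by finitely many lines. There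
  is then no kernel density to work with, and a single jump may reach only a null set of targets.
  What remains is that every unit vector sees directions of mass at least \<open>lam / 2\<close>
  that are not nearly orthogonal to it; hence near extremality travels along a chain of projections.

  C must not depend on the measure, and no compactness is invoked: the limit regime is a fixed
  \<delta>, and \<delta>, the number of jumps and their accuracies are chosen before the measure,
  the solution and the scale R.

  Second differences ignore affine functions, so one quotient of order \<gamma> covers regularity
  below and above order 1, without affine corrections in the blow-up. The gap \<gamma> < 2s makes
  jumps beyond R harmless, their weight being of order R^(\<gamma> - 2s). The gap above 2s -
  \<epsilon> covers the value 2s - \<epsilon> = 1, where second differences of order exactly 1 would
  not yield a derivative.\<close>

definition D2 :: "('a::real_vector \<Rightarrow> real) \<Rightarrow> 'a \<Rightarrow> 'a \<Rightarrow> real" where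
  "D2 w x h = w (x + h) + w (x - h) - 2 * w x"

definition slice_op :: "real \<Rightarrow> 'a::euclidean_space measure \<Rightarrow> ('a \<Rightarrow> real) \<Rightarrow> 'a \<Rightarrow> real" where
  "slice_op s \<mu> w x = (\<integral>\<theta>. (\<integral>r. D2 w x (r *\<^sub>R \<theta>) / \<bar>r\<bar> powr (1 + 2 * s) \<partial>lborel) \<partial>\<mu>)"

lemma stable_op_eq_slice_op: "stable_op s \<mu> w (t, x) = slice_op s \<mu> (\<lambda>y. w (t, y)) x"
  by (simp add: stable_op_def slice_op_def D2_def)

text \<open>Quadratic control of short jumps tames the kernel at 0 because 2s < 2, and growth of
  order q < 2s tames it at infinity. The exponent q is 0 where only a sup bound is at hand, and
  \<gamma> where second differences grow with the step.\<close>

definition kernel_majorant :: "real \<Rightarrow> real \<Rightarrow> real \<Rightarrow> real \<Rightarrow> real \<Rightarrow> real \<Rightarrow> real" where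
  "kernel_majorant s a c2 c q r =
     (if \<bar>r\<bar> \<le> a then c2 * r\<^sup>2 else c * \<bar>r\<bar> powr q) / \<bar>r\<bar> powr (1 + 2 * s)"

lemma kernel_majorant_measurable [measurable]: "kernel_majorant s a c2 c q \<in> borel_measurable borel"
  unfolding kernel_majorant_def by measurable

text \<open>Nonnegativity lets the gauge integral over the half line pass to a Lebesgue integral.
  The origin, counted by both halves, is a null set.\<close>

lemma has_bochner_integral_even:
  fixes f :: "real \<Rightarrow> real"
  assumes [measurable]: "f \<in> borel_measurable borel" and nn: "\<And>r. 0 \<le> f r"
    and I: "(f has_integral I) {0..}" and even: "\<And>r. f (- r) = f r"
  shows "has_bochner_integral lborel f (2 * I)"
proof -
  have I0: "0 \<le> I" using I nn by (meson has_integral_nonneg)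
  have "((\<lambda>r. if r \<in> {0..} then f r else 0) has_integral I) UNIV"
    using I by (subst has_integral_restrict_UNIV)
  then have 1: "((\<lambda>r. indicator {0..} r * f r) has_integral I) UNIV"
    by (rule has_integral_eq[rotated]) (auto simp: indicator_def)
  have "has_bochner_integral lborel (\<lambda>r. indicator {0..} r * f r) I"
    by (rule has_bochner_integral_nn_integral)
      (use nn_integral_has_integral_lborel[OF _ _ 1] nn I0 in auto)
  note 2 = this has_bochner_integral_add[OF this
      lborel_has_bochner_integral_real_affine_iff[of "-1" _ _ 0, THEN iffD1, OF _ this]]
  have "has_bochner_integral lborel (\<lambda>r. indicator {0..} r * f r + indicator {0..} (- r) * f r) (2 * I)"
    using 2(2) by (simp add: even)
  moreover have "AE r in lborel. indicator {0..} r * f r + indicator {0..} (- r) * f r = f r"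
    using AE_lborel_singleton[of 0] by eventually_elim (auto simp: indicator_def)
  ultimately show ?thesis
    by (subst has_bochner_integral_cong_AE[symmetric]) auto
qed

lemma abs_power2_divide_powr: "r\<^sup>2 / \<bar>r\<bar> powr p = \<bar>r :: real\<bar> powr (2 - p)"
proof (cases "r = 0")
  case False
  then have "\<bar>r\<bar> powr 2 = r\<^sup>2" by (simp add: powr_numeral)
  then show ?thesis by (simp add: powr_diff)
qed simp

lemma kernel_majorant_nonneg: "0 \<le> c2 \<Longrightarrow> 0 \<le> c \<Longrightarrow> 0 \<le> kernel_majorant s a c2 c q r"
  by (simp add: kernel_majorant_def)

lemma kernel_majorant_integral:
  assumes "0 < s" "s < 1" "0 < a" "0 \<le> c2" "0 \<le> c" "q < 2 * s"
  shows "has_bochner_integral lborel (kernel_majorant s a c2 c q)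
    (2 * (c2 * a powr (2 - 2 * s) / (2 - 2 * s) + c * a powr (q - 2 * s) / (2 * s - q)))"
proof -
  have A: "((\<lambda>r. c2 * r powr (1 - 2 * s)) has_integral c2 * (a powr (2 - 2 * s) / (2 - 2 * s))) {0..a}"
    using has_integral_powr_from_0[of "1 - 2 * s" a] assms by (intro has_integral_mult_right) (simp add: algebra_simps)
  have A': "(kernel_majorant s a c2 c q has_integral c2 * (a powr (2 - 2 * s) / (2 - 2 * s))) {0..a}"
  proof (rule has_integral_eq[OF _ A])
    fix r assume "r \<in> {0..a}"
    then show "c2 * r powr (1 - 2 * s) = kernel_majorant s a c2 c q r"
      using abs_power2_divide_powr[of r "1 + 2 * s"] by (simp add: kernel_majorant_def flip: times_divide_eq_right)
  qed
  have eq: "- (a powr (q - 1 - 2 * s + 1)) / (q - 1 - 2 * s + 1) = a powr (q - 2 * s) / (2 * s - q)"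
    using assms by (simp add: divide_simps) (simp add: algebra_simps)
  have B: "((\<lambda>r. c * r powr (q - 1 - 2 * s)) has_integral c * (a powr (q - 2 * s) / (2 * s - q))) {a..}"
    using has_integral_powr_to_inf[of "q - 1 - 2 * s" a, unfolded eq] assms
    by (intro has_integral_mult_right) simp
  have B': "(kernel_majorant s a c2 c q has_integral c * (a powr (q - 2 * s) / (2 * s - q))) {a..}"
  \<comment> \<open>At the endpoint a the majorant is still on its quadratic branch, hence the
    exceptional null set.\<close>
  proof (rule has_integral_spike[OF _ _ B])
    show "negligible {a}" by simp
    fix r assume "r \<in> {a..} - {a}"
    then have "r > a" "r > 0" using assms by auto
    moreover have "r powr (q - 1 - 2 * s) = r powr q / r powr (1 + 2 * s)"
      by (simp add: powr_diff[symmetric] algebra_simps)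
    ultimately show "kernel_majorant s a c2 c q r = c * r powr (q - 1 - 2 * s)"
      by (simp add: kernel_majorant_def)
  qed
  have "{0..a} \<inter> {a..} = {a}" "{0..a} \<union> {a..} = {0..}" using assms by auto
  with has_integral_Un[OF A' B'] have
   "(kernel_majorant s a c2 c q has_integral (c2 * (a powr (2 - 2 * s) / (2 - 2 * s)) + c * (a powr (q - 2 * s) / (2 * s - q)))) {0..}"
    by simp
  from has_bochner_integral_even[OF _ _ this]
  show ?thesis using assms by (simp add: kernel_majorant_nonneg) (simp add: kernel_majorant_def)
qed

text \<open>A qualitative class on which the iterated integral of \<open>slice_op\<close> converges
  absolutely, so that the operator is linear there. The bounds P and Q are existential, so they
  cannot enter a constant of the estimates.\<close>

definition c11 :: "('a::real_normed_vector \<Rightarrow> real) \<Rightarrow> bool" where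
  "c11 w \<longleftrightarrow> continuous_on UNIV w \<and> (\<exists>P. \<forall>x. \<bar>w x\<bar> \<le> P) \<and> (\<exists>Q. \<forall>x h. \<bar>D2 w x h\<bar> \<le> Q * (norm h)\<^sup>2)"

lemma c11_linear_comb:
  assumes "c11 w1" "c11 w2"
  shows "c11 (\<lambda>x. a * w1 x + b * w2 x)"
proof -
  obtain P1 Q1 P2 Q2 where *: "\<And>x. \<bar>w1 x\<bar> \<le> P1" "\<And>x. \<bar>w2 x\<bar> \<le> P2"
     "\<And>x h. \<bar>D2 w1 x h\<bar> \<le> Q1 * (norm h)\<^sup>2" "\<And>x h. \<bar>D2 w2 x h\<bar> \<le> Q2 * (norm h)\<^sup>2"
    using assms unfolding c11_def by blast
  have lin: "D2 (\<lambda>x. a * w1 x + b * w2 x) x h = a * D2 w1 x h + b * D2 w2 x h" for x h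
    by (simp add: D2_def algebra_simps)
  have tri: "\<bar>a * u + b * v\<bar> \<le> \<bar>a\<bar> * U + \<bar>b\<bar> * V" if "\<bar>u\<bar> \<le> U" "\<bar>v\<bar> \<le> V" for u v U V
    using mult_left_mono[OF that(1), of "\<bar>a\<bar>"] mult_left_mono[OF that(2), of "\<bar>b\<bar>"]
    by (intro order_trans[OF abs_triangle_ineq]) (simp add: abs_mult)
  show ?thesis unfolding c11_def
  proof (intro conjI exI allI)
    show "continuous_on UNIV (\<lambda>x. a * w1 x + b * w2 x)"
      using assms by (auto simp: c11_def intro!: continuous_intros)
    show "\<bar>a * w1 x + b * w2 x\<bar> \<le> \<bar>a\<bar> * P1 + \<bar>b\<bar> * P2" for x
      using tri * by blast
    show "\<bar>D2 (\<lambda>x. a * w1 x + b * w2 x) x h\<bar> \<le> (\<bar>a\<bar> * Q1 + \<bar>b\<bar> * Q2) * (norm h)\<^sup>2" for x h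
      unfolding lin using tri[OF *(3) *(4)] by (simp add: algebra_simps)
  qed
qed

lemma c11_affine:
  assumes "c11 w"
  shows "c11 (\<lambda>x. w (y + c *\<^sub>R x))"
proof -
  obtain P Q where *: "\<And>x. \<bar>w x\<bar> \<le> P" "\<And>x h. \<bar>D2 w x h\<bar> \<le> Q * (norm h)\<^sup>2"
    and "continuous_on UNIV w"
    using assms unfolding c11_def by blast
  moreover have "D2 (\<lambda>x. w (y + c *\<^sub>R x)) x h = D2 w (y + c *\<^sub>R x) (c *\<^sub>R h)" for x h
    by (simp add: D2_def algebra_simps)
  moreover have "continuous_on UNIV (\<lambda>x. w (y + c *\<^sub>R x))"
    using \<open>continuous_on UNIV w\<close>
    by (intro continuous_on_compose2[OF \<open>continuous_on UNIV w\<close>] continuous_intros) auto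
  moreover have "\<bar>D2 w (y + c *\<^sub>R x) (c *\<^sub>R h)\<bar> \<le> (Q * c\<^sup>2) * (norm h)\<^sup>2" for x h
    using *(2)[of "y + c *\<^sub>R x" "c *\<^sub>R h"] by (simp add: power_mult_distrib mult.assoc)
  ultimately show ?thesis unfolding c11_def by (metis (no_types, lifting))
qed

section \<open>Spectral measures and their nondegeneracy\<close>

lemma spectral_measureD:
  assumes "spectral_measure s lam Lam \<mu>" "0 \<le> Lam"
  shows "sets \<mu> = sets (restrict_space borel (sphere 0 1))" "space \<mu> = sphere 0 1"
    "finite_measure \<mu>" "measure \<mu> (sphere 0 1) \<le> Lam"
    "f \<in> borel_measurable borel \<Longrightarrow> f \<in> borel_measurable \<mu>"
proof -
  show 1: "sets \<mu> = sets (restrict_space borel (sphere 0 1))"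
    using assms by (simp add: spectral_measure_def)
  then show 2: "space \<mu> = sphere 0 1"
    using sets_eq_imp_space_eq[OF 1] by (simp add: space_restrict_space)
  have "emeasure \<mu> (sphere 0 1) \<le> ennreal Lam" using assms by (simp add: spectral_measure_def)
  with 2 show "finite_measure \<mu>"
    by (intro finite_measureI) (auto simp: top_unique)
  show "measure \<mu> (sphere 0 1) \<le> Lam"
    unfolding measure_def using \<open>emeasure \<mu> (sphere 0 1) \<le> ennreal Lam\<close> assms(2)
    using enn2real_leI by blast
  show "f \<in> borel_measurable borel \<Longrightarrow> f \<in> borel_measurable \<mu>"
    using measurable_restrict_space1[of f borel borel "sphere 0 1"] measurable_cong_sets[OF 1 refl] by blast
qed

lemma spectral_measure_id_measurable:
  assumes "spectral_measure s lam Lam \<mu>"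
  shows "(\<lambda>\<theta>. \<theta>) \<in> borel_measurable \<mu>"
proof -
  have "sets \<mu> = sets (restrict_space borel (sphere 0 1))"
    using assms by (simp add: spectral_measure_def)
  moreover have "(\<lambda>\<theta>. \<theta>) \<in> borel_measurable (restrict_space borel (sphere 0 (1::real)))"
    by (rule measurable_restrict_space1) measurable
  ultimately show ?thesis using measurable_cong_sets[of \<mu> _ borel borel] by blast
qed

text \<open>The threshold c satisfies \<open>Lam * c powr (2 * s) = lam / 2\<close>. Directions
  below it therefore contribute at most \<open>lam / 2\<close> to an integral that is at least
  \<open>lam\<close>; on the others the integrand is at most 1, so their mass makes up the
  rest.\<close>

lemma nondegenerate_directions:
  fixes \<mu> :: "'a::euclidean_space measure"
  assumes sp: "spectral_measure s lam Lam \<mu>" and "0 < s" "0 < lam" "lam \<le> Lam" "norm \<nu> = 1"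
  shows "lam / 2 \<le> measure \<mu> {\<theta> \<in> sphere 0 1. (lam / (2 * Lam)) powr (1 / (2 * s)) \<le> \<bar>\<nu> \<bullet> \<theta>\<bar>}"
proof -
  have Lam: "0 \<le> Lam" using assms by auto
  note S = spectral_measureD[OF sp Lam]
  interpret finite_measure \<mu> by (rule S)
  define c where "c = (lam / (2 * Lam)) powr (1 / (2 * s))"
  define G where "G = {\<theta> \<in> sphere 0 1. c \<le> \<bar>\<nu> \<bullet> \<theta>\<bar>}"
  note [measurable] = spectral_measure_id_measurable[OF sp]
  have G[measurable]: "G \<in> sets \<mu>"
  proof -
    have "{\<theta> \<in> space \<mu>. c \<le> \<bar>\<nu> \<bullet> \<theta>\<bar>} \<in> sets \<mu>" by measurable
    then show ?thesis by (simp add: G_def S)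
  qed
  have cp: "c powr (2 * s) = lam / (2 * Lam)" using assms by (simp add: c_def powr_powr)
  have "ennreal lam \<le> (\<integral>\<^sup>+\<theta>. ennreal (\<bar>\<nu> \<bullet> \<theta>\<bar> powr (2 * s)) \<partial>\<mu>)"
    using sp assms unfolding spectral_measure_def by (auto simp: le_INF_iff)
  also have "\<dots> \<le> (\<integral>\<^sup>+\<theta>. ennreal (c powr (2 * s)) + indicator G \<theta> \<partial>\<mu>)"
  proof (rule nn_integral_mono)
    fix \<theta> assume "\<theta> \<in> space \<mu>"
    then have th: "norm \<theta> = 1" by (simp add: S)
    then have "\<bar>\<nu> \<bullet> \<theta>\<bar> \<le> 1" using Cauchy_Schwarz_ineq2[of \<nu> \<theta>] assms by simp
    then have 1: "\<bar>\<nu> \<bullet> \<theta>\<bar> powr (2 * s) \<le> 1" using assms by (intro powr_le1) auto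
    show "ennreal (\<bar>\<nu> \<bullet> \<theta>\<bar> powr (2 * s)) \<le> ennreal (c powr (2 * s)) + indicator G \<theta>"
    proof (cases "\<theta> \<in> G")
      case True
      have "ennreal (\<bar>\<nu> \<bullet> \<theta>\<bar> powr (2 * s)) \<le> 1" using 1 by (simp add: ennreal_le_1)
      then show ?thesis using True by (simp add: add_increasing)
    next
      case False
      then have "\<bar>\<nu> \<bullet> \<theta>\<bar> \<le> c" using th by (auto simp: G_def)
      then have "\<bar>\<nu> \<bullet> \<theta>\<bar> powr (2 * s) \<le> c powr (2 * s)"
        using assms by (intro powr_mono2) auto
      then show ?thesis using False by (simp add: ennreal_leI)
    qed
  qed
  also have "\<dots> = ennreal (c powr (2 * s)) * emeasure \<mu> (sphere 0 1) + emeasure \<mu> G"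
    using nn_integral_indicator[OF G] by (subst nn_integral_add) (simp_all add: S(2))
  also have "\<dots> \<le> ennreal (lam / 2) + ennreal (measure \<mu> G)"
  proof (intro add_mono)
    have "ennreal (c powr (2 * s)) * emeasure \<mu> (sphere 0 1) \<le> ennreal (c powr (2 * s)) * ennreal Lam"
      using sp by (intro mult_left_mono) (auto simp: spectral_measure_def)
    also have "\<dots> = ennreal (lam / 2)" using assms by (simp add: cp ennreal_mult[symmetric])
    finally show "ennreal (c powr (2 * s)) * emeasure \<mu> (sphere 0 1) \<le> ennreal (lam / 2)" .
  qed (simp add: emeasure_eq_measure)
  finally have "lam \<le> lam / 2 + measure \<mu> G"
    using assms by (simp add: ennreal_plus[symmetric] del: ennreal_plus)
  then show ?thesis by (simp add: G_def c_def)
qed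

section \<open>Directional integrals: linearity, scaling and upper bounds of the slice
  operator\<close>

definition slice_integrand :: "real \<Rightarrow> ('a::real_vector \<Rightarrow> real) \<Rightarrow> 'a \<Rightarrow> 'a \<Rightarrow> real \<Rightarrow> real" where
  "slice_integrand s w x \<theta> r = D2 w x (r *\<^sub>R \<theta>) / \<bar>r\<bar> powr (1 + 2 * s)"

lemma slice_op_alt: "slice_op s \<mu> w x = (\<integral>\<theta>. (\<integral>r. slice_integrand s w x \<theta> r \<partial>lborel) \<partial>\<mu>)"
  by (simp add: slice_op_def slice_integrand_def)

lemma slice_integrand_bound:
  assumes "\<And>x. \<bar>w x\<bar> \<le> P" "\<And>x h. \<bar>D2 w x h\<bar> \<le> Q * (norm h)\<^sup>2" "norm \<theta> = 1"
  shows "\<bar>slice_integrand s w x \<theta> r\<bar> \<le> kernel_majorant s 1 Q (4 * P) 0 r"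
proof (cases "r = 0")
  case False
  have "\<bar>D2 w x (r *\<^sub>R \<theta>)\<bar> \<le> Q * r\<^sup>2"
    using assms(2)[of x "r *\<^sub>R \<theta>"] assms(3) by simp
  moreover have "\<bar>D2 w x (r *\<^sub>R \<theta>)\<bar> \<le> 4 * P"
    using assms(1)[of x] assms(1)[of "x + r *\<^sub>R \<theta>"] assms(1)[of "x - r *\<^sub>R \<theta>"] unfolding D2_def
    by linarith
  ultimately show ?thesis using False
    by (simp add: slice_integrand_def kernel_majorant_def divide_right_mono)
qed (simp add: slice_integrand_def kernel_majorant_def)

lemma
  fixes w :: "'a::euclidean_space \<Rightarrow> real"
  assumes w: "c11 w" and s: "0 < s" "s < 1"
  shows slice_integrand_integrable: "norm \<theta> = 1 \<Longrightarrow> integrable lborel (slice_integrand s w x \<theta>)"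
    and slice_integrand_integral_integrable:
      "spectral_measure s lam Lam \<mu> \<Longrightarrow> 0 \<le> Lam \<Longrightarrow> integrable \<mu> (\<lambda>\<theta>. \<integral>r. slice_integrand s w x \<theta> r \<partial>lborel)"
proof -
  obtain P Q where *: "\<And>x. \<bar>w x\<bar> \<le> P" "\<And>x h. \<bar>D2 w x h\<bar> \<le> Q * (norm h)\<^sup>2"
    and cont: "continuous_on UNIV w"
    using w unfolding c11_def by blast
  have [measurable]: "w \<in> borel_measurable borel" using cont by (rule borel_measurable_continuous_onI)
  have P: "0 \<le> 4 * P" using *(1)[of 0] by simp
  obtain b :: 'a where "b \<in> Basis" using nonempty_Basis by blast
  then have Q: "0 \<le> Q" using *(2)[of 0 b] by simp
  define K where "K = 2 * (Q * 1 powr (2 - 2 * s) / (2 - 2 * s) + (4 * P) * 1 powr (0 - 2 * s) / (2 * s - 0))"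
  have K: "has_bochner_integral lborel (kernel_majorant s 1 Q (4 * P) 0) K"
    unfolding K_def using kernel_majorant_integral[of s 1 Q "4 * P" 0] s P Q by simp
  show int: "integrable lborel (slice_integrand s w x \<theta>)" if th: "norm \<theta> = 1" for \<theta>
  proof (rule Bochner_Integration.integrable_bound)
    show "integrable lborel (kernel_majorant s 1 Q (4 * P) 0)" using K by (simp add: has_bochner_integral_iff)
    show "slice_integrand s w x \<theta> \<in> borel_measurable lborel"
      unfolding slice_integrand_def D2_def by measurable
    show "AE r in lborel. norm (slice_integrand s w x \<theta> r) \<le> norm (kernel_majorant s 1 Q (4 * P) 0 r)"
      using order_trans[OF slice_integrand_bound[OF * th] abs_ge_self] by (intro AE_I2) simp
  qed
  show "integrable \<mu> (\<lambda>\<theta>. \<integral>r. slice_integrand s w x \<theta> r \<partial>lborel)"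
    if sp: "spectral_measure s lam Lam \<mu>" and Lam: "0 \<le> Lam"
  proof -
    note S = spectral_measureD[OF sp Lam]
    interpret finite_measure \<mu> by (rule S)
    note [measurable] = spectral_measure_id_measurable[OF sp]
    show ?thesis
    proof (rule integrable_const_bound[where B = K])
      show "(\<lambda>\<theta>. \<integral>r. slice_integrand s w x \<theta> r \<partial>lborel) \<in> borel_measurable \<mu>"
        unfolding slice_integrand_def D2_def by measurable
      show "AE \<theta> in \<mu>. norm (\<integral>r. slice_integrand s w x \<theta> r \<partial>lborel) \<le> K"
      proof (rule AE_I2)
        fix \<theta> assume "\<theta> \<in> space \<mu>"
        then have th: "norm \<theta> = 1" by (simp add: S)
        have "norm (\<integral>r. slice_integrand s w x \<theta> r \<partial>lborel) \<le> (\<integral>r. kernel_majorant s 1 Q (4 * P) 0 r \<partial>lborel)"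
          using slice_integrand_bound[OF * th] int[OF th] K
          by (intro order_trans[OF integral_norm_bound] integral_mono) (auto simp: has_bochner_integral_iff)
        then show "norm (\<integral>r. slice_integrand s w x \<theta> r \<partial>lborel) \<le> K"
          using K by (simp add: has_bochner_integral_iff)
      qed
    qed
  qed
qed

lemma slice_op_linear_comb:
  fixes w1 w2 :: "'a::euclidean_space \<Rightarrow> real"
  assumes "c11 w1" "c11 w2" "0 < s" "s < 1" "spectral_measure s lam Lam \<mu>" "0 \<le> Lam"
  shows "slice_op s \<mu> (\<lambda>x. a * w1 x + b * w2 x) x = a * slice_op s \<mu> w1 x + b * slice_op s \<mu> w2 x"
proof -
  note S = spectral_measureD[OF assms(5,6)]
  have lin: "slice_integrand s (\<lambda>x. a * w1 x + b * w2 x) x \<theta> r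
    = a * slice_integrand s w1 x \<theta> r + b * slice_integrand s w2 x \<theta> r" for \<theta> r
    by (simp add: D2_def slice_integrand_def algebra_simps add_divide_distrib diff_divide_distrib)
  have "slice_op s \<mu> (\<lambda>x. a * w1 x + b * w2 x) x
    = (\<integral>\<theta>. a * (\<integral>r. slice_integrand s w1 x \<theta> r \<partial>lborel) + b * (\<integral>r. slice_integrand s w2 x \<theta> r \<partial>lborel) \<partial>\<mu>)"
    unfolding slice_op_alt lin
    by (rule Bochner_Integration.integral_cong) (use assms in \<open>auto simp: S slice_integrand_integrable\<close>)
  also have "\<dots> = a * slice_op s \<mu> w1 x + b * slice_op s \<mu> w2 x"
    unfolding slice_op_alt using assms by (simp add: slice_integrand_integral_integrable)
  finally show ?thesis .
qed

lemma slice_op_affine: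
  fixes w :: "'a::euclidean_space \<Rightarrow> real"
  assumes "c \<noteq> 0"
  shows "slice_op s \<mu> (\<lambda>x. w (y + c *\<^sub>R x)) x = \<bar>c\<bar> powr (2 * s) * slice_op s \<mu> w (y + c *\<^sub>R x)"
proof -
  have "(\<integral>r. slice_integrand s (\<lambda>x. w (y + c *\<^sub>R x)) x \<theta> r \<partial>lborel)
     = \<bar>c\<bar> powr (2 * s) * (\<integral>r. slice_integrand s w (y + c *\<^sub>R x) \<theta> r \<partial>lborel)" for \<theta>
  proof -
    have "slice_integrand s w (y + c *\<^sub>R x) \<theta> (0 + c * r)
      = slice_integrand s (\<lambda>x. w (y + c *\<^sub>R x)) x \<theta> r / \<bar>c\<bar> powr (1 + 2 * s)" for r
      by (simp add: slice_integrand_def D2_def abs_mult powr_mult algebra_simps)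
    then have "(\<integral>r. slice_integrand s w (y + c *\<^sub>R x) \<theta> r \<partial>lborel)
       = \<bar>c\<bar> * ((\<integral>r. slice_integrand s (\<lambda>x. w (y + c *\<^sub>R x)) x \<theta> r \<partial>lborel) / \<bar>c\<bar> powr (1 + 2 * s))"
      using lborel_integral_real_affine[OF assms, of "slice_integrand s w (y + c *\<^sub>R x) \<theta>" 0] by simp
    moreover have "\<bar>c\<bar> powr (1 + 2 * s) = \<bar>c\<bar> * \<bar>c\<bar> powr (2 * s)"
      using assms by (simp add: powr_add)
    ultimately show ?thesis using assms by simp
  qed
  then show ?thesis unfolding slice_op_alt by simp
qed

text \<open>The term with \<kappa> records a gain available only for directions in G. Since only the
  upper bound \<open>Lam\<close> for the total mass is known, B has to be nonnegative.\<close>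

lemma slice_op_le:
  fixes w :: "'a::euclidean_space \<Rightarrow> real"
  assumes w: "c11 w" and s: "0 < s" "s < 1" and sp: "spectral_measure s lam Lam \<mu>" and Lam: "0 \<le> Lam"
    and G: "G \<in> sets \<mu>" and B: "0 \<le> B"
    and le: "\<And>\<theta>. norm \<theta> = 1 \<Longrightarrow> (\<integral>r. slice_integrand s w x \<theta> r \<partial>lborel) \<le> B - \<kappa> * indicator G \<theta>"
  shows "slice_op s \<mu> w x \<le> Lam * B - \<kappa> * measure \<mu> G"
proof -
  note S = spectral_measureD[OF sp Lam]
  interpret finite_measure \<mu> by (rule S)
  have "slice_op s \<mu> w x \<le> (\<integral>\<theta>. B - \<kappa> * indicator G \<theta> \<partial>\<mu>)"
    unfolding slice_op_alt
    by (rule integral_mono) (use assms S in \<open>auto intro!: slice_integrand_integral_integrable simp: emeasure_finite less_top[symmetric]\<close>)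
  also have "\<dots> = measure \<mu> (sphere 0 1) * B - \<kappa> * measure \<mu> G"
    using G sets.sets_into_space[OF G]
    by (subst Bochner_Integration.integral_diff) (auto simp: S(2) less_top[symmetric] Int_absorb2)
  also have "\<dots> \<le> Lam * B - \<kappa> * measure \<mu> G" using S(4) B by (simp add: mult_right_mono)
  finally show ?thesis .
qed

section \<open>From second differences to increments in space and time\<close>

text \<open>Twice the increment at h equals the increment at 2h minus the second difference at x + h
  with step h. Descending through dyadic scales, each halving multiplies the bound for the increment
  by 1/2, while \<beta> < 1 allows the larger factor \<open>2 powr (- \<beta>)\<close>; the surplus
  pays for the second difference.\<close>

lemma holder_of_D2:
  fixes p :: "'a::real_normed_vector \<Rightarrow> real"
  assumes \<beta>: "0 < \<beta>" "\<beta> < 1" "\<beta> \<le> \<gamma>" and \<rho>: "0 < \<rho>" "\<rho> \<le> 1" and H: "0 \<le> H"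
    and P: "\<And>y. y \<in> cball x (2 * \<rho>) \<Longrightarrow> \<bar>p y\<bar> \<le> P"
    and D: "\<And>y h. y \<in> cball x (2 * \<rho>) \<Longrightarrow> norm h \<le> \<rho> \<Longrightarrow> \<bar>D2 p y h\<bar> \<le> H * norm h powr \<gamma>"
    and h: "norm h \<le> \<rho>"
  shows "\<bar>p (x + h) - p x\<bar> \<le> (4 * P / \<rho> + H / (2 - 2 powr \<beta>)) * norm h powr \<beta>"
proof -
  define K where "K = 4 * P / \<rho> + H / (2 - 2 powr \<beta>)"
  have b2: "2 powr \<beta> < (2::real)" using powr_less_mono[of \<beta> 1 2] \<beta> by simp
  have P0: "0 \<le> P" using P[of x] \<rho> by (smt (verit) centre_in_cball zero_le_mult_iff)
  have K1: "4 * P / \<rho> \<le> K" unfolding K_def using H b2 by simp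
  \<comment> \<open>This inequality closes the induction over the scales. The other summand of K
    settles the scales between \<rho>/2 and \<rho>, where only the sup bound P is used.\<close>
  have K2: "K * 2 powr \<beta> + H \<le> 2 * K"
  proof -
    have "H = H / (2 - 2 powr \<beta>) * (2 - 2 powr \<beta>)" using b2 by simp
    also have "\<dots> \<le> K * (2 - 2 powr \<beta>)" unfolding K_def using b2 P0 \<rho> by (intro mult_right_mono) auto
    finally show ?thesis by (simp add: algebra_simps)
  qed
  have main: "\<bar>p (x + h) - p x\<bar> \<le> K * norm h powr \<beta>" if "norm h \<le> \<rho>" "\<rho> / 2 ^ Suc k < norm h" for k h
    using that
  proof (induction k arbitrary: h)
    case 0
    have "\<bar>p (x + h) - p x\<bar> \<le> 2 * P" using P[of "x + h"] P[of x] 0 \<rho> by (simp add: dist_norm)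
    also have "\<dots> = (4 * P / \<rho>) * (\<rho> / 2)" using \<rho> by simp
    also have "\<dots> \<le> (4 * P / \<rho>) * norm h powr \<beta>"
    proof (rule mult_left_mono)
      have "\<rho> / 2 \<le> norm h powr 1" using 0 \<rho> by simp
      also have "\<dots> \<le> norm h powr \<beta>" using 0 \<rho> \<beta> by (intro powr_mono') auto
      finally show "\<rho> / 2 \<le> norm h powr \<beta>" .
    qed (use P0 \<rho> in simp)
    also have "\<dots> \<le> K * norm h powr \<beta>" using K1 by (rule mult_right_mono) simp
    finally show ?case .
  next
    case (Suc k)
    show ?case
    proof (cases "norm h \<le> \<rho> / 2")
      case True
      have "\<bar>p (x + 2 *\<^sub>R h) - p x\<bar> \<le> K * norm (2 *\<^sub>R h) powr \<beta>"
        using Suc True by (intro Suc.IH) (auto simp: field_simps)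
      then have 1: "\<bar>p (x + 2 *\<^sub>R h) - p x\<bar> \<le> K * 2 powr \<beta> * norm h powr \<beta>"
        by (simp add: powr_mult)
      have "\<bar>D2 p (x + h) h\<bar> \<le> H * norm h powr \<gamma>"
        using True \<rho> by (intro D) (auto simp: dist_norm)
      also have "\<dots> \<le> H * norm h powr \<beta>"
        using Suc.prems \<rho> \<beta> H by (intro mult_left_mono powr_mono') auto
      finally have 2: "\<bar>D2 p (x + h) h\<bar> \<le> H * norm h powr \<beta>" .
      have "D2 p (x + h) h = p (x + 2 *\<^sub>R h) + p x - 2 * p (x + h)"
        by (simp add: D2_def scaleR_2 algebra_simps)
      then have "2 * \<bar>p (x + h) - p x\<bar> \<le> K * 2 powr \<beta> * norm h powr \<beta> + H * norm h powr \<beta>"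
        using 1 2 by (smt (verit))
      also have "\<dots> \<le> 2 * K * norm h powr \<beta>"
        using mult_right_mono[OF K2, of "norm h powr \<beta>"] by (simp add: algebra_simps)
      finally show ?thesis by simp
    next
      case False
      have "K * norm h powr \<beta> \<ge> 2 * P"
      proof -
        have "2 * P = (4 * P / \<rho>) * (\<rho> / 2)" using \<rho> by simp
        also have "\<dots> \<le> (4 * P / \<rho>) * norm h powr \<beta>"
        proof (rule mult_left_mono)
          have "\<rho> / 2 \<le> norm h powr 1" using False \<rho> by simp
          also have "\<dots> \<le> norm h powr \<beta>" using Suc.prems \<rho> \<beta> by (intro powr_mono') auto
          finally show "\<rho> / 2 \<le> norm h powr \<beta>" .
        qed (use P0 \<rho> in simp)
        also have "\<dots> \<le> K * norm h powr \<beta>" using K1 by (rule mult_right_mono) simp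
        finally show ?thesis .
      qed
      then show ?thesis using P[of "x + h"] P[of x] Suc.prems \<rho> by (simp add: dist_norm)
    qed
  qed
  show ?thesis
  proof (cases "h = 0")
    case False
    then obtain k where "\<rho> / norm h < 2 ^ k" using real_arch_pow[of 2] by auto
    then have "\<rho> / 2 ^ k < norm h" using False by (simp add: field_simps)
    moreover have "\<rho> / 2 ^ Suc k \<le> \<rho> / 2 ^ k" using \<rho> by (simp add: field_simps)
    ultimately show ?thesis using main[OF h, of k] by (simp add: K_def)
  qed simp
qed

text \<open>Only earlier times are compared, because a maximum over a space-time cylinder may sit at
  the final time.\<close>

lemma deriv_nonneg_of_left_max:
  fixes f :: "real \<Rightarrow> real"
  assumes "(f has_real_derivative d) (at t)" "t1 < t" "\<And>\<tau>. t1 \<le> \<tau> \<Longrightarrow> \<tau> \<le> t \<Longrightarrow> f \<tau> \<le> f t"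
  shows "0 \<le> d"
proof (rule ccontr)
  assume "\<not> 0 \<le> d"
  then obtain e where e: "0 < e" "\<And>h. 0 < h \<Longrightarrow> h < e \<Longrightarrow> f t < f (t - h)"
    using DERIV_neg_dec_left[OF assms(1)] by auto
  define h where "h = min (e / 2) ((t - t1) / 2)"
  have "0 < h" "h < e" "t1 \<le> t - h" using e assms by (auto simp: h_def min_def field_simps)
  then show False using e(2)[of h] assms(3)[of "t - h"] by auto
qed

text \<open>The integral of \<open>kernel_majorant s (1/2) 8 1 \<gamma>\<close>: the second
  difference of a paraboloid of opening 4 up to half the radius, growth of order \<gamma> beyond.
  The general radius and the factor H enter by scaling.\<close>

definition time_const :: "real \<Rightarrow> real \<Rightarrow> real" where
  "time_const s \<gamma> = 2 * (8 * (1/2) powr (2 - 2 * s) / (2 - 2 * s) + (1/2) powr (\<gamma> - 2 * s) / (2 * s - \<gamma>))"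

lemma time_const_nonneg: "0 < s \<Longrightarrow> s < 1 \<Longrightarrow> \<gamma> < 2 * s \<Longrightarrow> 0 \<le> time_const s \<gamma>"
  by (simp add: time_const_def)

lemma norm_parallelogram:
  fixes x y :: "'a::real_inner"
  shows "(norm (x + y))\<^sup>2 + (norm (x - y))\<^sup>2 = 2 * (norm x)\<^sup>2 + 2 * (norm y)\<^sup>2"
  unfolding power2_norm_eq_inner by (simp add: inner_simps inner_commute)

text \<open>Comparison with a paraboloid that rises in time at speed c. If the maximum of the
  difference lies at the initial time, the claim follows, the oscillation of the even part giving H
  \<rho>^\<gamma> / 2. At a later maximum the equation bounds c from above by a value that c exceeds
  by choice.\<close>

lemma time_increment_upper:
  fixes W :: "real \<Rightarrow> 'a::euclidean_space \<Rightarrow> real"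
  assumes s: "0 < s" "s < 1" and \<gamma>: "0 < \<gamma>" "\<gamma> < 2 * s"
    and sp: "spectral_measure s lam Lam \<mu>" and Lam: "0 \<le> Lam"
    and t: "t1 \<le> t2" and \<rho>: "0 < \<rho>" and H: "0 < H"
    and c11: "\<And>t. t \<in> {t1..t2} \<Longrightarrow> c11 (W t)"
    and cont: "continuous_on ({t1..t2} \<times> UNIV) (\<lambda>(t, x). W t x)"
    and eq: "\<And>t y. t \<in> {t1..t2} \<Longrightarrow> y \<in> cball x \<rho> \<Longrightarrow>
        ((\<lambda>t. W t y) has_real_derivative (slice_op s \<mu> (W t) y + F t y)) (at t)"
    and F: "\<And>t y. t \<in> {t1..t2} \<Longrightarrow> y \<in> cball x \<rho> \<Longrightarrow> \<bar>F t y\<bar> \<le> A"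
    and D: "\<And>t y h. t \<in> {t1..t2} \<Longrightarrow> y \<in> cball x \<rho> \<Longrightarrow> \<bar>D2 (W t) y h\<bar> \<le> H * norm h powr \<gamma>"
  shows "W t2 x - W t1 x \<le> H * \<rho> powr \<gamma> / 2 + (Lam * time_const s \<gamma> * H * \<rho> powr (\<gamma> - 2 * s) + A) * (t2 - t1)"
proof -
  have A: "0 \<le> A" using F[of t1 x] t \<rho> by auto
  define B where "B = time_const s \<gamma> * H * \<rho> powr (\<gamma> - 2 * s)"
  have B: "0 \<le> B" unfolding B_def using time_const_nonneg[of s \<gamma>] s \<gamma> H by simp
  \<comment> \<open>Without a gradient bound only the even part of W about x is close to its centre value; it solves the same equation.\<close>
  define U where "U = (\<lambda>t y. 1/2 * W t (x + 1 *\<^sub>R y) + 1/2 * W t (x + (-1) *\<^sub>R y))"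
  \<comment> \<open>Chosen so that q \<rho>^2 = H \<rho>^\<gamma>. On the lateral boundary the
    penalty 4 q \<rho>^2 is then eight times the oscillation bound H \<rho>^\<gamma> / 2 of U, which
    confines a maximum after the initial time to the ball of radius \<rho>/2.\<close>
  define q where "q = H * \<rho> powr (\<gamma> - 2)"
  have q: "0 < q" using H \<rho> by (simp add: q_def)
  have q\<rho>: "q * \<rho>\<^sup>2 = H * \<rho> powr \<gamma>"
  proof -
    have "\<rho>\<^sup>2 = \<rho> powr 2" using \<rho> by (simp add: powr_numeral)
    moreover have "\<rho> powr (\<gamma> - 2) * \<rho> powr 2 = \<rho> powr \<gamma>"
      by (simp only: powr_add[symmetric]) simp
    ultimately show ?thesis by (simp only: q_def mult.assoc)
  qed
  have c11U: "c11 (U t)" if "t \<in> {t1..t2}" for t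
    unfolding U_def using c11[OF that] by (intro c11_linear_comb c11_affine)
  have U0: "U t 0 = W t x" for t by (simp add: U_def)
  have Udiff: "\<bar>U t y - U t 0\<bar> \<le> H * norm y powr \<gamma> / 2" if "t \<in> {t1..t2}" for t y
  proof -
    have eq: "U t y - U t 0 = D2 (W t) x y / 2" by (simp add: U_def D2_def field_simps)
    show ?thesis unfolding eq using D[OF that, of x y] \<rho> by simp
  qed
  have *: "W t2 x - W t1 x \<le> H * \<rho> powr \<gamma> / 2 + (Lam * B + A + e) * (t2 - t1)" if e: "0 < e" for e
  proof -
    \<comment> \<open>The excess e makes the inequality at a later maximum contradictory; it is sent
      to 0 at the end.\<close>
    define c where "c = Lam * B + A + e"
    define \<Phi> where "\<Phi> = (\<lambda>(t, y). U t y - 4 * q * (norm y)\<^sup>2 - c * (t - t1))"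
    have contU: "continuous_on ({t1..t2} \<times> cball 0 \<rho>) (\<lambda>(t, y). U t y)"
    proof -
      have "continuous_on ({t1..t2} \<times> cball 0 \<rho>) (\<lambda>z. W (fst z) (x + c *\<^sub>R snd z))" for c
        by (rule continuous_on_compose2[OF cont, of _ "\<lambda>z. (fst z, x + c *\<^sub>R snd z)", simplified])
          (auto intro!: continuous_intros)
      then show ?thesis unfolding U_def case_prod_beta by (intro continuous_intros)
    qed
    have "continuous_on ({t1..t2} \<times> cball 0 \<rho>) \<Phi>"
      using contU unfolding \<Phi>_def case_prod_beta by (intro continuous_intros)
    moreover have "compact ({t1..t2} \<times> cball (0::'a) \<rho>)" by (intro compact_Times) auto
    moreover have "{t1..t2} \<times> cball (0::'a) \<rho> \<noteq> {}" using t \<rho> by auto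
    ultimately obtain z where z: "z \<in> {t1..t2} \<times> cball 0 \<rho>" "\<And>z'. z' \<in> {t1..t2} \<times> cball 0 \<rho> \<Longrightarrow> \<Phi> z' \<le> \<Phi> z"
      using continuous_attains_sup[of "{t1..t2} \<times> cball 0 \<rho>" \<Phi>] by blast
    obtain \<tau> y where zz: "z = (\<tau>, y)" by fastforce
    have \<tau>: "\<tau> \<in> {t1..t2}" and y: "norm y \<le> \<rho>" using z zz by auto
    have max: "U t y' - 4 * q * (norm y')\<^sup>2 - c * (t - t1) \<le> U \<tau> y - 4 * q * (norm y)\<^sup>2 - c * (\<tau> - t1)"
      if "t \<in> {t1..t2}" "norm y' \<le> \<rho>" for t y'
      using z(2)[of "(t, y')"] that by (simp add: \<Phi>_def zz)
    have ypow: "H * norm y powr \<gamma> \<le> H * \<rho> powr \<gamma>"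
      using y \<rho> \<gamma> H by (intro mult_left_mono powr_mono2) auto
    show ?thesis
    proof (cases "\<tau> = t1")
      case True
      have "U t2 0 - c * (t2 - t1) \<le> U t1 y - 4 * q * (norm y)\<^sup>2" using max[of t2 0] True t \<rho> by simp
      also have "\<dots> \<le> U t1 0 + H * \<rho> powr \<gamma> / 2"
      proof -
        have "0 \<le> 4 * q * (norm y)\<^sup>2" using q by simp
        then show ?thesis using abs_le_D1[OF Udiff[of t1 y]] ypow t by auto
      qed
      finally show ?thesis by (simp add: U0 c_def)
    next
      case False
      then have \<tau>1: "t1 < \<tau>" using \<tau> by auto
      have "4 * q * (norm y)\<^sup>2 \<le> U \<tau> y - U \<tau> 0" using max[OF \<tau>, of 0] \<rho> by simp
      also have "\<dots> \<le> q * \<rho>\<^sup>2 / 2" using abs_le_D1[OF Udiff[OF \<tau>, of y]] ypow q\<rho> by linarith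
      finally have "4 * q * (norm y)\<^sup>2 \<le> q * \<rho>\<^sup>2 / 2" .
      moreover have "q * (8 * (norm y)\<^sup>2) = 2 * (4 * q * (norm y)\<^sup>2)" by simp
      ultimately have "q * (8 * (norm y)\<^sup>2) \<le> q * \<rho>\<^sup>2" by linarith
      then have "8 * (norm y)\<^sup>2 \<le> \<rho>\<^sup>2" using q by (rule mult_left_le_imp_le)
      then have "(norm y)\<^sup>2 \<le> (\<rho> / 2)\<^sup>2"
      proof -
        have "(\<rho> / 2)\<^sup>2 = \<rho>\<^sup>2 / 4" by (simp add: power_divide)
        moreover have "0 \<le> (norm y)\<^sup>2" by simp
        ultimately show ?thesis using \<open>8 * (norm y)\<^sup>2 \<le> \<rho>\<^sup>2\<close> by linarith
      qed
      then have y2: "norm y \<le> \<rho> / 2" by (rule power2_le_imp_le) (use \<rho> in simp)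
      have xy: "x + y \<in> cball x \<rho>" "x - y \<in> cball x \<rho>" using y by (auto simp: dist_norm)
      have slU: "slice_op s \<mu> (U \<tau>) y = 1/2 * slice_op s \<mu> (W \<tau>) (x + y) + 1/2 * slice_op s \<mu> (W \<tau>) (x - y)"
      proof -
        have "slice_op s \<mu> (U \<tau>) y = 1/2 * slice_op s \<mu> (\<lambda>y. W \<tau> (x + 1 *\<^sub>R y)) y + 1/2 * slice_op s \<mu> (\<lambda>y. W \<tau> (x + (-1) *\<^sub>R y)) y"
          unfolding U_def using c11[OF \<tau>] s sp Lam by (intro slice_op_linear_comb c11_affine)
        then show ?thesis by (subst (asm) (1 2) slice_op_affine) auto
      qed
      have "((\<lambda>t. U t y - c * t) has_real_derivative
          (1/2 * (slice_op s \<mu> (W \<tau>) (x + y) + F \<tau> (x + y)) + 1/2 * (slice_op s \<mu> (W \<tau>) (x - y) + F \<tau> (x - y)) - c)) (at \<tau>)"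
        unfolding U_def using eq[OF \<tau> xy(1)] eq[OF \<tau> xy(2)]
        by (auto intro!: derivative_eq_intros simp: field_simps)
      from deriv_nonneg_of_left_max[OF this \<tau>1]
      have "0 \<le> 1/2 * (slice_op s \<mu> (W \<tau>) (x + y) + F \<tau> (x + y)) + 1/2 * (slice_op s \<mu> (W \<tau>) (x - y) + F \<tau> (x - y)) - c"
        using max[of _ y] y \<tau> by (simp add: algebra_simps)
      then have c1: "c \<le> slice_op s \<mu> (U \<tau>) y + A"
        unfolding slU using F[OF \<tau> xy(1)] F[OF \<tau> xy(2)] by argo
      have K: "has_bochner_integral lborel (kernel_majorant s (\<rho> / 2) (8 * q) H \<gamma>) B"
      proof -
        have "2 * (8 * q * (\<rho> / 2) powr (2 - 2 * s) / (2 - 2 * s) + H * (\<rho> / 2) powr (\<gamma> - 2 * s) / (2 * s - \<gamma>)) = B"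
        proof -
          have 1: "(\<rho> / 2) powr a = (1/2) powr a * \<rho> powr a" for a using \<rho> powr_mult[of "1/2" \<rho> a]
            by simp
          have 2: "q * \<rho> powr (2 - 2 * s) = H * \<rho> powr (\<gamma> - 2 * s)"
            using \<rho> by (simp add: q_def powr_add[symmetric])
          have "8 * q * (\<rho> / 2) powr (2 - 2 * s) = 8 * (1/2) powr (2 - 2 * s) * (q * \<rho> powr (2 - 2 * s))"
            by (simp add: 1)
          then show ?thesis unfolding 2 1 B_def time_const_def by (simp add: algebra_simps add_divide_distrib)
        qed
        then show ?thesis using kernel_majorant_integral[of s "\<rho>/2" "8 * q" H \<gamma>] s \<gamma> \<rho> q H by simp
      qed
      have "slice_op s \<mu> (U \<tau>) y \<le> Lam * B - 0 * measure \<mu> {}"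
      proof (rule slice_op_le[OF c11U[OF \<tau>] s sp Lam _ B])
        fix \<theta> :: 'a assume th: "norm \<theta> = 1"
        have "(\<integral>r. slice_integrand s (U \<tau>) y \<theta> r \<partial>lborel) \<le> (\<integral>r. kernel_majorant s (\<rho> / 2) (8 * q) H \<gamma> r \<partial>lborel)"
        proof (rule integral_mono)
          show "integrable lborel (slice_integrand s (U \<tau>) y \<theta>)"
            by (rule slice_integrand_integrable[OF c11U[OF \<tau>] s th])
          show "integrable lborel (kernel_majorant s (\<rho> / 2) (8 * q) H \<gamma>)"
            using K by (simp add: has_bochner_integral_iff)
          fix r
          \<comment> \<open>Jumps of length at most \<rho>/2 stay in the ball where y maximises, so
            the second difference of U is at most that of the paraboloid, 8 q r^2. Longer jumps
            leave the ball and are controlled by the growth hypothesis.\<close>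
          show "slice_integrand s (U \<tau>) y \<theta> r \<le> kernel_majorant s (\<rho> / 2) (8 * q) H \<gamma> r"
          proof (cases "\<bar>r\<bar> \<le> \<rho> / 2")
            case True
            have n: "norm (y + r *\<^sub>R \<theta>) \<le> \<rho>" "norm (y - r *\<^sub>R \<theta>) \<le> \<rho>"
              using norm_triangle_ineq[of y "r *\<^sub>R \<theta>"] norm_triangle_ineq4[of y "r *\<^sub>R \<theta>"] y2 True th by auto
            have "(norm (y + r *\<^sub>R \<theta>))\<^sup>2 + (norm (y - r *\<^sub>R \<theta>))\<^sup>2 = 2 * (norm y)\<^sup>2 + 2 * r\<^sup>2"
              using norm_parallelogram[of y "r *\<^sub>R \<theta>"] th by simp
            then have "4 * q * (norm (y + r *\<^sub>R \<theta>))\<^sup>2 + 4 * q * (norm (y - r *\<^sub>R \<theta>))\<^sup>2 = 4 * q * (2 * (norm y)\<^sup>2 + 2 * r\<^sup>2)"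
              by (simp only: distrib_left[symmetric])
            with max[OF \<tau> n(1)] max[OF \<tau> n(2)]
            have "D2 (U \<tau>) y (r *\<^sub>R \<theta>) \<le> 4 * q * (2 * r\<^sup>2)"
              unfolding D2_def by (simp add: distrib_left)
            then show ?thesis using True by (simp add: slice_integrand_def kernel_majorant_def divide_right_mono)
          next
            case False
            have "D2 (U \<tau>) y (r *\<^sub>R \<theta>) = 1/2 * D2 (W \<tau>) (x + y) (r *\<^sub>R \<theta>) + 1/2 * D2 (W \<tau>) (x - y) (r *\<^sub>R \<theta>)"
              by (simp add: U_def D2_def algebra_simps)
            also have "\<dots> \<le> H * \<bar>r\<bar> powr \<gamma>"
              using D[OF \<tau> xy(1), of "r *\<^sub>R \<theta>"] D[OF \<tau> xy(2), of "r *\<^sub>R \<theta>"] th by simp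
            finally show ?thesis using False by (simp add: slice_integrand_def kernel_majorant_def divide_right_mono)
          qed
        qed
        also have "\<dots> = B" using K by (simp add: has_bochner_integral_iff)
        finally show "(\<integral>r. slice_integrand s (U \<tau>) y \<theta> r \<partial>lborel) \<le> B - 0 * indicator {} \<theta>" by simp
      qed simp
      with c1 e show ?thesis by (simp add: c_def)
    qed
  qed
  have "W t2 x - W t1 x \<le> H * \<rho> powr \<gamma> / 2 + (Lam * B + A) * (t2 - t1)"
  proof (rule field_le_epsilon)
    fix e :: real assume e: "0 < e"
    \<comment> \<open>The added 1 keeps the denominator positive when both times coincide.\<close>
    define e' where "e' = e / (1 + (t2 - t1))"
    have d: "0 < 1 + (t2 - t1)" using t by linarith
    then have e': "0 < e'" using e by (simp add: e'_def del: diff_add_eq add_diff_eq)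
    have "e' * (t2 - t1) \<le> e' * (1 + (t2 - t1))" using e' by (intro mult_left_mono) auto
    also have "\<dots> = e" unfolding e'_def using d by (intro nonzero_eq_divide_eq[THEN iffD1, OF _ refl]) linarith
    finally have le: "e' * (t2 - t1) \<le> e" .
    have "W t2 x - W t1 x \<le> H * \<rho> powr \<gamma> / 2 + ((Lam * B + A) * (t2 - t1) + e' * (t2 - t1))"
      using *[OF e'] by (simp only: distrib_right)
    also have "\<dots> \<le> H * \<rho> powr \<gamma> / 2 + ((Lam * B + A) * (t2 - t1) + e)"
      using le by (intro add_left_mono)
    finally show "W t2 x - W t1 x \<le> H * \<rho> powr \<gamma> / 2 + (Lam * B + A) * (t2 - t1) + e"
      by (simp only: add.assoc)
  qed
  then show ?thesis by (simp add: B_def mult.assoc)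
qed

lemma D2_uminus: "D2 (\<lambda>x. - w x) x h = - D2 w x h"
  by (simp add: D2_def)

lemma c11_uminus: "c11 w \<Longrightarrow> c11 (\<lambda>x. - w x)"
  using c11_linear_comb[of w w "-1" 0] by simp

lemma slice_op_uminus: "slice_op s \<mu> (\<lambda>x. - w x) x = - slice_op s \<mu> w x"
  by (simp add: slice_op_def D2_uminus)

lemma time_increment_bound:
  fixes W :: "real \<Rightarrow> 'a::euclidean_space \<Rightarrow> real"
  assumes s: "0 < s" "s < 1" and \<gamma>: "0 < \<gamma>" "\<gamma> < 2 * s"
    and sp: "spectral_measure s lam Lam \<mu>" and Lam: "0 \<le> Lam"
    and t: "t1 \<le> t2" and \<rho>: "0 < \<rho>" and H: "0 < H"
    and c11: "\<And>t. t \<in> {t1..t2} \<Longrightarrow> c11 (W t)"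
    and cont: "continuous_on ({t1..t2} \<times> UNIV) (\<lambda>(t, x). W t x)"
    and eq: "\<And>t y. t \<in> {t1..t2} \<Longrightarrow> y \<in> cball x \<rho> \<Longrightarrow>
        ((\<lambda>t. W t y) has_real_derivative (slice_op s \<mu> (W t) y + F t y)) (at t)"
    and F: "\<And>t y. t \<in> {t1..t2} \<Longrightarrow> y \<in> cball x \<rho> \<Longrightarrow> \<bar>F t y\<bar> \<le> A"
    and D: "\<And>t y h. t \<in> {t1..t2} \<Longrightarrow> y \<in> cball x \<rho> \<Longrightarrow> \<bar>D2 (W t) y h\<bar> \<le> H * norm h powr \<gamma>"
  shows "\<bar>W t2 x - W t1 x\<bar> \<le> H * \<rho> powr \<gamma> / 2 + (Lam * time_const s \<gamma> * H * \<rho> powr (\<gamma> - 2 * s) + A) * (t2 - t1)"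
proof -
  have "- W t2 x - (- W t1 x) \<le> H * \<rho> powr \<gamma> / 2 + (Lam * time_const s \<gamma> * H * \<rho> powr (\<gamma> - 2 * s) + A) * (t2 - t1)"
  proof (rule time_increment_upper[OF s \<gamma> sp Lam t \<rho> H, where W = "\<lambda>t x. - W t x" and F = "\<lambda>t x. - F t x"])
    show "continuous_on ({t1..t2} \<times> UNIV) (\<lambda>(t, x). - W t x)"
      using cont unfolding case_prod_beta by (intro continuous_intros)
    fix t y assume "t \<in> {t1..t2}" "y \<in> cball x \<rho>"
    from DERIV_minus[OF eq[OF this]]
    show "((\<lambda>t. - W t y) has_real_derivative slice_op s \<mu> (\<lambda>x. - W t x) y + - F t y) (at t)"
      by (simp add: slice_op_uminus)
  qed (use c11 F D in \<open>auto simp: D2_uminus c11_uminus\<close>)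
  moreover have "W t2 x - W t1 x \<le> H * \<rho> powr \<gamma> / 2 + (Lam * time_const s \<gamma> * H * \<rho> powr (\<gamma> - 2 * s) + A) * (t2 - t1)"
    by (rule time_increment_upper[OF assms])
  ultimately show ?thesis by linarith
qed

section \<open>Spreading of near extremality\<close>

text \<open>\<open>holder_of_D2\<close> requires an exponent below 1 that does not exceed \<gamma>.
  Only some modulus of continuity matters here, so 1/2 is an arbitrary choice.\<close>

definition holder_exp :: "real \<Rightarrow> real" where "holder_exp \<gamma> = min \<gamma> (1/2)"

text \<open>The constant of \<open>holder_of_D2\<close> at radius 1 for a second difference g with
  |g| \<le> 2. The 16 is (1 + 1 + 2) * 4: a second difference of g combines three second differences
  of W with these weights, each bounded with factor 4.\<close>

definition holder_const :: "real \<Rightarrow> real" where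
  "holder_const \<gamma> = 8 + 16 / (2 - 2 powr holder_exp \<gamma>)"

text \<open>The integral of \<open>kernel_majorant s a c2 4 0\<close>, which accounts for short and
  medium jumps, plus a bound for the jumps beyond R/2 that does not depend on R. Multiplied by
  \<delta> it bounds the positive part of a directional integral of g.\<close>

definition jump_const :: "real \<Rightarrow> real \<Rightarrow> real \<Rightarrow> real" where
  "jump_const s a c2 = 2 * (c2 * a powr (2 - 2 * s) / (2 - 2 * s) + 4 * a powr (0 - 2 * s) / (2 * s - 0)) + 64 / s"

lemma holder_exp: "0 < \<gamma> \<Longrightarrow> 0 < holder_exp \<gamma>" "holder_exp \<gamma> < 1" "holder_exp \<gamma> \<le> \<gamma>"
  by (auto simp: holder_exp_def)

lemma holder_const_pos: "0 < holder_const \<gamma>"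
proof -
  have "2 powr holder_exp \<gamma> < (2::real)"
    using powr_less_mono[of "holder_exp \<gamma>" 1 2] holder_exp(2)[of \<gamma>] by simp
  then show ?thesis unfolding holder_const_def by (intro add_pos_pos divide_pos_pos) auto
qed

text \<open>The normal form produced by the blow-up: the second difference in direction e at the origin competes with the
supremum of the normalised \<gamma>-quotient, which is at most 1 + \<delta>, on balls whose radius R is at least 1/\<delta>.\<close>

locale near_extremal =
  fixes s \<gamma> lam Lam :: real and \<mu> :: "'a::euclidean_space measure"
    and W F :: "real \<Rightarrow> 'a \<Rightarrow> real" and e :: 'a and \<delta> R :: real
  assumes s: "0 < s" "s < 1" and \<gamma>: "0 < \<gamma>" "\<gamma> < 2 * s"
    and lam: "0 < lam" "lam \<le> Lam"
    and sp: "spectral_measure s lam Lam \<mu>"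
    and e: "norm e = 1"
    and contW: "continuous_on UNIV (\<lambda>(t, x). W t x)"
    and c11W: "\<And>t. c11 (W t)"
    and \<delta>: "0 < \<delta>" "\<delta> \<le> 1/8" and R: "1 / \<delta> \<le> R"
    and eqW: "\<And>t x. t \<in> {-1..0} \<Longrightarrow> norm x \<le> R \<Longrightarrow>
      ((\<lambda>t. W t x) has_real_derivative (slice_op s \<mu> (W t) x + F t x)) (at t)"
    and F: "\<And>t x. t \<in> {-1..0} \<Longrightarrow> norm x \<le> R \<Longrightarrow> \<bar>F t x\<bar> \<le> \<delta>"
    and D2W: "\<And>t x h. t \<in> {-1..0} \<Longrightarrow> norm x \<le> R \<Longrightarrow> norm h \<le> R \<Longrightarrow>
      \<bar>D2 (W t) x h\<bar> \<le> (1 + \<delta>) * norm h powr \<gamma>"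
    and W_le: "\<And>t x. \<bar>W t x\<bar> \<le> \<delta> * R powr \<gamma>"
begin

definition g :: "real \<Rightarrow> 'a \<Rightarrow> real" where "g t x = D2 (W t) x e"

lemma Lam_nonneg: "0 \<le> Lam" using lam by simp

lemma R8: "8 \<le> R"
proof -
  have "8 \<le> 1 / \<delta>" using \<delta> by (simp add: field_simps)
  then show ?thesis using R by linarith
qed

lemma abs_g_le_one: "t \<in> {-1..0} \<Longrightarrow> norm x \<le> R \<Longrightarrow> \<bar>g t x\<bar> \<le> 1 + \<delta>"
  using D2W[of t x e] R8 by (simp add: g_def e)

lemma abs_D2W_le: "\<bar>D2 (W t) x h\<bar> \<le> 4 * \<delta> * R powr \<gamma>"
  using W_le[of t x] W_le[of t "x + h"] W_le[of t "x - h"] unfolding D2_def by linarith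

text \<open>For steps longer than R the sup bound takes over, because \<delta> R^\<gamma> is then at
  most |h|^\<gamma>.\<close>

lemma D2W_all:
  assumes "t \<in> {-1..0}" "norm x \<le> R"
  shows "\<bar>D2 (W t) x h\<bar> \<le> 4 * norm h powr \<gamma>"
proof (cases "norm h \<le> R")
  case True
  have "(1 + \<delta>) * norm h powr \<gamma> \<le> 4 * norm h powr \<gamma>" using \<delta> by (intro mult_right_mono) auto
  then show ?thesis using D2W[OF assms True] by linarith
next
  case False
  have "4 * \<delta> * R powr \<gamma> \<le> 4 * R powr \<gamma>" using \<delta> by (intro mult_right_mono) auto
  also have "\<dots> \<le> 4 * norm h powr \<gamma>" using False R8 \<gamma> by (intro mult_left_mono powr_mono2) auto
  finally show ?thesis using abs_D2W_le[of t x h] by linarith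
qed

lemma g_alt: "g t = (\<lambda>x. 1 * (1 * W t (e + 1 *\<^sub>R x) + 1 * W t (- e + 1 *\<^sub>R x)) + (-2) * W t x)"
  by (rule ext) (simp add: g_def D2_def algebra_simps)

lemma c11_g: "c11 (g t)"
  unfolding g_alt using c11W[of t] by (intro c11_linear_comb c11_affine)

lemma slice_op_g: "slice_op s \<mu> (g t) x = slice_op s \<mu> (W t) (x + e) + slice_op s \<mu> (W t) (x - e) - 2 * slice_op s \<mu> (W t) x"
proof -
  have "slice_op s \<mu> (g t) x = 1 * slice_op s \<mu> (\<lambda>x. 1 * W t (e + 1 *\<^sub>R x) + 1 * W t (- e + 1 *\<^sub>R x)) x + (-2) * slice_op s \<mu> (W t) x"
    unfolding g_alt using c11W[of t] s sp Lam_nonneg by (intro slice_op_linear_comb c11_linear_comb c11_affine)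
  also have "slice_op s \<mu> (\<lambda>x. 1 * W t (e + 1 *\<^sub>R x) + 1 * W t (- e + 1 *\<^sub>R x)) x
     = 1 * slice_op s \<mu> (\<lambda>x. W t (e + 1 *\<^sub>R x)) x + 1 * slice_op s \<mu> (\<lambda>x. W t (- e + 1 *\<^sub>R x)) x"
    using c11W[of t] s sp Lam_nonneg by (intro slice_op_linear_comb c11_linear_comb c11_affine)
  finally show ?thesis by (subst (asm) (1 2) slice_op_affine) (auto simp: algebra_simps)
qed

lemma g_derivative:
  assumes t: "t \<in> {-1..0}" and x: "norm x \<le> R - 1"
  shows "\<exists>d. ((\<lambda>t. g t x) has_real_derivative d) (at t) \<and> \<bar>d - slice_op s \<mu> (g t) x\<bar> \<le> 4 * \<delta>"
proof -
  have n: "norm (x + e) \<le> R" "norm (x - e) \<le> R" "norm x \<le> R"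
    using norm_triangle_ineq[of x e] norm_triangle_ineq4[of x e] x e by auto
  define d where "d = (slice_op s \<mu> (W t) (x + e) + F t (x + e)) + (slice_op s \<mu> (W t) (x - e) + F t (x - e))
     - 2 * (slice_op s \<mu> (W t) x + F t x)"
  have "((\<lambda>t. g t x) has_real_derivative d) (at t)"
    unfolding g_def D2_def d_def
    by (intro DERIV_diff DERIV_add DERIV_cmult eqW t n)
  moreover have "\<bar>d - slice_op s \<mu> (g t) x\<bar> \<le> 4 * \<delta>"
    unfolding slice_op_g d_def using F[OF t n(1)] F[OF t n(2)] F[OF t n(3)] by (simp add: abs_le_iff)
  ultimately show ?thesis by blast
qed

abbreviation \<beta> where "\<beta> \<equiv> holder_exp \<gamma>"

lemma \<beta>: "0 < \<beta>" "\<beta> < 1" "\<beta> \<le> \<gamma>"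
  using \<gamma> holder_exp by auto

lemma g_holder:
  assumes t: "t \<in> {-1..0}" and x: "norm x \<le> R - 4" and h: "norm h \<le> 1"
  shows "\<bar>g t (x + h) - g t x\<bar> \<le> holder_const \<gamma> * norm h powr \<beta>"
proof -
  have "\<bar>g t (x + h) - g t x\<bar> \<le> (4 * 2 / 1 + 16 / (2 - 2 powr \<beta>)) * norm h powr \<beta>"
  proof (rule holder_of_D2[OF \<beta>])
    fix y assume "y \<in> cball x (2 * 1)"
    then have y: "norm y \<le> R - 1" using norm_triangle_ineq2[of y x] x by (simp add: dist_norm norm_minus_commute)
    show "\<bar>g t y\<bar> \<le> 2" using abs_g_le_one[OF t, of y] y \<delta> by auto
    fix h :: 'a
    have n: "norm (y + e) \<le> R" "norm (y - e) \<le> R" "norm y \<le> R"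
      using norm_triangle_ineq[of y e] norm_triangle_ineq4[of y e] y e by auto
    have "D2 (g t) y h = D2 (W t) (y + e) h + D2 (W t) (y - e) h - 2 * D2 (W t) y h"
      by (simp add: g_def D2_def algebra_simps)
    then show "\<bar>D2 (g t) y h\<bar> \<le> 16 * norm h powr \<gamma>"
      using D2W_all[OF t n(1), of h] D2W_all[OF t n(2), of h] D2W_all[OF t n(3), of h] by (simp add: abs_le_iff)
  qed (use h in auto)
  then show ?thesis by (simp add: holder_const_def)
qed

lemma g_time:
  assumes t: "t \<in> {-1..0}" and x: "norm x \<le> R - 2"
  shows "\<bar>g 0 x - g t x\<bar> \<le> 4 * (3 + 4 * Lam * time_const s \<gamma>) * (- t) powr (\<gamma> / (2 * s))"
proof (cases "t = 0")
  case False
  \<comment> \<open>Parabolic scaling: with \<rho>^(2s) = -t every term of the time increment bound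
    is at most a multiple of \<rho>^\<gamma>.\<close>
  define \<rho> where "\<rho> = (- t) powr (1 / (2 * s))"
  have t': "0 < - t" "- t \<le> 1" using t False by auto
  have \<rho>: "0 < \<rho>" "\<rho> \<le> 1" using t' s by (auto simp: \<rho>_def intro!: powr_le1)
  have \<rho>s: "\<rho> powr (2 * s) = - t" "\<rho> powr \<gamma> = (- t) powr (\<gamma> / (2 * s))"
    using t' s by (auto simp: \<rho>_def powr_powr)
  have *: "\<bar>W 0 y - W t y\<bar> \<le> (3 + 4 * Lam * time_const s \<gamma>) * (- t) powr (\<gamma> / (2 * s))" if y: "norm y \<le> R - 1" for y
  proof -
    have "\<bar>W 0 y - W t y\<bar> \<le> 4 * \<rho> powr \<gamma> / 2 + (Lam * time_const s \<gamma> * 4 * \<rho> powr (\<gamma> - 2 * s) + 1) * (0 - t)"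
    proof (rule time_increment_bound[OF s \<gamma> sp Lam_nonneg _ \<rho>(1)])
      show "continuous_on ({t..0} \<times> UNIV) (\<lambda>(t, x). W t x)" by (rule continuous_on_subset[OF contW]) auto
      fix t' y' assume "t' \<in> {t..0}" "y' \<in> cball y \<rho>"
      then have a: "t' \<in> {-1..0}" "norm y' \<le> R"
        using t y \<rho> norm_triangle_ineq2[of y' y] by (auto simp: dist_norm norm_minus_commute)
      show "((\<lambda>t. W t y') has_real_derivative (slice_op s \<mu> (W t') y' + F t' y')) (at t')" by (rule eqW[OF a])
      show "\<bar>F t' y'\<bar> \<le> 1" using F[OF a] \<delta> by linarith
      show "\<bar>D2 (W t') y' h\<bar> \<le> 4 * norm h powr \<gamma>" for h by (rule D2W_all[OF a])
    qed (use t' c11W in auto)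
    also have "\<dots> = 2 * \<rho> powr \<gamma> + 4 * Lam * time_const s \<gamma> * (\<rho> powr (\<gamma> - 2 * s) * \<rho> powr (2 * s)) + \<rho> powr (2 * s)"
    proof -
      have e: "0 - t = \<rho> powr (2 * s)" by (simp add: \<rho>s(1))
      show ?thesis unfolding e by (simp add: algebra_simps)
    qed
    also have "\<rho> powr (\<gamma> - 2 * s) * \<rho> powr (2 * s) = \<rho> powr \<gamma>"
      by (simp add: powr_add[symmetric])
    also have "\<rho> powr (2 * s) \<le> \<rho> powr \<gamma>" using \<rho> \<gamma> by (intro powr_mono') auto
    finally show ?thesis by (simp add: \<rho>s(2) algebra_simps)
  qed
  have n: "norm (x + e) \<le> R - 1" "norm (x - e) \<le> R - 1" "norm x \<le> R - 1"
    using norm_triangle_ineq[of x e] norm_triangle_ineq4[of x e] x e by auto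
  show ?thesis using *[OF n(1)] *[OF n(2)] *[OF n(3)] unfolding g_def D2_def abs_le_iff by (simp add: algebra_simps)
qed simp

text \<open>Between the value at x and the global bound there is a gap of only 2 \<delta>, so
  penalties of size comparable to \<delta> already push the maximum off the lateral and initial
  boundary. Consequently the operator is bounded below, and second differences above, by multiples
  of \<delta> at the maximum point. The radius 3/4 \<rho> leaves room \<rho>/4 for the steps
  h.\<close>

lemma penalized_maximum:
  assumes x: "norm x \<le> R - 2" and gx: "1 - \<delta> \<le> g 0 x" and \<tau>: "0 < \<tau>" "\<tau> \<le> 1" and \<rho>: "0 < \<rho>" "\<rho> \<le> 1"
  obtains t y where "t \<in> {-\<tau>..0}" "norm (y - x) \<le> 3/4 * \<rho>" "1 - \<delta> \<le> g t y"
    "- (4 / \<tau> + 4) * \<delta> \<le> slice_op s \<mu> (g t) y"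
    "\<And>h. norm h \<le> \<rho> / 4 \<Longrightarrow> D2 (g t) y h \<le> 8 * \<delta> / \<rho>\<^sup>2 * (norm h)\<^sup>2"
proof -
  \<comment> \<open>Twice the gap 2 \<delta>: at the maximum each penalty is at most \<eta>/2, which
    gives a distance of at most \<rho> / sqrt 2 from x and a time of at least -\<tau>/2.\<close>
  define \<eta> where "\<eta> = 4 * \<delta>"
  have \<eta>: "0 < \<eta>" using \<delta> by (simp add: \<eta>_def)
  define \<Phi> where "\<Phi> = (\<lambda>(t, y). g t y - \<eta> / \<rho>\<^sup>2 * (norm (y - x))\<^sup>2 + \<eta> / \<tau> * t)"
  let ?K = "{-\<tau>..0} \<times> cball x \<rho>"
  have contW': "continuous_on UNIV (\<lambda>z. W (fst z) (snd z + c))" for c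
  proof -
    have "continuous_on UNIV ((\<lambda>(t, x). W t x) \<circ> (\<lambda>z. (fst z, snd z + c)))"
      by (intro continuous_on_compose continuous_on_subset[OF contW] continuous_intros) auto
    then show ?thesis by (simp add: comp_def)
  qed
  have "continuous_on UNIV (\<lambda>z. g (fst z) (snd z))"
    unfolding g_def D2_def using contW'[of e] contW'[of "- e"] contW'[of 0] by (intro continuous_intros) auto
  then have "continuous_on ?K (\<lambda>z. g (fst z) (snd z))" by (rule continuous_on_subset) simp
  then have "continuous_on ?K \<Phi>" unfolding \<Phi>_def case_prod_beta by (intro continuous_intros)
  moreover have "compact ?K" by (intro compact_Times) auto
  moreover have "?K \<noteq> {}" using \<tau> \<rho> by auto
  ultimately obtain z where z: "z \<in> ?K" "\<And>z'. z' \<in> ?K \<Longrightarrow> \<Phi> z' \<le> \<Phi> z"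
    using continuous_attains_sup[of ?K \<Phi>] by blast
  obtain t y where zz: "z = (t, y)" by fastforce
  have t: "t \<in> {-\<tau>..0}" and y: "norm (y - x) \<le> \<rho>" using z zz by (auto simp: dist_norm norm_minus_commute)
  have t1: "t \<in> {-1..0}" using t \<tau> by auto
  have y1: "norm y \<le> R - 1" using norm_triangle_ineq2[of y x] x y \<rho> by linarith
  have max: "g t' y' - \<eta> / \<rho>\<^sup>2 * (norm (y' - x))\<^sup>2 + \<eta> / \<tau> * t' \<le> g t y - \<eta> / \<rho>\<^sup>2 * (norm (y - x))\<^sup>2 + \<eta> / \<tau> * t"
    if "t' \<in> {-\<tau>..0}" "norm (y' - x) \<le> \<rho>" for t' y'
    using z(2)[of "(t', y')"] that by (simp add: \<Phi>_def zz dist_norm norm_minus_commute)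
  have max0: "1 - \<delta> \<le> g t y - \<eta> / \<rho>\<^sup>2 * (norm (y - x))\<^sup>2 + \<eta> / \<tau> * t"
    using max[of 0 x] gx \<tau> \<rho> by simp
  have pos: "0 \<le> \<eta> / \<rho>\<^sup>2 * (norm (y - x))\<^sup>2" "\<eta> / \<tau> * t \<le> 0"
  proof -
    have "0 \<le> \<eta> / \<tau>" "t \<le> 0" using \<eta> t \<tau> by auto
    then show "\<eta> / \<tau> * t \<le> 0" by (rule mult_nonneg_nonpos)
  qed (use \<eta> in simp)
  have gy: "1 - \<delta> \<le> g t y" using max0 pos by linarith
  have g1: "g t y \<le> 1 + \<delta>" using abs_le_D1[OF abs_g_le_one[OF t1, of y]] y1 by simp
  have "\<eta> / \<rho>\<^sup>2 * (norm (y - x))\<^sup>2 \<le> \<eta> * (1/2)" using max0 pos g1 by (simp add: \<eta>_def)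
  then have "(norm (y - x))\<^sup>2 / \<rho>\<^sup>2 \<le> 1/2"
    using mult_le_cancel_left_pos[OF \<eta>, of "(norm (y - x))\<^sup>2 / \<rho>\<^sup>2" "1/2"] by simp
  then have "(norm (y - x))\<^sup>2 \<le> 1/2 * \<rho>\<^sup>2" using \<rho> by (simp add: divide_le_eq)
  moreover have "(3/4 * \<rho>)\<^sup>2 = 9/16 * \<rho>\<^sup>2" by (simp add: power_mult_distrib power_divide)
  moreover have "0 \<le> \<rho>\<^sup>2" by simp
  ultimately have "(norm (y - x))\<^sup>2 \<le> (3/4 * \<rho>)\<^sup>2" by linarith
  then have y2: "norm (y - x) \<le> 3/4 * \<rho>" by (rule power2_le_imp_le) (use \<rho> in simp)
  have "\<eta> / \<tau> * (- t) \<le> \<eta> * (1/2)" using max0 pos g1 by (simp add: \<eta>_def)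
  then have "(- t) / \<tau> \<le> 1/2" using mult_le_cancel_left_pos[OF \<eta>, of "(- t) / \<tau>" "1/2"] by simp
  then have t2: "- \<tau> < t" using \<tau> by (simp add: field_simps)
  obtain d where d: "((\<lambda>t. g t y) has_real_derivative d) (at t)" "\<bar>d - slice_op s \<mu> (g t) y\<bar> \<le> 4 * \<delta>"
    using g_derivative[OF t1 y1] by blast
  have "((\<lambda>t. g t y + \<eta> / \<tau> * t) has_real_derivative d + \<eta> / \<tau> * 1) (at t)"
    by (intro DERIV_add d DERIV_cmult DERIV_ident)
  from deriv_nonneg_of_left_max[OF this t2] have "0 \<le> d + \<eta> / \<tau>"
    using max[of _ y] y t by simp
  moreover have "- (4 / \<tau> + 4) * \<delta> = - (\<eta> / \<tau>) - 4 * \<delta>" by (simp add: \<eta>_def algebra_simps)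
  ultimately have "- (4 / \<tau> + 4) * \<delta> \<le> slice_op s \<mu> (g t) y" using abs_le_D1[OF d(2)] by linarith
  moreover have "D2 (g t) y h \<le> 8 * \<delta> / \<rho>\<^sup>2 * (norm h)\<^sup>2" if h: "norm h \<le> \<rho> / 4" for h
  proof -
    have n: "norm (y + h - x) \<le> \<rho>" "norm (y - h - x) \<le> \<rho>"
      using norm_triangle_ineq[of "y - x" h] norm_triangle_ineq4[of "y - x" h] y2 h by (auto simp: algebra_simps)
    have scale: "k * a + k * b = 2 * (k * c) + 2 * (k * d)" if "a + b = 2 * c + 2 * d" for k a b c d :: real
      using arg_cong[OF that, of "\<lambda>u. k * u"] by (simp add: distrib_left mult.left_commute)
    have eq: "\<eta> / \<rho>\<^sup>2 * (norm (y + h - x))\<^sup>2 + \<eta> / \<rho>\<^sup>2 * (norm (y - h - x))\<^sup>2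
       = 2 * (\<eta> / \<rho>\<^sup>2 * (norm (y - x))\<^sup>2) + 2 * (\<eta> / \<rho>\<^sup>2 * (norm h)\<^sup>2)"
      by (rule scale) (use norm_parallelogram[of "y - x" h] in \<open>simp add: algebra_simps\<close>)
    have "D2 (g t) y h \<le> 2 * (\<eta> / \<rho>\<^sup>2 * (norm h)\<^sup>2)"
      using max[OF t n(1)] max[OF t n(2)] eq unfolding D2_def by linarith
    then show ?thesis by (simp add: \<eta>_def)
  qed
  ultimately show ?thesis using that[OF t y2 gy] by blast
qed

text \<open>The deficit is nonnegative on the whole cylinder, so a small integral over jump targets
  forces it to be small at most of them.\<close>

definition v :: "real \<Rightarrow> 'a \<Rightarrow> real" where "v t x = 1 + \<delta> - g t x"

text \<open>Jumps up to length a are cut off because the deficit does not vanish at y in general and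
  the kernel is not integrable at 0; there the paraboloid touching g from above is used
  instead.\<close>

definition jump_density :: "real \<Rightarrow> real \<Rightarrow> real \<Rightarrow> 'a \<Rightarrow> 'a \<Rightarrow> real \<Rightarrow> real" where
  "jump_density a b t y \<theta> r = (if a < \<bar>r\<bar> \<and> \<bar>r\<bar> \<le> b
     then (v t (y + r *\<^sub>R \<theta>) + v t (y - r *\<^sub>R \<theta>)) / \<bar>r\<bar> powr (1 + 2 * s) else 0)"

lemma v_nonneg: "t \<in> {-1..0} \<Longrightarrow> norm x \<le> R \<Longrightarrow> 0 \<le> v t x"
  and v_le: "t \<in> {-1..0} \<Longrightarrow> norm x \<le> R \<Longrightarrow> v t x \<le> 3"
  using abs_g_le_one[of t x] \<delta> by (auto simp: v_def abs_le_iff)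

lemma jump_density_nonneg:
  assumes "t \<in> {-1..0}" "norm \<theta> = 1" "norm y + b \<le> R"
  shows "0 \<le> jump_density a b t y \<theta> r"
  using assms norm_triangle_ineq[of y "r *\<^sub>R \<theta>"] norm_triangle_ineq4[of y "r *\<^sub>R \<theta>"]
  by (auto simp: jump_density_def intro!: divide_nonneg_nonneg add_nonneg_nonneg v_nonneg)

lemma jump_density_integrable:
  assumes t: "t \<in> {-1..0}" and th: "norm \<theta> = 1" and y: "norm y + b \<le> R" and a: "0 < a"
  shows "integrable lborel (jump_density a b t y \<theta>)"
proof (rule Bochner_Integration.integrable_bound)
  show "integrable lborel (\<lambda>r. indicator {-b..b} r * (6 / a powr (1 + 2 * s)))"
    by (rule integrable_mult_left) (auto intro!: integrable_real_indicator simp: emeasure_lborel_Icc_eq)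
  have [measurable]: "g t \<in> borel_measurable borel"
    using c11_g[of t] by (intro borel_measurable_continuous_onI) (simp add: c11_def)
  show "jump_density a b t y \<theta> \<in> borel_measurable lborel"
    unfolding jump_density_def v_def by measurable
  show "AE r in lborel. norm (jump_density a b t y \<theta> r) \<le> norm (indicator {-b..b} r * (6 / a powr (1 + 2 * s)))"
  proof (rule AE_I2)
    fix r
    show "norm (jump_density a b t y \<theta> r) \<le> norm (indicator {-b..b} r * (6 / a powr (1 + 2 * s)))"
    proof (cases "a < \<bar>r\<bar> \<and> \<bar>r\<bar> \<le> b")
      case True
      then have n: "norm (y + r *\<^sub>R \<theta>) \<le> R" "norm (y - r *\<^sub>R \<theta>) \<le> R"
        using th y norm_triangle_ineq[of y "r *\<^sub>R \<theta>"] norm_triangle_ineq4[of y "r *\<^sub>R \<theta>"] by auto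
      have "(v t (y + r *\<^sub>R \<theta>) + v t (y - r *\<^sub>R \<theta>)) / \<bar>r\<bar> powr (1 + 2 * s) \<le> 6 / a powr (1 + 2 * s)"
        using v_le[OF t n(1)] v_le[OF t n(2)] True a s by (intro frac_le powr_mono2) auto
      then show ?thesis using True jump_density_nonneg[OF t th y, of a r]
        by (auto simp: jump_density_def indicator_def)
    next
      case False
      then have "jump_density a b t y \<theta> r = 0" unfolding jump_density_def by (rule if_not_P)
      then show ?thesis by simp
    qed
  qed
qed

text \<open>Three ranges of jump lengths. Up to a the touching paraboloid counts. Between a and R/2
  the second difference of g is twice the deficit at y, at most 4 \<delta>, minus the deficits at
  both targets, which move to the left-hand side. Beyond R/2 the sup bound of W counts, whence the
  inner coefficient 0 in the second majorant.\<close>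

lemma slice_integrand_split:
  assumes t: "t \<in> {-1..0}" and th: "norm \<theta> = 1" and y: "norm y \<le> R / 2" "norm y + b \<le> R / 2" and a: "0 < a"
    and gy: "1 - \<delta> \<le> g t y" and c2: "0 \<le> c2"
    and D2g: "\<And>h. norm h \<le> a \<Longrightarrow> D2 (g t) y h \<le> c2 * \<delta> * (norm h)\<^sup>2"
  shows "slice_integrand s (g t) y \<theta> r + jump_density a b t y \<theta> r
    \<le> kernel_majorant s a (c2 * \<delta>) (4 * \<delta>) 0 r + kernel_majorant s (R / 2) 0 (16 * \<delta> * R powr \<gamma>) 0 r"
proof -
  have n0: "norm (r *\<^sub>R \<theta>) = \<bar>r\<bar>" using th by simp
  have nn: "0 \<le> kernel_majorant s (R / 2) 0 (16 * \<delta> * R powr \<gamma>) 0 r"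
    using \<delta> by (intro kernel_majorant_nonneg) auto
  have vy: "v t y \<le> 2 * \<delta>" using gy by (simp add: v_def)
  consider "\<bar>r\<bar> \<le> a" | "a < \<bar>r\<bar>" "\<bar>r\<bar> \<le> R / 2" | "a < \<bar>r\<bar>" "R / 2 < \<bar>r\<bar>" by linarith
  then show ?thesis
  proof cases
    case 1
    then have "slice_integrand s (g t) y \<theta> r \<le> kernel_majorant s a (c2 * \<delta>) (4 * \<delta>) 0 r"
      using D2g[of "r *\<^sub>R \<theta>"] n0
      by (auto simp: slice_integrand_def kernel_majorant_def intro!: divide_right_mono)
    then show ?thesis using nn 1 by (simp add: jump_density_def)
  next
    case 2
    then have n: "norm (y + r *\<^sub>R \<theta>) \<le> R" "norm (y - r *\<^sub>R \<theta>) \<le> R"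
      using th y norm_triangle_ineq[of y "r *\<^sub>R \<theta>"] norm_triangle_ineq4[of y "r *\<^sub>R \<theta>"] by auto
    define p where "p = \<bar>r\<bar> powr (1 + 2 * s)"
    have p: "0 < p" using 2 a by (simp add: p_def)
    have "D2 (g t) y (r *\<^sub>R \<theta>) = 2 * v t y - (v t (y + r *\<^sub>R \<theta>) + v t (y - r *\<^sub>R \<theta>))"
      by (simp add: D2_def v_def)
    then have le: "D2 (g t) y (r *\<^sub>R \<theta>) + (if \<bar>r\<bar> \<le> b then v t (y + r *\<^sub>R \<theta>) + v t (y - r *\<^sub>R \<theta>) else 0) \<le> 4 * \<delta>"
      using vy v_nonneg[OF t n(1)] v_nonneg[OF t n(2)] by auto
    have "slice_integrand s (g t) y \<theta> r + jump_density a b t y \<theta> r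
      = (D2 (g t) y (r *\<^sub>R \<theta>) + (if \<bar>r\<bar> \<le> b then v t (y + r *\<^sub>R \<theta>) + v t (y - r *\<^sub>R \<theta>) else 0)) / p"
      using 2 by (simp add: slice_integrand_def jump_density_def p_def add_divide_distrib)
    also have "\<dots> \<le> 4 * \<delta> / p" using le p by (intro divide_right_mono) auto
    also have "\<dots> = kernel_majorant s a (c2 * \<delta>) (4 * \<delta>) 0 r"
      using 2 a by (simp add: kernel_majorant_def p_def)
    finally show ?thesis using nn by simp
  next
    case 3
    have "\<bar>D2 (g t) y (r *\<^sub>R \<theta>)\<bar> \<le> 16 * \<delta> * R powr \<gamma>"
      using abs_D2W_le[of t "y + r *\<^sub>R \<theta>" e] abs_D2W_le[of t "y - r *\<^sub>R \<theta>" e] abs_D2W_le[of t y e]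
      unfolding D2_def[of "g t"] g_def by (simp add: abs_le_iff)
    then have "slice_integrand s (g t) y \<theta> r \<le> kernel_majorant s (R / 2) 0 (16 * \<delta> * R powr \<gamma>) 0 r"
      using 3 R8 by (auto simp: slice_integrand_def kernel_majorant_def intro!: divide_right_mono)
    moreover have "\<not> \<bar>r\<bar> \<le> b" using 3 y norm_ge_zero[of y] by linarith
    then have "jump_density a b t y \<theta> r = 0" by (simp add: jump_density_def)
    moreover have "0 \<le> kernel_majorant s a (c2 * \<delta>) (4 * \<delta>) 0 r"
      using c2 \<delta> by (intro kernel_majorant_nonneg) auto
    ultimately show ?thesis by simp
  qed
qed



text \<open>If every direction in G saw a deficit above \<kappa>, then integrating the split
  estimate over the sphere would push the operator at y below its lower bound -K \<delta>: the
  positive contributions are of order \<delta> and the loss is at least \<kappa> m.\<close>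

lemma good_direction:
  assumes t: "t \<in> {-1..0}" and y: "norm y + b \<le> R / 2" "0 < a" "0 \<le> b" "0 \<le> c2"
    and gy: "1 - \<delta> \<le> g t y"
    and D2g: "\<And>h. norm h \<le> a \<Longrightarrow> D2 (g t) y h \<le> c2 * \<delta> * (norm h)\<^sup>2"
    and sl: "- K * \<delta> \<le> slice_op s \<mu> (g t) y"
    and G: "G \<in> sets \<mu>" "m \<le> measure \<mu> G" and \<kappa>: "0 < \<kappa>"
    and small: "(Lam * jump_const s a c2 + K) * \<delta> < \<kappa> * m"
  shows "\<exists>\<theta>\<in>G. norm \<theta> = 1 \<and> (\<integral>r. jump_density a b t y \<theta> r \<partial>lborel) \<le> \<kappa>"
proof (rule ccontr)
  assume "\<not> ?thesis"
  then have neg: "\<kappa> < (\<integral>r. jump_density a b t y \<theta> r \<partial>lborel)" if "\<theta> \<in> G" "norm \<theta> = 1" for \<theta>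
    using that by force
  have yR: "norm y \<le> R / 2" "norm y + b \<le> R" using y R8 by auto
  let ?k1 = "kernel_majorant s a (c2 * \<delta>) (4 * \<delta>) 0" and ?k2 = "kernel_majorant s (R / 2) 0 (16 * \<delta> * R powr \<gamma>) 0"
  define B1 where "B1 = 2 * ((c2 * \<delta>) * a powr (2 - 2 * s) / (2 - 2 * s) + (4 * \<delta>) * a powr (0 - 2 * s) / (2 * s - 0))"
  define B2 where "B2 = 2 * (0 * (R / 2) powr (2 - 2 * s) / (2 - 2 * s) + (16 * \<delta> * R powr \<gamma>) * (R / 2) powr (0 - 2 * s) / (2 * s - 0))"
  have k1: "has_bochner_integral lborel ?k1 B1"
    unfolding B1_def using s y \<delta> by (intro kernel_majorant_integral) auto
  have k2: "has_bochner_integral lborel ?k2 B2"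
    unfolding B2_def using s R8 \<delta> by (intro kernel_majorant_integral) auto
  have "B1 \<ge> 0" unfolding B1_def using s y \<delta> by auto
  moreover have "B2 \<ge> 0" unfolding B2_def using s \<delta> by auto
  ultimately have B0: "0 \<le> B1 + B2" by simp
  \<comment> \<open>The tail is of order \<delta> R^\<gamma> (R/2)^(-2s). It stays below a fixed
    multiple of \<delta> for every R because \<gamma> < 2s.\<close>
  have B2: "B2 \<le> 64 / s * \<delta>"
  proof -
    have "R powr \<gamma> * (R / 2) powr (0 - 2 * s) \<le> 4"
    proof -
      have "(R / 2) powr (0 - 2 * s) = R powr (0 - 2 * s) * (1/2) powr (0 - 2 * s)"
        using powr_mult[of R "1/2" "0 - 2 * s"] R8 by simp
      moreover have "(1/2::real) powr (0 - 2 * s) = 2 powr (2 * s)"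
        by (simp add: powr_divide powr_minus_divide)
      moreover have "2 powr (2 * s) \<le> 2 powr (2::real)" using s by (intro powr_mono) auto
      ultimately have "(R / 2) powr (0 - 2 * s) \<le> R powr (0 - 2 * s) * 4"
        by (simp add: mult_left_mono)
      then have "R powr \<gamma> * (R / 2) powr (0 - 2 * s) \<le> R powr \<gamma> * (R powr (0 - 2 * s) * 4)"
        by (intro mult_left_mono) auto
      also have "\<dots> = R powr (\<gamma> - 2 * s) * 4" by (simp add: powr_add[symmetric])
      also have "R powr (\<gamma> - 2 * s) \<le> R powr 0" using R8 \<gamma> by (intro powr_mono) auto
      finally show ?thesis using R8 by simp
    qed
    then have "16 * \<delta> * (R powr \<gamma> * (R / 2) powr (0 - 2 * s)) \<le> 16 * \<delta> * 4"
      using \<delta> by (intro mult_left_mono) auto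
    then have "(16 * \<delta> * R powr \<gamma> * (R / 2) powr (0 - 2 * s)) / s \<le> (64 * \<delta>) / s"
      using s by (intro divide_right_mono) auto
    then show ?thesis unfolding B2_def by (simp add: mult.assoc)
  qed
  have "slice_op s \<mu> (g t) y \<le> Lam * (B1 + B2) - \<kappa> * measure \<mu> G"
  proof (rule slice_op_le[OF c11_g s sp Lam_nonneg G(1) B0])
    fix \<theta> :: 'a assume th: "norm \<theta> = 1"
    note i = slice_integrand_integrable[OF c11_g s th, of t y] jump_density_integrable[OF t th yR(2) y(2)]
    have "(\<integral>r. slice_integrand s (g t) y \<theta> r + jump_density a b t y \<theta> r \<partial>lborel) \<le> (\<integral>r. ?k1 r + ?k2 r \<partial>lborel)"
      using i k1 k2 slice_integrand_split[OF t th yR(1) y(1,2) gy y(4) D2g]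
      by (intro integral_mono) (auto simp: has_bochner_integral_iff)
    also have "\<dots> = B1 + B2" using k1 k2 by (simp add: has_bochner_integral_iff)
    finally have "(\<integral>r. slice_integrand s (g t) y \<theta> r \<partial>lborel) \<le> B1 + B2 - (\<integral>r. jump_density a b t y \<theta> r \<partial>lborel)"
      using i by simp
    moreover have "\<kappa> * indicator G \<theta> \<le> (\<integral>r. jump_density a b t y \<theta> r \<partial>lborel)"
      using neg[of \<theta>] th Bochner_Integration.integral_nonneg[of lborel "jump_density a b t y \<theta>"] jump_density_nonneg[OF t th yR(2)]
      by (auto simp: indicator_def)
    ultimately show "(\<integral>r. slice_integrand s (g t) y \<theta> r \<partial>lborel) \<le> B1 + B2 - \<kappa> * indicator G \<theta>" by linarith
  qed
  also have "\<dots> \<le> Lam * (jump_const s a c2 * \<delta>) - \<kappa> * m"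
  proof -
    have "B1 + 64 / s * \<delta> = jump_const s a c2 * \<delta>"
      by (simp add: B1_def jump_const_def algebra_simps add_divide_distrib)
    then have "B1 + B2 \<le> jump_const s a c2 * \<delta>" using B2 by linarith
    then show ?thesis using Lam_nonneg G(2) \<kappa> by (intro diff_mono mult_left_mono) auto
  qed
  finally show False using sl small by (simp add: algebra_simps)
qed

text \<open>A deficit above 2 \<kappa> at one target persists above \<kappa> on a segment of length
  l by Hoelder continuity. The kernel is at least b^(-1-2s) on that segment, so it alone would
  exceed the assumed integral.\<close>

lemma v_le_of_jump_density:
  assumes t: "t \<in> {-1..0}" and th: "norm \<theta> = 1" and y: "norm y + b \<le> R - 4" and a: "0 < a"
    and int: "(\<integral>r. jump_density a b t y \<theta> r \<partial>lborel) \<le> \<kappa> * l / b powr (1 + 2 * s)"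
    and r: "a < \<bar>r\<bar>" "\<bar>r\<bar> + l \<le> b" and l: "0 < l" "l \<le> 1"
    and osc: "holder_const \<gamma> * l powr \<beta> \<le> \<kappa>"
  shows "v t (y + r *\<^sub>R \<theta>) \<le> 2 * \<kappa>"
proof (rule ccontr)
  assume neg: "\<not> ?thesis"
  define c where "c = v t (y + r *\<^sub>R \<theta>) - \<kappa>"
  have c: "\<kappa> < c" using neg by (simp add: c_def)
  have "0 \<le> holder_const \<gamma> * l powr \<beta>" using holder_const_pos[of \<gamma>] by simp
  then have \<kappa>: "0 \<le> \<kappa>" using osc by linarith
  have b: "0 < b" using r a l by linarith
  have yb: "norm y + b \<le> R" using y by simp
  have lower: "c / b powr (1 + 2 * s) * indicator {\<bar>r\<bar>..\<bar>r\<bar> + l} q \<le> jump_density a b t y \<theta> q" for q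
  proof (cases "q \<in> {\<bar>r\<bar>..\<bar>r\<bar> + l}")
    case True
    then have q: "a < q" "q \<le> b" "0 < q" using r a by auto
    \<comment> \<open>The segment continues away from y, in the direction given by the sign of r, so
      that its jump lengths run through |r| to |r| + l and remain between a and b.\<close>
    define h where "h = (sgn r * (q - \<bar>r\<bar>)) *\<^sub>R \<theta>"
    have h: "norm h \<le> l" using True th by (auto simp: h_def abs_mult abs_sgn_eq)
    have nr: "norm (y + r *\<^sub>R \<theta>) \<le> R - 4"
      using norm_triangle_ineq[of y "r *\<^sub>R \<theta>"] th y r l by simp
    have yq: "y + r *\<^sub>R \<theta> + h = y + (sgn r * q) *\<^sub>R \<theta>"
    proof -
      have "r + sgn r * (q - \<bar>r\<bar>) = sgn r * q" by (auto simp: sgn_if)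
      then show ?thesis by (metis h_def add.assoc scaleR_add_left)
    qed
    have "\<bar>g t (y + r *\<^sub>R \<theta> + h) - g t (y + r *\<^sub>R \<theta>)\<bar> \<le> holder_const \<gamma> * norm h powr \<beta>"
      using h l by (intro g_holder t nr) auto
    also have "\<dots> \<le> holder_const \<gamma> * l powr \<beta>"
      using h \<beta> holder_const_pos[of \<gamma>] by (intro mult_left_mono powr_mono2) auto
    also have "\<dots> \<le> \<kappa>" by (rule osc)
    finally have cv: "c \<le> v t (y + (sgn r * q) *\<^sub>R \<theta>)"
      unfolding yq by (simp add: c_def v_def abs_le_iff)
    have n: "norm (y + q *\<^sub>R \<theta>) \<le> R" "norm (y - q *\<^sub>R \<theta>) \<le> R"
      using th yb q norm_triangle_ineq[of y "q *\<^sub>R \<theta>"] norm_triangle_ineq4[of y "q *\<^sub>R \<theta>"] by auto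
    have "c \<le> v t (y + q *\<^sub>R \<theta>) + v t (y - q *\<^sub>R \<theta>)"
      using cv v_nonneg[OF t n(1)] v_nonneg[OF t n(2)] r a by (cases "r > 0") (auto simp: sgn_if)
    then have "c / b powr (1 + 2 * s) \<le> (v t (y + q *\<^sub>R \<theta>) + v t (y - q *\<^sub>R \<theta>)) / q powr (1 + 2 * s)"
      using q c \<kappa> s by (intro frac_le powr_mono2) auto
    then show ?thesis using True q by (simp add: jump_density_def)
  next
    case False
    then show ?thesis using jump_density_nonneg[OF t th yb] by simp
  qed
  have "c / b powr (1 + 2 * s) * l = (\<integral>q. c / b powr (1 + 2 * s) * indicator {\<bar>r\<bar>..\<bar>r\<bar> + l} q \<partial>lborel)"
    using l by simp
  also have "\<dots> \<le> (\<integral>q. jump_density a b t y \<theta> q \<partial>lborel)"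
    by (rule integral_mono[OF _ jump_density_integrable[OF t th yb a] lower])
      (intro integrable_mult_right integrable_real_indicator, auto simp: emeasure_lborel_Icc_eq)
  also note int
  finally have "c * (l / b powr (1 + 2 * s)) \<le> \<kappa> * (l / b powr (1 + 2 * s))" by simp
  moreover have "0 < l / b powr (1 + 2 * s)" using l b by simp
  ultimately have "c \<le> \<kappa>" by (rule mult_right_le_imp_le)
  then show False using c by simp
qed

end

text \<open>The iteration produces several thresholds for \<delta>; monotonicity lets their minimum
  serve all of them.\<close>

lemma near_extremal_mono:
  assumes "near_extremal s \<gamma> lam Lam \<mu> W F e \<delta> R" "\<delta> \<le> \<delta>'" "\<delta>' \<le> 1/8"
  shows "near_extremal s \<gamma> lam Lam \<mu> W F e \<delta>' R"
proof -
  interpret near_extremal s \<gamma> lam Lam \<mu> W F e \<delta> R by fact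
  have "1 / \<delta>' \<le> 1 / \<delta>" using assms \<delta> by (simp add: frac_le)
  then have 1: "1 / \<delta>' \<le> R" using R by linarith
  have 2: "\<bar>D2 (W t) x h\<bar> \<le> (1 + \<delta>') * norm h powr \<gamma>" if "t \<in> {-1..0}" "norm x \<le> R" "norm h \<le> R" for t x h
    using D2W[OF that] assms(2) by (smt (verit) mult_right_mono powr_ge_zero)
  have 3: "\<bar>W t x\<bar> \<le> \<delta>' * R powr \<gamma>" for t x
    using W_le[of t x] assms(2) mult_right_mono[of \<delta> \<delta>' "R powr \<gamma>"] by simp
  have 4: "\<bar>F t x\<bar> \<le> \<delta>'" if "t \<in> {-1..0}" "norm x \<le> R" for t x using F[OF that] assms(2) by simp
  show ?thesis
    by unfold_locales (use s \<gamma> lam sp e contW c11W \<delta> assms eqW 1 2 3 4 in auto)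
qed

context near_extremal
begin

text \<open>The new point x' is the orthogonal projection of z onto the line through y in direction \<theta>; since \<theta> makes
an angle bounded away from \<pi>/2 with z - y, this contracts the distance by the factor q0.\<close>

lemma approach_point:
  fixes N \<rho>1 \<rho> \<tau> l \<kappa> :: real
  defines "c0 \<equiv> (lam / (2 * Lam)) powr (1 / (2 * s))"
  defines "q0 \<equiv> sqrt (1 - c0\<^sup>2)"
  defines "b \<equiv> 2 * N + 2"
  assumes N: "1 \<le> N" "8 * N + 8 \<le> R" and \<rho>1: "0 < \<rho>1" and \<rho>: "0 < \<rho>" "\<rho> \<le> 1" "\<rho> \<le> c0 * \<rho>1 / 2"
    and \<tau>: "0 < \<tau>" "\<tau> \<le> 1" "4 * (3 + 4 * Lam * time_const s \<gamma>) * \<tau> powr (\<gamma> / (2 * s)) \<le> \<kappa>"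
    and l: "0 < l" "l \<le> 1" "holder_const \<gamma> * l powr holder_exp \<gamma> \<le> \<kappa>"
    and \<kappa>: "0 < \<kappa>"
    and small: "(Lam * jump_const s (\<rho> / 4) (8 / \<rho>\<^sup>2) + (4 / \<tau> + 4)) * \<delta> < (\<kappa> * l / b powr (1 + 2 * s)) * (lam / 2)"
    and x: "norm x \<le> 2 * N" and z: "norm z \<le> N" and xz: "\<rho>1 \<le> norm (x - z)" "norm (x - z) \<le> 2 * N"
    and gx: "1 - \<delta> \<le> D2 (W 0) x e"
  shows "\<exists>x'. norm (x' - z) \<le> q0 * (norm (x - z) + \<rho>) \<and> 1 - 3 * \<kappa> \<le> D2 (W 0) x' e"
proof -
  have c0: "0 < c0" "c0 \<le> 1"
  proof -
    show "0 < c0" using lam by (simp add: c0_def)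
    have "lam / (2 * Lam) \<le> 1" using lam by (simp add: field_simps)
    then show "c0 \<le> 1" unfolding c0_def using s lam by (intro powr_le1) auto
  qed
  have q0: "0 \<le> q0" "q0\<^sup>2 = 1 - c0\<^sup>2"
    using c0 power_le_one[of c0 2] by (auto simp: q0_def)
  have "norm x \<le> R - 2" using x N by linarith
  from penalized_maximum[OF this _ \<tau>(1,2) \<rho>(1,2)] gx[folded g_def]
  obtain t y where t: "t \<in> {-\<tau>..0}" and y: "norm (y - x) \<le> 3/4 * \<rho>" and gy: "1 - \<delta> \<le> g t y"
    and sl: "- (4 / \<tau> + 4) * \<delta> \<le> slice_op s \<mu> (g t) y"
    and D2g: "\<And>h. norm h \<le> \<rho> / 4 \<Longrightarrow> D2 (g t) y h \<le> 8 * \<delta> / \<rho>\<^sup>2 * (norm h)\<^sup>2"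
    by metis
  have t1: "t \<in> {-1..0}" using t \<tau> by auto
  have y1: "norm y \<le> 2 * N + 1" using norm_triangle_ineq2[of y x] x y \<rho> by linarith
  define d where "d = norm (z - y)"
  have d1: "d \<le> norm (x - z) + \<rho>" "norm (x - z) - 3/4 * \<rho> \<le> d"
    using norm_triangle_ineq[of "z - x" "x - y"] norm_triangle_ineq[of "z - y" "y - x"] y \<rho>
    by (auto simp: d_def norm_minus_commute)
  have "c0 * \<rho>1 \<le> \<rho>1" using c0 \<rho>1 by simp
  then have d2: "\<rho>1 / 2 < d" using d1 xz \<rho> \<rho>1 by linarith
  then have d0: "0 < d" using \<rho>1 by linarith
  define \<nu> where "\<nu> = (1 / d) *\<^sub>R (z - y)"
  have \<nu>: "norm \<nu> = 1" using d0 by (simp add: \<nu>_def d_def)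
  define G where "G = {\<theta> \<in> sphere 0 1. c0 \<le> \<bar>\<nu> \<bullet> \<theta>\<bar>}"
  have Gm: "lam / 2 \<le> measure \<mu> G"
    using nondegenerate_directions[OF sp s(1) lam \<nu>] by (simp add: G_def c0_def)
  \<comment> \<open>A set outside the sigma-algebra has measure 0 by convention, so the positive
    lower bound already yields measurability.\<close>
  have G: "G \<in> sets \<mu>" using Gm lam measure_notin_sets[of G \<mu>] by fastforce
  have yb: "norm y + b \<le> R / 2" using y1 N by (simp add: b_def)
  have "\<exists>\<theta>\<in>G. norm \<theta> = 1 \<and> (\<integral>r. jump_density (\<rho> / 4) b t y \<theta> r \<partial>lborel) \<le> \<kappa> * l / b powr (1 + 2 * s)"
  proof (rule good_direction[OF t1 yb _ _ _ gy _ sl G Gm])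
    show "D2 (g t) y h \<le> 8 / \<rho>\<^sup>2 * \<delta> * (norm h)\<^sup>2" if "norm h \<le> \<rho> / 4" for h
      using D2g[OF that] by simp
  qed (use small \<rho> N l \<kappa> in \<open>auto simp: b_def\<close>)
  then obtain \<theta> where \<theta>: "\<theta> \<in> G" "norm \<theta> = 1"
     "(\<integral>r. jump_density (\<rho> / 4) b t y \<theta> r \<partial>lborel) \<le> \<kappa> * l / b powr (1 + 2 * s)"
       by blast
  define r where "r = (z - y) \<bullet> \<theta>"
  have r_eq: "r = d * (\<nu> \<bullet> \<theta>)" using d0 by (simp add: r_def \<nu>_def)
  have rd: "c0 * d \<le> \<bar>r\<bar>" using \<theta>(1) d0 by (simp add: r_eq G_def abs_mult mult.commute)
  have r_le: "\<bar>r\<bar> \<le> d" using Cauchy_Schwarz_ineq2[of "z - y" \<theta>] \<theta>(2) by (simp add: r_def d_def)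
  \<comment> \<open>The jump has to be longer than the cut-off \<rho>/4; the assumption \<rho> \<le>
    c0 \<rho>1 / 2 ensures this.\<close>
  have "c0 * (\<rho>1 / 2) < c0 * d" using c0 d2 by simp
  then have r1: "\<rho> / 4 < \<bar>r\<bar>" using rd \<rho> by linarith
  have r2: "\<bar>r\<bar> + l \<le> b" using r_le d1 xz \<rho> l by (simp add: b_def)
  have v: "v t (y + r *\<^sub>R \<theta>) \<le> 2 * \<kappa>"
    by (rule v_le_of_jump_density[OF t1 \<theta>(2) _ _ \<theta>(3) r1 r2 l(1,2)]) (use yb N \<rho> l in auto)
  define x' where "x' = y + r *\<^sub>R \<theta>"
  have nx': "norm x' \<le> R - 2"
    using norm_triangle_ineq[of y "r *\<^sub>R \<theta>"] \<theta>(2) r2 l yb R8 by (simp add: x'_def)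
  have "(norm (x' - z))\<^sup>2 = d\<^sup>2 - r\<^sup>2"
  proof -
    have "x' - z = r *\<^sub>R \<theta> - (z - y)" by (simp add: x'_def)
    then have "(norm (x' - z))\<^sup>2 = (norm (r *\<^sub>R \<theta>))\<^sup>2 + d\<^sup>2 - 2 * ((r *\<^sub>R \<theta>) \<bullet> (z - y))"
      unfolding d_def by (simp only: power2_norm_eq_inner inner_diff_left inner_diff_right) (simp add: inner_commute)
    also have "(r *\<^sub>R \<theta>) \<bullet> (z - y) = r\<^sup>2" by (simp add: r_def inner_commute power2_eq_square)
    also have "(norm (r *\<^sub>R \<theta>))\<^sup>2 = r\<^sup>2" using \<theta>(2) by simp
    finally show ?thesis by simp
  qed
  moreover have "(c0 * d)\<^sup>2 \<le> r\<^sup>2" using rd c0 d0 by (intro abs_le_square_iff[THEN iffD1]) simp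
  ultimately have "(norm (x' - z))\<^sup>2 \<le> (q0 * d)\<^sup>2"
    by (simp add: power_mult_distrib q0(2) algebra_simps)
  then have "norm (x' - z) \<le> q0 * d" by (rule power2_le_imp_le) (use q0 d0 in simp)
  also have "\<dots> \<le> q0 * (norm (x - z) + \<rho>)" using d1 q0 by (intro mult_left_mono) auto
  finally have near: "norm (x' - z) \<le> q0 * (norm (x - z) + \<rho>)" .
  \<comment> \<open>The jump was made at the earlier time t. Returning to time 0 costs one more
    \<kappa>, in addition to the 2 \<kappa> of the deficit.\<close>
  have "\<bar>g 0 x' - g t x'\<bar> \<le> 4 * (3 + 4 * Lam * time_const s \<gamma>) * (- t) powr (\<gamma> / (2 * s))"
    by (rule g_time[OF t1 nx'])
  also have "\<dots> \<le> 4 * (3 + 4 * Lam * time_const s \<gamma>) * \<tau> powr (\<gamma> / (2 * s))"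
    using t \<gamma> s Lam_nonneg time_const_nonneg[OF s \<gamma>(2)] by (intro mult_left_mono powr_mono2) auto
  also note \<tau>(3)
  finally have "1 - 3 * \<kappa> \<le> D2 (W 0) x' e"
    using v \<delta> unfolding x'_def[symmetric] v_def g_def[symmetric] by (simp add: abs_le_iff)
  then show ?thesis using near by blast
qed

end

section \<open>Iterated approach, filling a ball, and the contradiction\<close>

lemma exists_powr_small:
  fixes C a \<kappa> :: real
  assumes "0 \<le> C" "0 < a" "0 < \<kappa>"
  shows "\<exists>x>0. x \<le> 1 \<and> C * x powr a \<le> \<kappa>"
proof -
  define x where "x = min 1 ((\<kappa> / (C + 1)) powr (1 / a))"
  have x: "0 < x" "x \<le> 1" using assms by (auto simp: x_def)
  have "x powr a \<le> ((\<kappa> / (C + 1)) powr (1 / a)) powr a" using x assms by (intro powr_mono2) (auto simp: x_def)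
  also have "\<dots> = \<kappa> / (C + 1)" using assms by (simp add: powr_powr)
  finally have "C * x powr a \<le> C * (\<kappa> / (C + 1))" using assms by (intro mult_left_mono) auto
  also have "\<dots> \<le> \<kappa>" using assms by (simp add: field_simps)
  finally show ?thesis using x by blast
qed

text \<open>The order of quantifiers is the point: q depends on N and \<rho>1 but not on the
  accuracy \<kappa>, so the number of steps is known before the accuracies are chosen, and \<delta>
  works for all measures, solutions and R at once.\<close>

lemma approach_step:
  fixes s \<gamma> lam Lam N \<rho>1 \<kappa> :: real
  assumes s: "0 < s" "s < 1" and \<gamma>: "0 < \<gamma>" "\<gamma> < 2 * s" and lam: "0 < lam" "lam \<le> Lam"
    and N: "1 \<le> N" and \<rho>1: "0 < \<rho>1"
  shows "\<exists>q. 0 < q \<and> q < 1 \<and> (\<forall>\<kappa>>0. \<exists>\<delta>. 0 < \<delta> \<and> \<delta> \<le> 1/8 \<and>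
    (\<forall>(\<mu> :: 'a::euclidean_space measure) W F e R x z. near_extremal s \<gamma> lam Lam \<mu> W F e \<delta> R \<longrightarrow>
      norm x \<le> 2 * N \<longrightarrow> norm z \<le> N \<longrightarrow> \<rho>1 \<le> norm (x - z) \<longrightarrow> norm (x - z) \<le> 2 * N \<longrightarrow> 1 - \<delta> \<le> D2 (W 0) x e \<longrightarrow>
      (\<exists>x'. norm (x' - z) \<le> q * norm (x - z) \<and> 1 - \<kappa> \<le> D2 (W 0) x' e)))"
proof -
  define c0 where "c0 = (lam / (2 * Lam)) powr (1 / (2 * s))"
  define q0 where "q0 = sqrt (1 - c0\<^sup>2)"
  define b where "b = 2 * N + 2"
  have c0: "0 < c0" "c0 \<le> 1"
  proof -
    show "0 < c0" using lam by (simp add: c0_def)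
    have "lam / (2 * Lam) \<le> 1" using lam by (simp add: field_simps)
    then show "c0 \<le> 1" unfolding c0_def using s lam by (intro powr_le1) auto
  qed
  have q0: "0 \<le> q0" "q0 < 1"
    using c0 power_le_one[of c0 2] by (auto simp: q0_def)
  \<comment> \<open>Halfway between q0 and 1: the surplus (1 - q0) d / 2 absorbs the displacement
    \<rho> caused by moving from x to the maximum point y, as long as d is at least \<rho>1.\<close>
  define q where "q = (1 + q0) / 2"
  have q: "0 < q" "q < 1" using q0 by (auto simp: q_def)
  define \<rho> where "\<rho> = min 1 (min (c0 * \<rho>1 / 2) (\<rho>1 * (1 - q0) / 2))"
  have \<rho>: "0 < \<rho>" "\<rho> \<le> 1" "\<rho> \<le> c0 * \<rho>1 / 2" "\<rho> \<le> \<rho>1 * (1 - q0) / 2"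
    using c0 \<rho>1 q0 by (auto simp: \<rho>_def)
  have q_step: "q0 * (d + \<rho>) \<le> q * d" if "\<rho>1 \<le> d" for d
  proof -
    have "q0 * (d + \<rho>) \<le> q0 * d + 1 * \<rho>" using q0 \<rho> by (simp add: distrib_left mult_left_le_one_le)
    also have "\<rho> \<le> d * (1 - q0) / 2" using \<rho>(4) that q0 by (smt (verit) divide_right_mono mult_right_mono)
    finally show ?thesis by (simp add: q_def field_simps)
  qed
  have "\<exists>\<delta>. 0 < \<delta> \<and> \<delta> \<le> 1/8 \<and>
    (\<forall>(\<mu> :: 'a measure) W F e R x z. near_extremal s \<gamma> lam Lam \<mu> W F e \<delta> R \<longrightarrow>
      norm x \<le> 2 * N \<longrightarrow> norm z \<le> N \<longrightarrow> \<rho>1 \<le> norm (x - z) \<longrightarrow> norm (x - z) \<le> 2 * N \<longrightarrow> 1 - \<delta> \<le> D2 (W 0) x e \<longrightarrow>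
      (\<exists>x'. norm (x' - z) \<le> q * norm (x - z) \<and> 1 - \<kappa>' \<le> D2 (W 0) x' e))" if \<kappa>': "0 < \<kappa>'" for \<kappa>'
  proof -
    define \<kappa> where "\<kappa> = \<kappa>' / 3"
    have \<kappa>: "0 < \<kappa>" "3 * \<kappa> = \<kappa>'" using \<kappa>' by (auto simp: \<kappa>_def)
    obtain \<tau> where \<tau>: "0 < \<tau>" "\<tau> \<le> 1" "4 * (3 + 4 * Lam * time_const s \<gamma>) * \<tau> powr (\<gamma> / (2 * s)) \<le> \<kappa>"
      using exists_powr_small[of "4 * (3 + 4 * Lam * time_const s \<gamma>)" "\<gamma> / (2 * s)" \<kappa>]
        s \<gamma> lam \<kappa> time_const_nonneg[OF s \<gamma>(2)] by auto
    obtain l where l: "0 < l" "l \<le> 1" "holder_const \<gamma> * l powr holder_exp \<gamma> \<le> \<kappa>"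
      using exists_powr_small[of "holder_const \<gamma>" "holder_exp \<gamma>" \<kappa>] holder_const_pos[of \<gamma>] holder_exp[of \<gamma>] \<gamma> \<kappa> by auto
    define A where "A = Lam * jump_const s (\<rho> / 4) (8 / \<rho>\<^sup>2) + (4 / \<tau> + 4)"
    define B where "B = (\<kappa> * l / b powr (1 + 2 * s)) * (lam / 2)"
    have B: "0 < B" using \<kappa> l lam N by (auto simp: B_def b_def)
    \<comment> \<open>The first entry yields R \<ge> 8N + 8 through R \<ge> 1/\<delta>; the second
      makes the operator bound smaller than the loss \<kappa> m.\<close>
    define \<delta> where "\<delta> = min (1 / (8 * N + 8)) (B / (2 * (\<bar>A\<bar> + 1)))"
    have \<delta>: "0 < \<delta>" "\<delta> \<le> 1 / (8 * N + 8)" "\<delta> \<le> B / (2 * (\<bar>A\<bar> + 1))"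
      using B N by (auto simp: \<delta>_def)
    note \<delta>' = this
    have "1 / (8 * N + 8) \<le> 1/8" using N by (simp add: field_simps)
    then have \<delta>8: "\<delta> \<le> 1/8" using \<delta> by linarith
    have "A * \<delta> \<le> (\<bar>A\<bar> + 1) * (B / (2 * (\<bar>A\<bar> + 1)))"
      using \<delta> B by (intro mult_mono) auto
    also have "\<dots> = B / 2"
    proof -
      have "\<bar>A\<bar> + 1 \<noteq> 0" by linarith
      then show ?thesis by (simp add: divide_simps)
    qed
    finally have small: "A * \<delta> < B" using B by linarith
    show ?thesis
    proof (intro exI[of _ \<delta>] conjI allI impI)
      fix \<mu> :: "'a measure" and W F e R and x z :: 'a
      assume ne: "near_extremal s \<gamma> lam Lam \<mu> W F e \<delta> R"
        and x: "norm x \<le> 2 * N" and z: "norm z \<le> N" and xz: "\<rho>1 \<le> norm (x - z)" "norm (x - z) \<le> 2 * N"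
        and gx: "1 - \<delta> \<le> D2 (W 0) x e"
      interpret near_extremal s \<gamma> lam Lam \<mu> W F e \<delta> R by (rule ne)
      have "8 * N + 8 \<le> 1 / \<delta>" using frac_le[of 1 1 \<delta> "1 / (8 * N + 8)"] \<delta>'(1,2) N by simp
      then have "8 * N + 8 \<le> R" using R by linarith
      from approach_point[OF N this \<rho>1 \<rho>(1,2) _ \<tau> l \<kappa>(1) _ x z xz gx] \<rho>(3) small
      obtain x' where "norm (x' - z) \<le> q0 * (norm (x - z) + \<rho>)" "1 - 3 * \<kappa> \<le> D2 (W 0) x' e"
        unfolding A_def B_def b_def c0_def[symmetric] q0_def[symmetric] by blast
      then show "\<exists>x'. norm (x' - z) \<le> q * norm (x - z) \<and> 1 - \<kappa>' \<le> D2 (W 0) x' e"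
        using q_step[OF xz(1)] \<kappa>(2) by (metis order_trans)
    qed (use \<delta> \<delta>8 in auto)
  qed
  then show ?thesis using q by blast
qed

text \<open>Accuracies are chosen backwards: the last step dictates how good the point before it
  must be. A step is taken only while the distance to z is at least \<rho>1. Distances never
  increase beyond N, which keeps all points in the ball of radius 2N where a step is
  allowed.\<close>

lemma spread_to_ball:
  fixes s \<gamma> lam Lam N \<rho>1 \<kappa> :: real
  assumes s: "0 < s" "s < 1" and \<gamma>: "0 < \<gamma>" "\<gamma> < 2 * s" and lam: "0 < lam" "lam \<le> Lam"
    and N: "1 \<le> N" and \<rho>1: "0 < \<rho>1" and \<kappa>: "0 < \<kappa>"
  shows "\<exists>\<delta>. 0 < \<delta> \<and> \<delta> \<le> 1/8 \<and>
    (\<forall>(\<mu> :: 'a::euclidean_space measure) W F e R z. near_extremal s \<gamma> lam Lam \<mu> W F e \<delta> R \<longrightarrow>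
      1 - \<delta> \<le> D2 (W 0) 0 e \<longrightarrow> norm z \<le> N \<longrightarrow> (\<exists>x. norm (x - z) \<le> \<rho>1 \<and> 1 - \<kappa> \<le> D2 (W 0) x e))"
proof -
  from approach_step[OF assms(1-8), where 'a = 'a]
  obtain q where q: "0 < q" "q < 1" and step: "\<forall>\<kappa>>0. \<exists>\<delta>. 0 < \<delta> \<and> \<delta> \<le> 1/8 \<and>
    (\<forall>(\<mu> :: 'a::euclidean_space measure) W F e R x z. near_extremal s \<gamma> lam Lam \<mu> W F e \<delta> R \<longrightarrow>
      norm x \<le> 2 * N \<longrightarrow> norm z \<le> N \<longrightarrow> \<rho>1 \<le> norm (x - z) \<longrightarrow> norm (x - z) \<le> 2 * N \<longrightarrow> 1 - \<delta> \<le> D2 (W 0) x e \<longrightarrow>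
      (\<exists>x'. norm (x' - z) \<le> q * norm (x - z) \<and> 1 - \<kappa> \<le> D2 (W 0) x' e))" by blast
  have main: "\<exists>\<delta>. 0 < \<delta> \<and> \<delta> \<le> 1/8 \<and>
    (\<forall>(\<mu> :: 'a measure) W F e R z. near_extremal s \<gamma> lam Lam \<mu> W F e \<delta> R \<longrightarrow>
      1 - \<delta> \<le> D2 (W 0) 0 e \<longrightarrow> norm z \<le> N \<longrightarrow> (\<exists>x. norm (x - z) \<le> max \<rho>1 (q ^ k * N) \<and> norm (x - z) \<le> N \<and> 1 - \<kappa> \<le> D2 (W 0) x e))"
    if "0 < \<kappa>" for k \<kappa>
    using that
  proof (induction k arbitrary: \<kappa>)
    case 0
    show ?case
    proof (intro exI[of _ "min \<kappa> (1/8)"] conjI allI impI)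
      fix \<mu> :: "'a measure" and W F R and e z :: 'a
      assume "1 - min \<kappa> (1/8) \<le> D2 (W 0) 0 e" "norm z \<le> N"
      then show "\<exists>x. norm (x - z) \<le> max \<rho>1 (q ^ 0 * N) \<and> norm (x - z) \<le> N \<and> 1 - \<kappa> \<le> D2 (W 0) x e"
        by (intro exI[of _ 0]) auto
    qed (use 0 in auto)
  next
    case (Suc k)
    obtain \<delta>1 where \<delta>1: "0 < \<delta>1" "\<delta>1 \<le> 1/8" and st: "\<And>(\<mu> :: 'a measure) W F e R x z. near_extremal s \<gamma> lam Lam \<mu> W F e \<delta>1 R \<Longrightarrow>
      norm x \<le> 2 * N \<Longrightarrow> norm z \<le> N \<Longrightarrow> \<rho>1 \<le> norm (x - z) \<Longrightarrow> norm (x - z) \<le> 2 * N \<Longrightarrow> 1 - \<delta>1 \<le> D2 (W 0) x e \<Longrightarrow>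
      (\<exists>x'. norm (x' - z) \<le> q * norm (x - z) \<and> 1 - \<kappa> \<le> D2 (W 0) x' e)"
      using step Suc.prems by metis
    \<comment> \<open>Good enough to take one more step, and also to stop if x is already within
      \<rho>1 of z.\<close>
    define \<kappa>1 where "\<kappa>1 = min \<delta>1 \<kappa>"
    have "0 < \<kappa>1" using \<delta>1 Suc.prems by (simp add: \<kappa>1_def)
    from Suc.IH[OF this] obtain \<delta>2 where \<delta>2: "0 < \<delta>2" "\<delta>2 \<le> 1/8" and ih: "\<And>(\<mu> :: 'a measure) W F e R z. near_extremal s \<gamma> lam Lam \<mu> W F e \<delta>2 R \<Longrightarrow>
      1 - \<delta>2 \<le> D2 (W 0) 0 e \<Longrightarrow> norm z \<le> N \<Longrightarrow> (\<exists>x. norm (x - z) \<le> max \<rho>1 (q ^ k * N) \<and> norm (x - z) \<le> N \<and> 1 - \<kappa>1 \<le> D2 (W 0) x e)"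
      by metis
    show ?case
    proof (intro exI[of _ "min \<delta>1 \<delta>2"] conjI allI impI)
      fix \<mu> :: "'a measure" and W F e R and z :: 'a
      assume ne: "near_extremal s \<gamma> lam Lam \<mu> W F e (min \<delta>1 \<delta>2) R" and g0: "1 - min \<delta>1 \<delta>2 \<le> D2 (W 0) 0 e" and z: "norm z \<le> N"
      have ne1: "near_extremal s \<gamma> lam Lam \<mu> W F e \<delta>1 R" using near_extremal_mono[OF ne] \<delta>1 by simp
      have ne2: "near_extremal s \<gamma> lam Lam \<mu> W F e \<delta>2 R" using near_extremal_mono[OF ne] \<delta>2 by simp
      have "1 - \<delta>2 \<le> D2 (W 0) 0 e" using g0 by simp
      from ih[OF ne2 this z] obtain x where x: "norm (x - z) \<le> max \<rho>1 (q ^ k * N)" "norm (x - z) \<le> N" "1 - \<kappa>1 \<le> D2 (W 0) x e" by blast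
      show "\<exists>x. norm (x - z) \<le> max \<rho>1 (q ^ Suc k * N) \<and> norm (x - z) \<le> N \<and> 1 - \<kappa> \<le> D2 (W 0) x e"
      proof (cases "norm (x - z) < \<rho>1")
        case True
        then show ?thesis using x by (intro exI[of _ x]) (auto simp: \<kappa>1_def)
      next
        case False
        have "norm x \<le> 2 * N" using x(2) z norm_triangle_ineq2[of x z] by linarith
        moreover have "1 - \<delta>1 \<le> D2 (W 0) x e"
        proof -
          have "\<kappa>1 \<le> \<delta>1" by (simp add: \<kappa>1_def)
          then show ?thesis using x(3) by linarith
        qed
        moreover have "norm (x - z) \<le> 2 * N" "\<rho>1 \<le> norm (x - z)" using x(2) N False by auto
        ultimately obtain x' where x': "norm (x' - z) \<le> q * norm (x - z)" "1 - \<kappa> \<le> D2 (W 0) x' e"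
          using st[OF ne1 _ z] by blast
        have "q * norm (x - z) \<le> q * max \<rho>1 (q ^ k * N)" using x q by (intro mult_left_mono) auto
        also have "\<dots> \<le> max \<rho>1 (q ^ Suc k * N)"
        proof -
          have "q * \<rho>1 \<le> \<rho>1" using q \<rho>1 by simp
          then show ?thesis by (cases "\<rho>1 \<le> q ^ k * N") (simp_all add: max_absorb1 max_absorb2 mult.assoc le_max_iff_disj)
        qed
        finally have "norm (x' - z) \<le> max \<rho>1 (q ^ Suc k * N)" using x' by linarith
        moreover have "q * norm (x - z) \<le> 1 * norm (x - z)" using q by (intro mult_right_mono) auto
        then have "norm (x' - z) \<le> N" using x' x by linarith
        ultimately show ?thesis using x' by blast
      qed
    qed (use \<delta>1 \<delta>2 in auto)
  qed
  have "(\<lambda>k. q ^ k * N) \<longlonglongrightarrow> 0 * N"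
    using q by (intro tendsto_mult LIMSEQ_realpow_zero tendsto_const) auto
  then have "eventually (\<lambda>k. q ^ k * N < \<rho>1) sequentially" using \<rho>1 by (intro order_tendstoD) auto
  then obtain k where "q ^ k * N < \<rho>1" by (auto simp: eventually_sequentially)
  then have "max \<rho>1 (q ^ k * N) = \<rho>1" by simp
  with main[OF \<kappa>, of k] show ?thesis by metis
qed

lemma D2_double: "D2 w x (2 *\<^sub>R h) = D2 w (x + h) h + D2 w (x - h) h + 2 * D2 w x h"
  by (simp add: D2_def scaleR_2 algebra_simps)

theorem no_near_extremal:
  fixes s \<gamma> lam Lam :: real
  assumes s: "0 < s" "s < 1" and \<gamma>: "0 < \<gamma>" "\<gamma> < 2 * s" and lam: "0 < lam" "lam \<le> Lam"
  shows "\<exists>\<delta>. 0 < \<delta> \<and> \<delta> \<le> 1/8 \<and>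
    (\<forall>(\<mu> :: 'a::euclidean_space measure) W F e R. near_extremal s \<gamma> lam Lam \<mu> W F e \<delta> R \<longrightarrow> D2 (W 0) 0 e < 1 - \<delta>)"
proof -
  have "0 < 2 - \<gamma>" using \<gamma> s by simp
  \<comment> \<open>The contradiction will be 4^m \<le> 4 * 2^(m \<gamma>), that is m (2 - \<gamma>)
    \<le> 2.\<close>
  then obtain m :: nat where m: "3 < real m * (2 - \<gamma>)"
    using reals_Archimedean3 by blast
  define N where "N = (2::real) ^ m"
  have N: "1 \<le> N" by (simp add: N_def)
  obtain \<rho>1 where \<rho>1: "0 < \<rho>1" "\<rho>1 \<le> 1" "holder_const \<gamma> * \<rho>1 powr holder_exp \<gamma> \<le> 1/4"
    using exists_powr_small[of "holder_const \<gamma>" "holder_exp \<gamma>" "1/4"] holder_const_pos[of \<gamma>] holder_exp[of \<gamma>] \<gamma> by auto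
  obtain \<delta>0 where \<delta>0: "0 < \<delta>0" "\<delta>0 \<le> 1/8" and spread: "\<And>(\<mu> :: 'a::euclidean_space measure) W F e R z. near_extremal s \<gamma> lam Lam \<mu> W F e \<delta>0 R \<Longrightarrow>
      1 - \<delta>0 \<le> D2 (W 0) 0 e \<Longrightarrow> norm z \<le> N \<Longrightarrow> (\<exists>x. norm (x - z) \<le> \<rho>1 \<and> 1 - 1/4 \<le> D2 (W 0) x e)"
    using spread_to_ball[OF s \<gamma> lam N \<rho>1(1), of "1/4", where 'a = 'a, OF divide_pos_pos[OF zero_less_one zero_less_numeral]] by blast
  \<comment> \<open>The second entry forces R \<ge> N + 5, which leaves the ball of radius N the
    margin 4 that Hoelder continuity of g asks for.\<close>
  define \<delta> where "\<delta> = min \<delta>0 (1 / (N + 5))"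
  have \<delta>': "0 < \<delta>" "\<delta> \<le> \<delta>0" "\<delta> \<le> 1 / (N + 5)"
    using \<delta>0 N by (auto simp: \<delta>_def)
  show ?thesis
  proof (intro exI[of _ \<delta>] conjI allI impI)
    fix \<mu> :: "'a measure" and W F e R
    assume ne: "near_extremal s \<gamma> lam Lam \<mu> W F e \<delta> R"
    interpret near_extremal s \<gamma> lam Lam \<mu> W F e \<delta> R by (rule ne)
    have "N + 5 \<le> 1 / \<delta>" using frac_le[of 1 1 \<delta> "1 / (N + 5)"] \<delta>' N by simp
    then have RN: "N + 5 \<le> R" using R by linarith
    show "D2 (W 0) 0 e < 1 - \<delta>"
    proof (rule ccontr)
      assume "\<not> ?thesis"
      then have g0: "1 - \<delta>0 \<le> D2 (W 0) 0 e" using \<delta>' by linarith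
      have half: "1/2 \<le> D2 (W 0) z e" if z: "norm z \<le> N" for z
      proof -
        obtain x where x: "norm (x - z) \<le> \<rho>1" "1 - 1/4 \<le> D2 (W 0) x e"
          using spread[OF near_extremal_mono[OF ne \<delta>'(2) \<delta>0(2)] g0 z] by blast
        have "\<bar>g 0 (z + (x - z)) - g 0 z\<bar> \<le> holder_const \<gamma> * norm (x - z) powr holder_exp \<gamma>"
          by (rule g_holder) (use x \<rho>1 z RN in auto)
        also have "\<dots> \<le> holder_const \<gamma> * \<rho>1 powr holder_exp \<gamma>"
          using x holder_exp[of \<gamma>] \<gamma> holder_const_pos[of \<gamma>] by (intro mult_left_mono powr_mono2) auto
        also note \<rho>1(3)
        finally show ?thesis using x by (simp add: g_def) (simp add: abs_if split: if_splits)
      qed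
      \<comment> \<open>By D2_double the values at step 2^k decompose into values at unit step in points of the ball of radius N.\<close>
      have grow: "4 ^ k / 2 \<le> D2 (W 0) x (2 ^ k *\<^sub>R e)" if "norm x \<le> N + 1 - 2 ^ k" for k x
        using that
      proof (induction k arbitrary: x)
        case 0
        then show ?case using half by simp
      next
        case (Suc k)
        have ne: "norm (2 ^ k *\<^sub>R e) = 2 ^ k" by (simp add: e)
        have "2 ^ Suc k = 2 * (2::real) ^ k" by simp
        then have n: "norm (x + 2 ^ k *\<^sub>R e) \<le> N + 1 - 2 ^ k" "norm (x - 2 ^ k *\<^sub>R e) \<le> N + 1 - 2 ^ k" "norm x \<le> N + 1 - 2 ^ k"
          using Suc.prems ne norm_triangle_ineq[of x "2 ^ k *\<^sub>R e"] norm_triangle_ineq4[of x "2 ^ k *\<^sub>R e"] zero_le_power[of "2::real" k] by linarith+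
        have "D2 (W 0) x (2 ^ Suc k *\<^sub>R e) = D2 (W 0) x (2 *\<^sub>R (2 ^ k *\<^sub>R e))" by simp
        also note D2_double
        finally show ?case using Suc.IH[OF n(1)] Suc.IH[OF n(2)] Suc.IH[OF n(3)] by simp
      qed
      have "norm (0::'a) \<le> N + 1 - 2 ^ m" by (simp add: N_def)
      from grow[OF this] have "4 ^ m / 2 \<le> \<bar>D2 (W 0) 0 (N *\<^sub>R e)\<bar>" by (simp add: N_def)
      also have "\<dots> \<le> (1 + \<delta>) * norm (N *\<^sub>R e) powr \<gamma>"
        using RN N by (intro D2W) (auto simp: e)
      also have "\<dots> \<le> 2 * N powr \<gamma>" using N near_extremal.\<delta>(2)[OF ne] by (simp add: e mult_right_mono)
      finally have "4 ^ m \<le> 4 * N powr \<gamma>" by simp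
      moreover have "(4::real) ^ m = 2 powr (2 * m)" by (simp add: powr_realpow[symmetric] powr_powr[symmetric] powr_mult)
      moreover have "N powr \<gamma> = 2 powr (m * \<gamma>)" by (simp add: N_def powr_realpow[symmetric] powr_powr)
      moreover have "(4::real) = 2 powr 2" by simp
      ultimately have "2 powr (2 * m) \<le> (2::real) powr (2 + m * \<gamma>)" by (simp only: powr_add)
      then have "2 * m \<le> 2 + m * \<gamma>" by simp
      then show False using m by (simp add: algebra_simps)
    qed
  qed (use \<delta>' \<delta>0 in auto)
qed

section \<open>Blow-up\<close>

text \<open>Comparable to the parabolic distance to the lateral and initial boundary of the cylinder {-3/4<..<0} \<times> ball 0 (3/4). Weighting the
quotients by its power \<gamma> makes their supremum insensitive to that boundary.\<close>

definition par_dist :: "real \<Rightarrow> real \<Rightarrow> 'a::real_normed_vector \<Rightarrow> real" where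
  "par_dist s t x = min (3/4 - norm x) ((t + 3/4) powr (1 / (2 * s)))"

text \<open>Space is scaled by |h0|, time by |h0|^(2s), and c turns the bound M into 1 at the
  centre. The radius R is \<delta>/8 times the weight in units of |h0|, so the weight varies by a
  factor of at least 1 - \<delta>/8 over the new cylinder. The two \<open>ratio\<close> conditions
  give R \<ge> 1/\<delta> and keep the unit time interval inside; the conditions on K make the
  source and the sup norm small.\<close>

lemma blowup_is_near_extremal:
  fixes W f :: "real \<Rightarrow> 'a::euclidean_space \<Rightarrow> real"
  assumes s: "0 < s" "s < 1" and \<gamma>: "0 < \<gamma>" "\<gamma> < 2 * s" and lam: "0 < lam" "lam \<le> Lam"
    and sp: "spectral_measure s lam Lam \<mu>" and b: "b < 0"
    and contW: "continuous_on UNIV (\<lambda>(t, x). W t x)" and c11W: "\<And>t. c11 (W t)"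
    and W_le: "\<And>t x. \<bar>W t x\<bar> \<le> A" and A: "0 < A"
    and eqW: "\<And>t x. -3/4 < t \<Longrightarrow> t \<le> b \<Longrightarrow> norm x < 3/4 \<Longrightarrow>
      ((\<lambda>t. W t x) has_real_derivative (slice_op s \<mu> (W t) x + f t x)) (at t)"
    and f_le: "\<And>t x. -3/4 < t \<Longrightarrow> t \<le> b \<Longrightarrow> norm x < 3/4 \<Longrightarrow> \<bar>f t x\<bar> \<le> A"
    and M: "\<And>t x h. -3/4 < t \<Longrightarrow> t \<le> b \<Longrightarrow> norm x < 3/4 \<Longrightarrow> norm h \<le> par_dist s t x / 2 \<Longrightarrow>
      par_dist s t x powr \<gamma> * \<bar>D2 (W t) x h\<bar> \<le> M * norm h powr \<gamma>"
    and \<delta>: "0 < \<delta>" "\<delta> \<le> 1/8"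
    and K: "K * A \<le> M" "(\<delta> / 8) powr (- \<gamma>) / \<delta> \<le> K" "1 / \<delta> \<le> K"
    and z0: "-3/4 < t0" "t0 \<le> b" "norm x0 < 3/4" and h0: "h0 \<noteq> 0"
    and ratio: "1 / (\<delta> * (\<delta> / 8)) \<le> par_dist s t0 x0 / norm h0"
      "1 \<le> (1 - (1 - \<delta> / 8) powr (2 * s)) * (par_dist s t0 x0 / norm h0) powr (2 * s)"
    and \<sigma>: "\<bar>\<sigma>\<bar> = 1"
    and c: "c = par_dist s t0 x0 powr \<gamma> / (M * norm h0 powr \<gamma>)"
  shows "near_extremal s \<gamma> lam Lam \<mu>
     (\<lambda>t x. \<sigma> * c * W (t0 + norm h0 powr (2 * s) * t) (x0 + norm h0 *\<^sub>R x))
     (\<lambda>t x. \<sigma> * c * norm h0 powr (2 * s) * f (t0 + norm h0 powr (2 * s) * t) (x0 + norm h0 *\<^sub>R x))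
     ((1 / norm h0) *\<^sub>R h0) \<delta> (\<delta> / 8 * (par_dist s t0 x0 / norm h0))"
proof -
  define d0 where "d0 = par_dist s t0 x0"
  define \<rho> where "\<rho> = norm h0"
  define R where "R = \<delta> / 8 * (d0 / \<rho>)"
  define T where "T = (\<lambda>t. t0 + \<rho> powr (2 * s) * t)"
  define X where "X = (\<lambda>x. x0 + \<rho> *\<^sub>R x)"
  have \<rho>: "0 < \<rho>" using h0 by (simp add: \<rho>_def)
  have d0: "0 < d0" "d0 < 1"
  proof -
    show "0 < d0" using z0 by (simp add: d0_def par_dist_def)
    have "d0 \<le> 3/4 - norm x0" by (simp add: d0_def par_dist_def)
    then show "d0 < 1" using norm_ge_zero[of x0] by linarith
  qed
  have K0: "0 < K" using K(3) \<delta> by (smt (verit) divide_pos_pos)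
  have M0: "0 < M" using K(1) mult_pos_pos[OF K0 A] by linarith
  have AM: "A / M \<le> 1 / K" using K(1) K0 M0 by (simp add: field_simps)
  have c_eq: "c = d0 powr \<gamma> / (M * \<rho> powr \<gamma>)" using c by (simp add: d0_def \<rho>_def)
  have c0: "0 < c" unfolding c_eq using d0 M0 \<rho> by simp
  have \<rho>R: "\<rho> * R = \<delta> / 8 * d0" using \<rho> by (simp add: R_def)
  have d0\<rho>: "1 / (\<delta> * (\<delta> / 8)) \<le> d0 / \<rho>" using ratio(1) by (simp add: d0_def \<rho>_def)
  have R_large: "1 / \<delta> \<le> R"
  proof -
    have "1 / \<delta> = \<delta> / 8 * (1 / (\<delta> * (\<delta> / 8)))" using \<delta> by (simp add: field_simps)
    also have "\<dots> \<le> \<delta> / 8 * (d0 / \<rho>)" using \<delta> by (intro mult_left_mono d0\<rho>) auto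
    finally show ?thesis by (simp add: R_def)
  qed
  have "1 / \<delta> \<ge> 8" using \<delta> by (simp add: field_simps)
  then have R8: "8 \<le> R" using R_large by linarith
  have "\<delta> / 8 * (d0 / \<rho>) \<le> 1 * (d0 / \<rho>)" using \<delta> d0 \<rho> by (intro mult_right_mono) auto
  then have "1 \<le> d0 / \<rho>" using R8 by (simp add: R_def)
  then have \<rho>1: "\<rho> \<le> d0" "\<rho> \<le> 1" using \<rho> d0 by (auto simp: le_divide_eq)
  have \<rho>s: "\<rho> powr (2 * s) \<le> (1 - (1 - \<delta> / 8) powr (2 * s)) * d0 powr (2 * s)"
  proof -
    have "\<rho> powr (2 * s) * 1 \<le> \<rho> powr (2 * s) * ((1 - (1 - \<delta> / 8) powr (2 * s)) * (d0 / \<rho>) powr (2 * s))"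
      using ratio(2) by (intro mult_left_mono) (auto simp: d0_def \<rho>_def)
    also have "\<dots> = (1 - (1 - \<delta> / 8) powr (2 * s)) * d0 powr (2 * s)"
      using \<rho> d0 by (simp add: powr_divide)
    finally show ?thesis by simp
  qed
  \<comment> \<open>On the rescaled cylinder the solution stays in the domain of the equation and
    the weight loses at most the factor 1 - \<delta>/8.\<close>
  have region: "-3/4 < T t \<and> T t \<le> b \<and> norm (X x) < 3/4 \<and> (1 - \<delta> / 8) * d0 \<le> par_dist s (T t) (X x)"
    if t: "t \<in> {-1..0}" and x: "norm x \<le> R" for t x
  proof -
    have "norm (X x) \<le> norm x0 + \<rho> * norm x"
      using norm_triangle_ineq[of x0 "\<rho> *\<^sub>R x"] \<rho> by (simp add: X_def)
    also have "\<rho> * norm x \<le> \<rho> * R" using x \<rho> by simp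
    also note \<rho>R
    finally have n: "norm (X x) \<le> norm x0 + \<delta> / 8 * d0" by simp
    have d0x: "d0 \<le> 3/4 - norm x0" "d0 \<le> (t0 + 3/4) powr (1 / (2 * s))" by (auto simp: d0_def par_dist_def)
    have pos: "0 < (1 - \<delta> / 8) * d0" using \<delta> d0 by simp
    have n1: "(1 - \<delta> / 8) * d0 \<le> 3/4 - norm (X x)" using n d0x by (simp add: algebra_simps)
    have "d0 powr (2 * s) \<le> ((t0 + 3/4) powr (1 / (2 * s))) powr (2 * s)" using d0 d0x s by (intro powr_mono2) auto
    also have "\<dots> = t0 + 3/4" using s z0 by (simp add: powr_powr)
    finally have "d0 powr (2 * s) \<le> t0 + 3/4" .
    moreover have "((1 - \<delta> / 8) * d0) powr (2 * s) = (1 - \<delta> / 8) powr (2 * s) * d0 powr (2 * s)"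
      using \<delta> d0 by (simp add: powr_mult)
    moreover have "\<rho> powr (2 * s) * t \<ge> \<rho> powr (2 * s) * (-1)" using t by (intro mult_left_mono) auto
    ultimately have tt: "((1 - \<delta> / 8) * d0) powr (2 * s) \<le> T t + 3/4"
      using \<rho>s by (simp add: T_def algebra_simps)
    have "0 < ((1 - \<delta> / 8) * d0) powr (2 * s)" using less_imp_neq[OF pos] by (simp only: powr_gt_zero)
    then have T1: "-3/4 < T t" using tt by linarith
    have "((1 - \<delta> / 8) * d0) = (((1 - \<delta> / 8) * d0) powr (2 * s)) powr (1 / (2 * s))"
      using s pos by (simp add: powr_powr)
    also have "\<dots> \<le> (T t + 3/4) powr (1 / (2 * s))" using tt s by (intro powr_mono2) auto
    finally have "(1 - \<delta> / 8) * d0 \<le> par_dist s (T t) (X x)" using n1 by (simp add: par_dist_def)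
    moreover have "\<rho> powr (2 * s) * t \<le> 0" using t by (intro mult_nonneg_nonpos) auto
    then have "T t \<le> b" using z0 by (simp add: T_def)
    moreover have "norm (X x) < 3/4" using n1 pos by linarith
    ultimately show ?thesis using T1 by blast
  qed
  have slice: "slice_op s \<mu> (\<lambda>x. \<sigma> * c * W (T t) (X x)) x = \<sigma> * c * (\<rho> powr (2 * s) * slice_op s \<mu> (W (T t)) (X x))" for t x
  proof -
    have "slice_op s \<mu> (\<lambda>x. \<sigma> * c * W (T t) (X x) + 0 * W (T t) (X x)) x
       = \<sigma> * c * slice_op s \<mu> (\<lambda>x. W (T t) (X x)) x + 0 * slice_op s \<mu> (\<lambda>x. W (T t) (X x)) x"
      unfolding X_def using c11W lam s sp by (intro slice_op_linear_comb c11_affine) auto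
    then show ?thesis using slice_op_affine[of \<rho> s \<mu> "W (T t)" x0 x] \<rho> by (simp add: X_def)
  qed
  have "near_extremal s \<gamma> lam Lam \<mu> (\<lambda>t x. \<sigma> * c * W (T t) (X x)) (\<lambda>t x. \<sigma> * c * \<rho> powr (2 * s) * f (T t) (X x)) ((1 / \<rho>) *\<^sub>R h0) \<delta> R"
  proof
    show "norm ((1 / \<rho>) *\<^sub>R h0) = 1" using h0 by (simp add: \<rho>_def)
    show "continuous_on UNIV (\<lambda>(t, x). \<sigma> * c * W (T t) (X x))"
    proof -
      have "continuous_on UNIV ((\<lambda>(t, x). W t x) \<circ> (\<lambda>z. (T (fst z), X (snd z))))"
        unfolding T_def X_def
        by (intro continuous_on_compose continuous_on_subset[OF contW] continuous_intros) auto
      then show ?thesis unfolding comp_def case_prod_beta by (intro continuous_intros) simp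
    qed
    show "c11 (\<lambda>x. \<sigma> * c * W (T t) (X x))" for t
      unfolding X_def using c11_linear_comb[OF c11_affine c11_affine, OF c11W c11W, of "\<sigma> * c" "T t" x0 \<rho> 0]
      by simp
    fix t :: real and x :: 'a assume t: "t \<in> {-1..0}" and x: "norm x \<le> R"
    note r = region[OF this]
    have dW: "((\<lambda>t. W t (X x)) has_real_derivative slice_op s \<mu> (W (T t)) (X x) + f (T t) (X x)) (at (T t))"
      using eqW r by blast
    have dT: "(T has_real_derivative \<rho> powr (2 * s)) (at t)" unfolding T_def by (auto intro!: derivative_eq_intros)
    show "((\<lambda>t. \<sigma> * c * W (T t) (X x)) has_real_derivative
          slice_op s \<mu> (\<lambda>x. \<sigma> * c * W (T t) (X x)) x + \<sigma> * c * \<rho> powr (2 * s) * f (T t) (X x)) (at t)"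
      unfolding slice using DERIV_cmult[OF DERIV_chain2[OF dW dT], of "\<sigma> * c"] by (simp add: algebra_simps)
    show "\<bar>\<sigma> * c * \<rho> powr (2 * s) * f (T t) (X x)\<bar> \<le> \<delta>"
    proof -
      have "\<rho> powr (2 * s) \<le> \<rho> powr \<gamma>" using \<rho> \<rho>1 \<gamma> by (intro powr_mono') auto
      moreover have "d0 powr \<gamma> \<le> 1" using d0 \<gamma> by (intro powr_le1) auto
      ultimately have "d0 powr \<gamma> * \<rho> powr (2 * s) \<le> 1 * \<rho> powr \<gamma>" by (intro mult_mono) auto
      then have "c * \<rho> powr (2 * s) \<le> 1 / M"
        unfolding c_eq using M0 \<rho> by (simp add: field_simps)
      then have "(c * \<rho> powr (2 * s)) * \<bar>f (T t) (X x)\<bar> \<le> 1 / M * A"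
        using f_le r A M0 by (intro mult_mono) auto
      also have "\<dots> \<le> 1 / K" using AM by simp
      also have "\<dots> \<le> \<delta>" using K(3) K0 \<delta> by (simp add: field_simps)
      finally show ?thesis using \<sigma> c0 by (simp add: abs_mult)
    qed
    fix h :: 'a assume h: "norm h \<le> R"
    define d where "d = par_dist s (T t) (X x)"
    have d: "(1 - \<delta> / 8) * d0 \<le> d" using r by (simp add: d_def)
    have pos: "0 < (1 - \<delta> / 8) * d0" using \<delta> d0 by simp
    have "norm (\<rho> *\<^sub>R h) \<le> \<rho> * R" using h \<rho> by simp
    also have "\<dots> \<le> ((1 - \<delta> / 8) * d0) / 2"
    proof -
      have "\<delta> / 8 * d0 \<le> ((1 - \<delta> / 8) / 2) * d0" using \<delta> d0 by (intro mult_right_mono) auto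
      then show ?thesis by (simp add: \<rho>R)
    qed
    also have "\<dots> \<le> d / 2" using d by simp
    finally have "d powr \<gamma> * \<bar>D2 (W (T t)) (X x) (\<rho> *\<^sub>R h)\<bar> \<le> M * norm (\<rho> *\<^sub>R h) powr \<gamma>"
      unfolding d_def using r by (intro M) auto
    then have 1: "d powr \<gamma> * \<bar>D2 (W (T t)) (X x) (\<rho> *\<^sub>R h)\<bar> \<le> M * \<rho> powr \<gamma> * norm h powr \<gamma>"
      using \<rho> by (simp add: powr_mult mult.assoc)
    have dd: "((1 - \<delta> / 8) * d0) powr \<gamma> \<le> d powr \<gamma>" using d pos \<gamma> by (intro powr_mono2) auto
    have "D2 (\<lambda>x. \<sigma> * c * W (T t) (X x)) x h = \<sigma> * c * D2 (W (T t)) (X x) (\<rho> *\<^sub>R h)"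
      by (simp add: D2_def X_def algebra_simps)
    then have "\<bar>D2 (\<lambda>x. \<sigma> * c * W (T t) (X x)) x h\<bar> = c * \<bar>D2 (W (T t)) (X x) (\<rho> *\<^sub>R h)\<bar>"
      using \<sigma> c0 by (simp add: abs_mult)
    also have "\<dots> \<le> (1 + \<delta>) * norm h powr \<gamma>"
    proof -
      have "((1 - \<delta> / 8) powr \<gamma> * d0 powr \<gamma>) * \<bar>D2 (W (T t)) (X x) (\<rho> *\<^sub>R h)\<bar> \<le> M * \<rho> powr \<gamma> * norm h powr \<gamma>"
        using dd 1 \<delta> d0 by (smt (verit) abs_ge_zero mult_right_mono powr_mult)
      then have "(1 - \<delta> / 8) powr \<gamma> * (c * \<bar>D2 (W (T t)) (X x) (\<rho> *\<^sub>R h)\<bar>) \<le> norm h powr \<gamma>"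
        unfolding c_eq using M0 \<rho> by (simp add: field_simps)
      \<comment> \<open>The lost weight is absorbed in the slack 1 + \<delta>: as \<gamma> < 2, it
        suffices that (1 + \<delta>) (1 - \<delta>/8)^2 \<ge> 1.\<close>
      also have "norm h powr \<gamma> \<le> ((1 + \<delta>) * (1 - \<delta> / 8) powr \<gamma>) * norm h powr \<gamma>"
      proof -
        have "(1 - \<delta> / 8) powr 2 \<le> (1 - \<delta> / 8) powr \<gamma>"
          using \<delta> \<gamma> s by (intro powr_mono') auto
        moreover have "(1 - \<delta> / 8) powr 2 = (1 - \<delta> / 8)\<^sup>2" using \<delta> by simp
        moreover have "1 \<le> (1 + \<delta>) * (1 - \<delta> / 8)\<^sup>2"
        proof -
          have "1 - \<delta> / 4 \<le> (1 - \<delta> / 8)\<^sup>2" by (simp add: power2_diff power_divide)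
          then have "(1 + \<delta>) * (1 - \<delta> / 4) \<le> (1 + \<delta>) * (1 - \<delta> / 8)\<^sup>2"
            using \<delta> by (intro mult_left_mono) auto
          moreover have "(1 + \<delta>) * (1 - \<delta> / 4) = 1 + \<delta> * (3/4 - \<delta> / 4)"
            by (simp add: field_simps)
          moreover have "0 \<le> \<delta> * (3/4 - \<delta> / 4)" using \<delta> by (intro mult_nonneg_nonneg) auto
          ultimately show ?thesis by linarith
        qed
        ultimately have "1 \<le> (1 + \<delta>) * (1 - \<delta> / 8) powr \<gamma>"
          using \<delta> by (smt (verit) mult_left_mono)
        from mult_right_mono[OF this, of "norm h powr \<gamma>"] show ?thesis by simp
      qed
      finally have "(1 - \<delta> / 8) powr \<gamma> * (c * \<bar>D2 (W (T t)) (X x) (\<rho> *\<^sub>R h)\<bar>) \<le> (1 - \<delta> / 8) powr \<gamma> * ((1 + \<delta>) * norm h powr \<gamma>)"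
        by (simp add: mult.assoc mult.left_commute)
      moreover have "0 < (1 - \<delta> / 8) powr \<gamma>" using \<delta> by simp
      ultimately show ?thesis by (rule mult_left_le_imp_le)
    qed
    finally show "\<bar>D2 (\<lambda>x. \<sigma> * c * W (T t) (X x)) x h\<bar> \<le> (1 + \<delta>) * norm h powr \<gamma>" .
  next
    fix t :: real and x :: 'a
    have "\<bar>\<sigma> * c * W (T t) (X x)\<bar> \<le> c * A" using \<sigma> c0 W_le by (simp add: abs_mult)
    \<comment> \<open>The factor (d0/\<rho>)^\<gamma> is huge but equals (8 R / \<delta>)^\<gamma>,
      so it has the permitted growth in R; the size of K takes care of the power of
      \<delta>/8.\<close>
    also have "c * A = (A / M) * (d0 / \<rho>) powr \<gamma>" unfolding c_eq using d0 \<rho> by (simp add: powr_divide)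
    also have "\<dots> \<le> (1 / K) * (d0 / \<rho>) powr \<gamma>" by (intro mult_right_mono AM) auto
    also have "d0 / \<rho> = R / (\<delta> / 8)" using \<delta> by (simp add: R_def)
    also have "(R / (\<delta> / 8)) powr \<gamma> = R powr \<gamma> * (\<delta> / 8) powr (- \<gamma>)"
      using R8 \<delta> by (simp only: powr_divide powr_minus_divide) simp
    also have "1 / K * (R powr \<gamma> * (\<delta> / 8) powr (- \<gamma>)) \<le> \<delta> * R powr \<gamma>"
    proof -
      have "(\<delta> / 8) powr (- \<gamma>) \<le> \<delta> * K" using K(2) \<delta> by (simp add: field_simps)
      then have "(1 / K) * (\<delta> / 8) powr (- \<gamma>) \<le> \<delta>" using K0 by (simp add: field_simps)
      from mult_right_mono[OF this, of "R powr \<gamma>"] show ?thesis by (simp add: mult_ac)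
    qed
    finally show "\<bar>\<sigma> * c * W (T t) (X x)\<bar> \<le> \<delta> * R powr \<gamma>" .
  qed (use s \<gamma> lam sp \<delta> R_large in auto)
  then show ?thesis by (simp add: T_def X_def \<rho>_def R_def d0_def)
qed

text \<open>Only A enters the estimates; the bound Q serves to make the weighted supremum finite.\<close>

definition smooth_solution ::
    "real \<Rightarrow> 'a::euclidean_space measure \<Rightarrow> (real \<Rightarrow> 'a \<Rightarrow> real) \<Rightarrow> (real \<Rightarrow> 'a \<Rightarrow> real) \<Rightarrow>
     real \<Rightarrow> real \<Rightarrow> real \<Rightarrow> bool" where
  "smooth_solution s \<mu> W f A Q b \<longleftrightarrow> b < 0 \<and>
    continuous_on UNIV (\<lambda>(t, x). W t x) \<and> (\<forall>t. c11 (W t)) \<and> (\<forall>t x. W t differentiable (at x)) \<and>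
    (\<forall>t x h. \<bar>D2 (W t) x h\<bar> \<le> Q * (norm h)\<^sup>2) \<and> (\<forall>t x. \<bar>W t x\<bar> \<le> A) \<and>
    (\<forall>t x. -3/4 < t \<longrightarrow> t \<le> b \<longrightarrow> norm x < 3/4 \<longrightarrow>
      ((\<lambda>t. W t x) has_real_derivative (slice_op s \<mu> (W t) x + f t x)) (at t) \<and> \<bar>f t x\<bar> \<le> A)"

text \<open>If the weighted supremum M exceeds K0 A, a near maximiser has a step h0 tiny compared
  with its weight, since second differences never exceed 4 A. This scale separation is what the
  blow-up requires, and the blow-up is excluded by \<open>no_near_extremal\<close>.\<close>

theorem interior_D2_estimate:
  fixes s \<gamma> lam Lam :: real
  assumes s: "0 < s" "s < 1" and \<gamma>: "0 < \<gamma>" "\<gamma> < 2 * s" and lam: "0 < lam" "lam \<le> Lam"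
  shows "\<exists>K>0. \<forall>(\<mu> :: 'a::euclidean_space measure) W f A Q b.
    spectral_measure s lam Lam \<mu> \<longrightarrow> smooth_solution s \<mu> W f A Q b \<longrightarrow>
    (\<forall>t x h. -5/8 \<le> t \<longrightarrow> t \<le> b \<longrightarrow> norm x \<le> 5/8 \<longrightarrow> \<bar>D2 (W t) x h\<bar> \<le> K * A * norm h powr \<gamma>)"
proof -
  obtain \<delta> where \<delta>: "0 < \<delta>" "\<delta> \<le> 1/8" and key: "\<And>(\<mu> :: 'a::euclidean_space measure) W F e R.
      near_extremal s \<gamma> lam Lam \<mu> W F e \<delta> R \<Longrightarrow> D2 (W 0) 0 e < 1 - \<delta>"
    using no_near_extremal[OF assms, where 'a = 'a] by metis
  define Y where "Y = 1 - (1 - \<delta> / 8) powr (2 * s)"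
  have Y: "0 < Y"
  proof -
    have "(1 - \<delta> / 8) powr (2 * s) < 1 powr (2 * s)" using \<delta> s by (intro powr_less_mono2) auto
    then show ?thesis by (simp add: Y_def)
  qed
  \<comment> \<open>The two entries are the thresholds for the quotient of weight and step that
    correspond to the two \<open>ratio\<close> conditions of the blow-up.\<close>
  define Z where "Z = max (1 / (\<delta> * (\<delta> / 8))) ((1 / Y) powr (1 / (2 * s)))"
  have Z0: "0 < Z" using \<delta> by (simp add: Z_def less_max_iff_disj)
  \<comment> \<open>The entry 8 Z^\<gamma> enforces scale separation: at a near maximiser the
    weighted quotient is at least M/2, while the second difference is at most 4 A.\<close>
  define K0 where "K0 = max (8 * Z powr \<gamma>) (max ((\<delta> / 8) powr (- \<gamma>) / \<delta>) (1 / \<delta>))"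
  have K0: "8 * Z powr \<gamma> \<le> K0" "(\<delta> / 8) powr (- \<gamma>) / \<delta> \<le> K0" "1 / \<delta> \<le> K0"
    by (auto simp: K0_def)
  have "0 < 1 / \<delta>" using \<delta> by simp
  then have K0pos: "0 < K0" using K0(3) by linarith
  \<comment> \<open>A lower bound for the weight on the smaller cylinder, which keeps distance 1/8
    from the lateral boundary and from the initial time.\<close>
  define c1 where "c1 = min (1/8) ((1/8) powr (1 / (2 * s)))"
  have c1: "0 < c1" by (simp add: c1_def)
  \<comment> \<open>The second summand covers steps longer than c1/2, where the trivial bound 4 A is
    used.\<close>
  define K where "K = K0 / c1 powr \<gamma> + 4 / (c1 / 2) powr \<gamma>"
  have K: "0 < K" using K0pos c1 by (auto simp: K_def intro!: add_pos_pos)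
  have main: "par_dist s t x powr \<gamma> * \<bar>D2 (W t) x h\<bar> \<le> K0 * A * norm h powr \<gamma>"
    if sp: "spectral_measure s lam Lam \<mu>" and b: "b < 0"
    and contW: "continuous_on UNIV (\<lambda>(t, x). W t x)" and c11W: "\<And>t. c11 (W t)"
    and Q: "\<And>t x h. \<bar>D2 (W t) x h\<bar> \<le> Q * (norm h)\<^sup>2" and W_le: "\<And>t x. \<bar>W t x\<bar> \<le> A" and A: "0 < A"
    and eqW: "\<And>t x. -3/4 < t \<Longrightarrow> t \<le> b \<Longrightarrow> norm x < 3/4 \<Longrightarrow>
      ((\<lambda>t. W t x) has_real_derivative (slice_op s \<mu> (W t) x + f t x)) (at t)"
    and f_le: "\<And>t x. -3/4 < t \<Longrightarrow> t \<le> b \<Longrightarrow> norm x < 3/4 \<Longrightarrow> \<bar>f t x\<bar> \<le> A"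
    and tx: "-3/4 < t" "t \<le> b" "norm x < 3/4" "norm h \<le> par_dist s t x / 2"
    for \<mu> :: "'a measure" and W f :: "real \<Rightarrow> 'a \<Rightarrow> real" and A Q b t and x h :: 'a
  proof (rule ccontr)
    assume neg: "\<not> ?thesis"
    define V where "V = (\<lambda>(t, x, h). par_dist s t x powr \<gamma> * \<bar>D2 (W t) x h\<bar> / norm h powr \<gamma>)"
    define D where "D = {(t, x :: 'a, h :: 'a). -3/4 < t \<and> t \<le> b \<and> norm x < 3/4 \<and> norm h \<le> par_dist s t x / 2 \<and> h \<noteq> 0}"
    have D01: "D2 (W t) x 0 = 0" for t x by (simp add: D2_def)
    have h: "h \<noteq> 0" using neg A K0pos by (auto simp: D01)
    then have txD: "(t, x, h) \<in> D" using tx by (simp add: D_def)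
    have V1: "K0 * A < V (t, x, h)" using neg h by (simp add: V_def field_simps)
    have par1: "par_dist s t x \<le> 1" for t and x :: 'a using norm_ge_zero[of x] unfolding par_dist_def by linarith
    have par0: "0 < par_dist s t x" if "-3/4 < t" "norm x < 3/4" for t and x :: 'a using that by (simp add: par_dist_def)
    have bdd: "bdd_above (V ` D)"
    proof (rule bdd_aboveI2)
      fix z assume "z \<in> D"
      then obtain t x h where z: "z = (t, x, h)" "-3/4 < t" "norm x < 3/4" "norm h \<le> par_dist s t x / 2" "h \<noteq> 0"
        by (auto simp: D_def)
      have h1: "norm h \<le> 1" using z par1[of t x] by simp
      have Q0: "0 \<le> Q * (norm h)\<^sup>2" using Q[of t x h] by linarith
      have "par_dist s t x powr \<gamma> * \<bar>D2 (W t) x h\<bar> \<le> 1 * (Q * (norm h)\<^sup>2)"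
        using par1[of t x] par0[OF z(2,3)] \<gamma> Q[of t x h] by (intro mult_mono powr_le1) auto
      also have "\<dots> \<le> Q * norm h powr \<gamma>"
      proof -
        have "(norm h)\<^sup>2 = norm h powr 2" using z by simp
        also have "\<dots> \<le> norm h powr \<gamma>" using h1 \<gamma> s by (intro powr_mono') auto
        finally have "(norm h)\<^sup>2 \<le> norm h powr \<gamma>" .
        moreover have "0 \<le> Q" using Q0 z by (simp add: zero_le_mult_iff)
        ultimately show ?thesis by (simp add: mult_left_mono)
      qed
      finally show "V z \<le> Q" using z by (simp add: V_def field_simps)
    qed
    define M where "M = Sup (V ` D)"
    have MV: "V z \<le> M" if "z \<in> D" for z unfolding M_def using bdd that by (rule cSUP_upper2) simp
    have KM: "K0 * A < M" using V1 MV[OF txD] by simp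
    have M0: "0 < M" using KM mult_pos_pos[OF K0pos A] by linarith
    \<comment> \<open>The supremum need not be attained. A relative loss \<delta> is affordable
      because the contradiction only asks for a value above 1 - \<delta>.\<close>
    have "M - \<delta> * M < M" using \<delta> M0 by simp
    then obtain z where "z \<in> D" "M - \<delta> * M < V z"
      unfolding M_def using less_cSUP_iff[OF _ bdd, of "Sup (V ` D) - \<delta> * Sup (V ` D)"] txD by blast
    then obtain t0 x0 h0 where z0: "-3/4 < t0" "t0 \<le> b" "norm x0 < 3/4" "norm h0 \<le> par_dist s t0 x0 / 2" "h0 \<noteq> 0"
      and near: "M - \<delta> * M < V (t0, x0, h0)" by (auto simp: D_def)
    define d0 where "d0 = par_dist s t0 x0"
    define \<rho> where "\<rho> = norm h0"
    have \<rho>: "0 < \<rho>" using z0 by (simp add: \<rho>_def)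
    have d0: "0 < d0" using par0[OF z0(1,3)] by (simp add: d0_def)
    have near': "(1 - \<delta>) * M < d0 powr \<gamma> * \<bar>D2 (W t0) x0 h0\<bar> / \<rho> powr \<gamma>"
      using near by (simp add: V_def d0_def \<rho>_def algebra_simps)
    have "Z powr \<gamma> \<le> (d0 / \<rho>) powr \<gamma>"
    proof -
      have "8 * Z powr \<gamma> * A \<le> K0 * A" using K0(1) A by (intro mult_right_mono) auto
      then have "8 * Z powr \<gamma> * A \<le> M" using KM by linarith
      then have "(1/2) * (8 * Z powr \<gamma> * A) \<le> (1 - \<delta>) * M" using \<delta> M0 A by (intro mult_mono) auto
      also have "\<dots> \<le> (d0 / \<rho>) powr \<gamma> * \<bar>D2 (W t0) x0 h0\<bar>"
        using near' d0 \<rho> by (simp add: powr_divide)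
      also have "\<dots> \<le> (d0 / \<rho>) powr \<gamma> * (4 * A)"
        using W_le[of t0 x0] W_le[of t0 "x0 + h0"] W_le[of t0 "x0 - h0"] unfolding D2_def by (intro mult_left_mono) auto
      finally have "Z powr \<gamma> * (4 * A) \<le> (d0 / \<rho>) powr \<gamma> * (4 * A)" by (simp add: mult_ac)
      then show ?thesis by (rule mult_right_le_imp_le) (use A in simp)
    qed
    then have Zd: "Z \<le> d0 / \<rho>" using \<gamma> Z0 d0 \<rho>
      by (metis linorder_not_less powr_less_mono2 divide_pos_pos less_imp_le)
    have r1: "1 / (\<delta> * (\<delta> / 8)) \<le> d0 / \<rho>" using Zd by (simp add: Z_def)
    have r2: "1 \<le> Y * (d0 / \<rho>) powr (2 * s)"
    proof -
      have "1 / Y = ((1 / Y) powr (1 / (2 * s))) powr (2 * s)" using s Y by (simp add: powr_powr)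
      also have "\<dots> \<le> (d0 / \<rho>) powr (2 * s)" using Zd s by (intro powr_mono2) (auto simp: Z_def)
      finally show ?thesis using Y by (simp add: field_simps)
    qed
    define c where "c = d0 powr \<gamma> / (M * \<rho> powr \<gamma>)"
    \<comment> \<open>The blow-up argument is one-sided, so the solution is reflected if its
      extremal second difference is negative.\<close>
    define \<sigma> :: real where "\<sigma> = (if 0 \<le> D2 (W t0) x0 h0 then 1 else -1)"
    have \<sigma>: "\<bar>\<sigma>\<bar> = 1" "\<sigma> * D2 (W t0) x0 h0 = \<bar>D2 (W t0) x0 h0\<bar>"
      by (auto simp: \<sigma>_def)
    have MD: "par_dist s t x powr \<gamma> * \<bar>D2 (W t) x h\<bar> \<le> M * norm h powr \<gamma>"
      if "-3/4 < t" "t \<le> b" "norm x < 3/4" "norm h \<le> par_dist s t x / 2" for t x h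
    proof (cases "h = 0")
      case False
      then have "V (t, x, h) \<le> M" using that by (intro MV) (simp add: D_def)
      then show ?thesis using False by (simp add: V_def field_simps)
    qed (simp add: D01)
    have "near_extremal s \<gamma> lam Lam \<mu>
       (\<lambda>t x. \<sigma> * c * W (t0 + norm h0 powr (2 * s) * t) (x0 + norm h0 *\<^sub>R x))
       (\<lambda>t x. \<sigma> * c * norm h0 powr (2 * s) * f (t0 + norm h0 powr (2 * s) * t) (x0 + norm h0 *\<^sub>R x))
       ((1 / norm h0) *\<^sub>R h0) \<delta> (\<delta> / 8 * (par_dist s t0 x0 / norm h0))"
      by (rule blowup_is_near_extremal[OF s \<gamma> lam sp b contW c11W W_le A eqW f_le MD \<delta> _ K0(2,3) z0(1-3,5) _ _ \<sigma>(1)])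
        (use KM r1 r2 in \<open>auto simp: c_def d0_def \<rho>_def Y_def\<close>)
    from key[OF this] have "\<sigma> * c * W t0 (x0 + norm h0 *\<^sub>R ((1 / norm h0) *\<^sub>R h0)) +
       \<sigma> * c * W t0 (x0 - norm h0 *\<^sub>R ((1 / norm h0) *\<^sub>R h0)) - 2 * (\<sigma> * c * W t0 x0) < 1 - \<delta>"
      by (simp add: D2_def)
    moreover have "norm h0 *\<^sub>R ((1 / norm h0) *\<^sub>R h0) = h0" using z0 by simp
    ultimately have "c * (\<sigma> * D2 (W t0) x0 h0) < 1 - \<delta>" by (simp add: D2_def algebra_simps)
    then have "c * \<bar>D2 (W t0) x0 h0\<bar> < 1 - \<delta>" by (simp add: \<sigma>(2))
    moreover have "c * \<bar>D2 (W t0) x0 h0\<bar> > 1 - \<delta>"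
      using near' M0 \<rho> by (simp add: c_def field_simps)
    ultimately show False by simp
  qed
  show ?thesis
  proof (intro exI[of _ K] conjI allI impI K)
    fix \<mu> :: "'a measure" and W f :: "real \<Rightarrow> 'a \<Rightarrow> real" and A Q b t :: real and x h :: 'a
    assume sp: "spectral_measure s lam Lam \<mu>" and sol: "smooth_solution s \<mu> W f A Q b"
      and t: "-5/8 \<le> t" "t \<le> b" and x: "norm x \<le> 5/8"
    from sol have b: "b < 0"
      and contW: "continuous_on UNIV (\<lambda>(t, x). W t x)" and c11W: "\<forall>t. c11 (W t)"
      and Q: "\<forall>t x h. \<bar>D2 (W t) x h\<bar> \<le> Q * (norm h)\<^sup>2" and W_le: "\<forall>t x. \<bar>W t x\<bar> \<le> A"
      and eqW: "\<forall>t x. -3/4 < t \<longrightarrow> t \<le> b \<longrightarrow> norm x < 3/4 \<longrightarrow>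
        ((\<lambda>t. W t x) has_real_derivative (slice_op s \<mu> (W t) x + f t x)) (at t) \<and> \<bar>f t x\<bar> \<le> A"
      unfolding smooth_solution_def by blast+
    have A0: "0 \<le> A" using W_le abs_ge_zero order_trans by blast
    have D4: "\<bar>D2 (W t) x h\<bar> \<le> 4 * A"
      using W_le[rule_format, of t x] W_le[rule_format, of t "x + h"] W_le[rule_format, of t "x - h"]
      unfolding D2_def by linarith
    show "\<bar>D2 (W t) x h\<bar> \<le> K * A * norm h powr \<gamma>"
    proof (cases "A = 0")
      case True
      then show ?thesis using D4 by simp
    next
      case False
      then have A: "0 < A" using A0 by simp
      have c1d: "c1 \<le> par_dist s t x"
      proof -
        have "(1/8) powr (1 / (2 * s)) \<le> (t + 3/4) powr (1 / (2 * s))" using t s by (intro powr_mono2) auto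
        then show ?thesis using x by (simp add: c1_def par_dist_def min_le_iff_disj)
      qed
      have KA: "K * A * norm h powr \<gamma> = K0 * A * norm h powr \<gamma> / c1 powr \<gamma> + 4 * A * (norm h powr \<gamma> / (c1 / 2) powr \<gamma>)"
        by (simp add: K_def algebra_simps)
      show ?thesis
      proof (cases "norm h \<le> c1 / 2")
        case True
        have "c1 powr \<gamma> * \<bar>D2 (W t) x h\<bar> \<le> par_dist s t x powr \<gamma> * \<bar>D2 (W t) x h\<bar>"
          using c1d c1 \<gamma> by (intro mult_right_mono powr_mono2) auto
        also have "\<dots> \<le> K0 * A * norm h powr \<gamma>"
          by (rule main[OF sp b contW _ _ _ A]) (use c11W Q W_le eqW t x True c1d in auto)
        finally have "\<bar>D2 (W t) x h\<bar> \<le> K0 * A * norm h powr \<gamma> / c1 powr \<gamma>"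
          using c1 by (simp add: field_simps)
        moreover have "0 \<le> 4 * A * (norm h powr \<gamma> / (c1 / 2) powr \<gamma>)" using A by simp
        ultimately show ?thesis unfolding KA by linarith
      next
        case False
        have "(c1 / 2) powr \<gamma> \<le> norm h powr \<gamma>" using False c1 \<gamma> by (intro powr_mono2) auto
        then have "4 * A * 1 \<le> 4 * A * (norm h powr \<gamma> / (c1 / 2) powr \<gamma>)"
          using A c1 by (intro mult_left_mono) (auto simp: le_divide_eq)
        moreover have "0 \<le> K0 * A * norm h powr \<gamma> / c1 powr \<gamma>" using A K0pos by simp
        ultimately show ?thesis unfolding KA using D4 by linarith
      qed
    qed
  qed
qed

section \<open>Smooth cut-offs and convolution\<close>

lemma C_k_on_Suc_imp: "C_k_on (Suc k) UNIV g \<Longrightarrow> C_k_on k UNIV g"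
proof (induction k arbitrary: g)
  case 0
  then show ?case by (auto intro!: differentiable_imp_continuous_on simp: differentiable_on_def)
next
  case (Suc k)
  then show ?case by auto
qed

lemma C_k_on_SucI:
  assumes "\<And>x. (g has_derivative G x) (at x)" "\<And>b. b \<in> Basis \<Longrightarrow> C_k_on k UNIV (\<lambda>x. G x b)"
  shows "C_k_on (Suc k) UNIV g"
proof -
  have "frechet_derivative g (at x) = G x" for x using assms(1) by (rule frechet_derivative_at[symmetric])
  then show ?thesis using assms unfolding C_k_on.simps differentiable_def by auto
qed

lemma C_k_on_SucD:
  assumes "C_k_on (Suc k) UNIV g"
  shows "(g has_derivative frechet_derivative g (at x)) (at x)"
    "b \<in> Basis \<Longrightarrow> C_k_on k UNIV (\<lambda>x. frechet_derivative g (at x) b)"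
  using assms by (auto simp: frechet_derivative_works)

lemma C_k_on_const: "C_k_on k UNIV (\<lambda>x. c)"
proof (induction k arbitrary: c)
  case (Suc k)
  show ?case by (rule C_k_on_SucI[where G = "\<lambda>x h. 0"]) (auto simp: Suc)
qed simp

lemma C_k_on_add: "C_k_on k UNIV f \<Longrightarrow> C_k_on k UNIV g \<Longrightarrow> C_k_on k UNIV (\<lambda>x. f x + g x)"
proof (induction k arbitrary: f g)
  case (Suc k)
  note F = C_k_on_SucD[OF Suc.prems(1)] and G = C_k_on_SucD[OF Suc.prems(2)]
  show ?case by (rule C_k_on_SucI[OF has_derivative_add[OF F(1) G(1)]]) (intro Suc.IH F G)
qed (auto intro: continuous_intros)

lemma C_k_on_mult: "C_k_on k UNIV f \<Longrightarrow> C_k_on k UNIV g \<Longrightarrow> C_k_on k UNIV (\<lambda>x. f x * g x)"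
proof (induction k arbitrary: f g)
  case (Suc k)
  note F = C_k_on_SucD[OF Suc.prems(1)] and G = C_k_on_SucD[OF Suc.prems(2)]
  show ?case
    by (rule C_k_on_SucI[OF has_derivative_mult[OF F(1) G(1)]])
      (intro C_k_on_add Suc.IH F G C_k_on_Suc_imp[OF Suc.prems(1)] C_k_on_Suc_imp[OF Suc.prems(2)])
qed (auto intro: continuous_intros)

lemma C_k_on_inner: "C_k_on k UNIV (\<lambda>x. x \<bullet> c)"
proof (cases k)
  case (Suc m)
  show ?thesis unfolding Suc
    by (rule C_k_on_SucI[where G = "\<lambda>x h. h \<bullet> c"]) (auto intro!: derivative_eq_intros C_k_on_const)
qed (auto intro: continuous_intros)

lemma C_k_on_sum: "(\<And>i. i \<in> I \<Longrightarrow> C_k_on k UNIV (f i)) \<Longrightarrow> C_k_on k UNIV (\<lambda>x. \<Sum>i\<in>I. f i x)"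
  by (induction I rule: infinite_finite_induct) (auto intro: C_k_on_const C_k_on_add)

text \<open>Taking the whole sequence of derivatives as data lets the induction on k pass from
  \<phi> m to its successor.\<close>

lemma C_k_on_compose_real:
  fixes \<phi> :: "nat \<Rightarrow> real \<Rightarrow> real" and q :: "'a::euclidean_space \<Rightarrow> real"
  assumes \<phi>: "\<And>m r. (\<phi> m has_real_derivative \<phi> (Suc m) r) (at r)" and q: "\<And>k. C_k_on k UNIV q"
  shows "C_k_on k UNIV (\<lambda>x. \<phi> m (q x))"
proof (induction k arbitrary: m)
  case 0
  have "continuous_on UNIV (\<phi> m)"
    using \<phi> by (intro DERIV_continuous_on) (auto intro: has_field_derivative_at_within)
  then show ?case using q[of 0] by (auto intro: continuous_on_compose2)
next
  case (Suc k)
  note Q = C_k_on_SucD[OF q]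
  have "((\<lambda>x. \<phi> m (q x)) has_derivative (\<lambda>h. \<phi> (Suc m) (q x) * frechet_derivative q (at x) h)) (at x)" for x
    using has_derivative_compose[OF Q(1)[of x] \<phi>[of m "q x", unfolded has_field_derivative_def]] by simp
  then show ?case by (rule C_k_on_SucI) (intro C_k_on_mult Suc.IH Q)
qed

text \<open>This family is closed under differentiation, which makes smoothness of the bump function an induction.\<close>

definition flat :: "real poly \<Rightarrow> real \<Rightarrow> real" where
  "flat p r = (if r \<le> 0 then 0 else poly p (1 / r) * exp (- 1 / r))"

lemma poly_div_exp_tendsto_0: "((\<lambda>x::real. poly p x / exp x) \<longlongrightarrow> 0) at_top"
proof -
  \<comment> \<open>The extra power of x is needed for the induction: removing the constant
    coefficient of a polynomial pulls out a factor x.\<close>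
  have "((\<lambda>x::real. x ^ k * poly p x / exp x) \<longlongrightarrow> 0) at_top" for k
  proof (induction p arbitrary: k)
    case (pCons a p)
    have "((\<lambda>x. a * (x ^ k / exp x) + x ^ Suc k * poly p x / exp x) \<longlongrightarrow> a * 0 + 0) at_top"
      by (intro tendsto_add tendsto_mult tendsto_const tendsto_power_div_exp_0 pCons.IH)
    then show ?case by (simp add: algebra_simps add_divide_distrib)
  qed simp
  from this[of 0] show ?thesis by simp
qed

lemma flat_derivative: "(flat p has_real_derivative flat ([:0, 0, 1:] * (p - pderiv p)) r) (at r)"
proof -
  consider "r < 0" | "r = 0" | "r > 0" by linarith
  then show ?thesis
  proof cases
    case 1
    have "((\<lambda>r. 0) has_real_derivative 0) (at r)" by simp
    then have "(flat p has_real_derivative 0) (at r)"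
      by (rule has_field_derivative_transform_within_open[of _ _ _ "{..<0}"]) (use 1 in \<open>auto simp: flat_def\<close>)
    then show ?thesis using 1 by (simp add: flat_def)
  next
    case 2
    \<comment> \<open>With x = 1/h the difference quotient at 0 becomes x p(x) / exp x as x tends to
      infinity.\<close>
    have "((\<lambda>h. flat p h / h) \<longlongrightarrow> 0) (at_right 0)"
    proof (rule Lim_transform_eventually)
      have "((\<lambda>x. poly ([:0, 1:] * p) x / exp x) \<longlongrightarrow> 0) at_top" by (rule poly_div_exp_tendsto_0)
      then show "((\<lambda>h. poly ([:0, 1:] * p) (inverse h) / exp (inverse h)) \<longlongrightarrow> 0) (at_right 0)"
        by (rule filterlim_compose[OF _ filterlim_inverse_at_top_right])
      show "eventually (\<lambda>h. poly ([:0, 1:] * p) (inverse h) / exp (inverse h) = flat p h / h) (at_right 0)"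
        using eventually_at_right_less[of "0::real"] by eventually_elim (simp add: flat_def field_simps exp_minus)
    qed
    moreover have "((\<lambda>h. flat p h / h) \<longlongrightarrow> 0) (at_left 0)"
    proof (rule Lim_transform_eventually[OF tendsto_const])
      have "eventually (\<lambda>h::real. h < 0) (at_left 0)" by (simp add: eventually_at_filter)
      then show "eventually (\<lambda>h. 0 = flat p h / h) (at_left 0)" by eventually_elim (simp add: flat_def)
    qed
    ultimately have "((\<lambda>h. flat p h / h) \<longlongrightarrow> 0) (at 0)" by (intro filterlim_split_at)
    then show ?thesis unfolding 2 by (simp add: DERIV_def flat_def)
  next
    case 3
    have "((\<lambda>r. poly p (1 / r) * exp (- 1 / r)) has_real_derivative
       (poly (pderiv p) (1 / r) * (- 1 / r\<^sup>2)) * exp (- 1 / r) + poly p (1 / r) * (exp (- 1 / r) * (1 / r\<^sup>2))) (at r)"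
    proof -
      have a: "((\<lambda>r. 1 / r) has_real_derivative - 1 / r\<^sup>2) (at r)"
        using 3 by (auto intro!: derivative_eq_intros simp: power2_eq_square)
      have b: "((\<lambda>r. - 1 / r) has_real_derivative 1 / r\<^sup>2) (at r)"
        using 3 by (auto intro!: derivative_eq_intros simp: power2_eq_square)
      show ?thesis
        by (rule DERIV_cong[OF DERIV_mult[OF DERIV_chain2[OF poly_DERIV a] DERIV_fun_exp[OF b]]])
          (simp add: algebra_simps)
    qed
    then have "(flat p has_real_derivative
       (poly (pderiv p) (1 / r) * (- 1 / r\<^sup>2)) * exp (- 1 / r) + poly p (1 / r) * (exp (- 1 / r) * (1 / r\<^sup>2))) (at r)"
      by (rule has_field_derivative_transform_within_open[of _ _ _ "{0<..}"]) (use 3 in \<open>auto simp: flat_def\<close>)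
    then show ?thesis using 3 by (simp add: flat_def field_simps power2_eq_square)
  qed
qed

definition bump :: "real \<Rightarrow> 'a::euclidean_space \<Rightarrow> real" where
  "bump \<epsilon> z = flat 1 (\<epsilon>\<^sup>2 - z \<bullet> z)"

lemma bump_C_k: "C_k_on k UNIV (bump \<epsilon> :: 'a::euclidean_space \<Rightarrow> real)"
proof -
  define \<phi> where "\<phi> = (\<lambda>m. flat (((\<lambda>p. [:0, 0, 1:] * (p - pderiv p)) ^^ m) 1))"
  have \<phi>: "(\<phi> m has_real_derivative \<phi> (Suc m) r) (at r)" for m r
    unfolding \<phi>_def by (simp only: funpow.simps comp_def) (rule flat_derivative)
  define q :: "'a \<Rightarrow> real" where "q = (\<lambda>z. \<epsilon>\<^sup>2 + (-1) * (\<Sum>b\<in>Basis. (z \<bullet> b) * (z \<bullet> b)))"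
  have q: "C_k_on k UNIV q" for k unfolding q_def
    by (intro C_k_on_add C_k_on_mult C_k_on_sum C_k_on_inner C_k_on_const)
  have "q z = \<epsilon>\<^sup>2 - z \<bullet> z" for z by (simp add: q_def euclidean_inner[of z z, symmetric])
  then have "bump \<epsilon> = (\<lambda>z. \<phi> 0 (q z))"
    by (intro ext) (simp add: \<phi>_def bump_def)
  then show ?thesis using C_k_on_compose_real[of \<phi> q k 0, OF \<phi> q] by simp
qed

lemma bump_nonneg: "0 \<le> bump \<epsilon> z"
  by (simp add: bump_def flat_def)

lemma bump_pos_iff: "0 < \<epsilon> \<Longrightarrow> 0 < bump \<epsilon> z \<longleftrightarrow> norm z < \<epsilon>"
  by (simp add: bump_def flat_def norm_lt_square not_le)

lemma bump_eq_0: "0 < \<epsilon> \<Longrightarrow> \<epsilon> \<le> norm z \<Longrightarrow> bump \<epsilon> z = 0"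
  using bump_pos_iff[of \<epsilon> z] bump_nonneg[of \<epsilon> z] by linarith

section \<open>Taylor bounds for compactly supported functions, and convolution with them\<close>

lemma continuous_compact_support_bounded:
  fixes g :: "'a::euclidean_space \<Rightarrow> real"
  assumes "continuous_on UNIV g" "\<And>z. r < norm z \<Longrightarrow> g z = 0"
  shows "\<exists>C\<ge>0. \<forall>z. \<bar>g z\<bar> \<le> C"
proof -
  have "compact (g ` cball 0 r)"
    using assms(1) by (intro compact_continuous_image) (auto intro: continuous_on_subset)
  then have "bounded (g ` cball 0 r)" by (rule compact_imp_bounded)
  then obtain B where B: "\<forall>z\<in>cball 0 r. \<bar>g z\<bar> \<le> B"
    unfolding bounded_iff by auto
  have "\<bar>g z\<bar> \<le> max B 0" for z
    using B assms(2)[of z] by (cases "norm z \<le> r") (auto simp: le_max_iff_disj)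
  then show ?thesis by (intro exI[of _ "max B 0"]) auto
qed

lemma abs_linear_le_sum:
  fixes F :: "'a::euclidean_space \<Rightarrow> real" and C :: real
  assumes "linear F" "\<And>b. b \<in> Basis \<Longrightarrow> \<bar>F b\<bar> \<le> C"
  shows "\<bar>F h\<bar> \<le> DIM('a) * C * norm h"
proof -
  have "F h = F (\<Sum>b\<in>Basis. (h \<bullet> b) *\<^sub>R b)" by (simp add: euclidean_representation)
  also have "\<dots> = (\<Sum>b\<in>Basis. (h \<bullet> b) * F b)"
    using assms(1) by (simp add: linear_sum linear_scale)
  finally have "\<bar>F h\<bar> \<le> (\<Sum>b\<in>Basis. \<bar>h \<bullet> b\<bar> * \<bar>F b\<bar>)"
    by (simp add: abs_mult order_trans[OF sum_abs])
  also have "\<dots> \<le> (\<Sum>b\<in>(Basis :: 'a set). norm h * C)"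
    using assms(2) by (intro sum_mono mult_mono) (auto simp: Basis_le_norm)
  finally show ?thesis by (simp add: mult_ac)
qed

lemma frechet_derivative_eq_0_outside:
  fixes g :: "'a::euclidean_space \<Rightarrow> real"
  assumes "\<And>z. r < norm z \<Longrightarrow> g z = 0" "r < norm z"
  shows "frechet_derivative g (at z) = (\<lambda>h. 0)"
proof (rule frechet_derivative_at[symmetric])
  have "open {z :: 'a. r < norm z}" by (intro open_Collect_less continuous_intros)
  then show "(g has_derivative (\<lambda>h. 0)) (at z)"
    by (rule has_derivative_transform_within_open[OF has_derivative_const[of 0]]) (use assms in auto)
qed

text \<open>Compact support bounds the first and second partial derivatives. The mean value
  inequality turns the second ones into a Lipschitz bound for the derivative, and this into a
  quadratic Taylor remainder, uniformly in the base point.\<close>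

lemma smooth_compact_support_taylor:
  fixes \<eta> :: "'a::euclidean_space \<Rightarrow> real"
  assumes smooth: "\<And>k. C_k_on k UNIV \<eta>" and supp: "\<And>z. r < norm z \<Longrightarrow> \<eta> z = 0"
  shows "\<exists>C\<ge>0. (\<forall>z. \<bar>\<eta> z\<bar> \<le> C) \<and> (\<forall>z h. \<bar>frechet_derivative \<eta> (at z) h\<bar> \<le> C * norm h) \<and>
    (\<forall>z h. \<bar>\<eta> (z + h) - \<eta> z - frechet_derivative \<eta> (at z) h\<bar> \<le> C * (norm h)\<^sup>2)"
proof -
  let ?F = "\<lambda>z. frechet_derivative \<eta> (at z)"
  note E = C_k_on_SucD[OF smooth]
  have lin: "linear (?F z)" for z using E(1)[of z] has_derivative_linear by blast
  obtain C0 where C0: "0 \<le> C0" "\<And>z. \<bar>\<eta> z\<bar> \<le> C0"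
    using continuous_compact_support_bounded[of \<eta> r] smooth[of 0] supp by auto
  have "\<exists>C. \<forall>z. \<bar>?F z b\<bar> \<le> C" if "b \<in> Basis" for b
  proof -
    have "continuous_on UNIV (\<lambda>z. ?F z b)" using E(2)[OF that, of 0] by simp
    then show ?thesis
      using continuous_compact_support_bounded[of "\<lambda>z. ?F z b" r] frechet_derivative_eq_0_outside[of r \<eta>] supp
      by auto
  qed
  then obtain C1 where C1: "\<And>b z. b \<in> Basis \<Longrightarrow> \<bar>?F z b\<bar> \<le> C1 b" by metis
  have "\<exists>C. \<forall>z. \<bar>frechet_derivative (\<lambda>z. ?F z b) (at z) b'\<bar> \<le> C" if "b \<in> Basis" "b' \<in> Basis" for b b'
  proof -
    have "C_k_on (Suc 0) UNIV (\<lambda>z. ?F z b)" using E(2)[OF that(1)] .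
    from C_k_on_SucD(2)[OF this that(2)]
    have "continuous_on UNIV (\<lambda>z. frechet_derivative (\<lambda>z. ?F z b) (at z) b')" by simp
    moreover have "frechet_derivative (\<lambda>z. ?F z b) (at z) b' = 0" if "r < norm z" for z
      using frechet_derivative_eq_0_outside[of r "\<lambda>z. ?F z b" z] frechet_derivative_eq_0_outside[of r \<eta>] supp that by simp
    ultimately show ?thesis
      using continuous_compact_support_bounded[of "\<lambda>z. frechet_derivative (\<lambda>z. ?F z b) (at z) b'" r] by auto
  qed
  then obtain C2 where C2: "\<And>b b' z. b \<in> Basis \<Longrightarrow> b' \<in> Basis \<Longrightarrow> \<bar>frechet_derivative (\<lambda>z. ?F z b) (at z) b'\<bar> \<le> C2 b b'"
    by metis
  define D where "D = Max (C1 ` Basis)"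
  have D: "\<bar>?F z b\<bar> \<le> D" if "b \<in> Basis" for z b
  proof -
    have "C1 b \<le> D" unfolding D_def using that by (intro Max_ge) auto
    then show ?thesis using C1[OF that, of z] by linarith
  qed
  define D' where "D' = Max ((\<lambda>(b, b'). C2 b b') ` (Basis \<times> Basis))"
  have D': "\<bar>frechet_derivative (\<lambda>z. ?F z b) (at z) b'\<bar> \<le> D'" if "b \<in> Basis" "b' \<in> Basis" for z b b'
  proof -
    have "C2 b b' \<le> D'" unfolding D'_def using that by (intro Max_ge) (auto intro!: image_eqI[of _ _ "(b, b')"])
    then show ?thesis using C2[OF that, of z] by linarith
  qed
  define n where "n = real DIM('a)"
  obtain b0 :: 'a where b0: "b0 \<in> Basis" using nonempty_Basis by blast
  have nn: "0 \<le> D" "0 \<le> D'" "0 < n"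
    using D[OF b0, of 0] D'[OF b0 b0, of 0] by (auto simp: n_def intro: order_trans[OF abs_ge_zero])
  have lip: "\<bar>?F z b - ?F z' b\<bar> \<le> n * D' * norm (z - z')" if b: "b \<in> Basis" for z z' b
  proof -
    have der: "((\<lambda>z. ?F z b) has_derivative frechet_derivative (\<lambda>z. ?F z b) (at z)) (at z)" for z
      using C_k_on_SucD(1)[OF E(2)[OF b, of "Suc 0"]] .
    have on: "onorm (frechet_derivative (\<lambda>z. ?F z b) (at z)) \<le> n * D'" for z
      using abs_linear_le_sum[OF has_derivative_linear[OF der], where C = D'] D'[OF b] nn
      by (intro onorm_bound) (auto simp: n_def)
    show ?thesis
      using differentiable_bound[OF convex_UNIV has_derivative_at_withinI[OF der] on, of z z'] by simp
  qed
  have lipF: "\<bar>?F z h - ?F z' h\<bar> \<le> n * (n * D' * norm (z - z')) * norm h" for z z' h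
    unfolding n_def using abs_linear_le_sum[OF linear_compose_sub[OF lin[of z] lin[of z']]] lip[unfolded n_def] by blast
  have taylor: "\<bar>\<eta> (z + h) - \<eta> z - ?F z h\<bar> \<le> n * n * D' * (norm h)\<^sup>2" for z h
  proof -
    have "norm (\<eta> (z + h) - \<eta> z - ?F z ((z + h) - z)) \<le> norm ((z + h) - z) * (n * (n * D' * norm h))"
    proof (rule differentiable_bound_linearization[where S = "cball z (norm h)"])
      show "(\<eta> has_derivative ?F x) (at x within cball z (norm h))" for x
        using E(1)[of x] by (rule has_derivative_at_withinI)
      show "z + t *\<^sub>R (z + h - z) \<in> cball z (norm h)" if "t \<in> {0..1}" for t
        using that by (simp add: dist_norm mult_left_le_one_le)
      fix y assume "y \<in> cball z (norm h)"
      then have y: "norm (y - z) \<le> norm h" by (simp add: dist_norm norm_minus_commute)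
      show "onorm (?F y - ?F z) \<le> n * (n * D' * norm h)"
      proof (rule onorm_bound)
        show "0 \<le> n * (n * D' * norm h)" using nn by simp
        fix x
        have "\<bar>?F y x - ?F z x\<bar> \<le> n * (n * D' * norm (y - z)) * norm x"
          by (rule lipF)
        also have "\<dots> \<le> n * (n * D' * norm h) * norm x"
          using nn y by (intro mult_right_mono mult_left_mono) auto
        finally show "norm ((?F y - ?F z) x) \<le> n * (n * D' * norm h) * norm x" by simp
      qed
    qed simp
    then show ?thesis by (simp add: power2_eq_square mult_ac)
  qed
  have first: "\<bar>?F z h\<bar> \<le> n * D * norm h" for z h
    unfolding n_def using abs_linear_le_sum[OF lin] D by blast
  define C where "C = C0 + n * D + n * n * D'"
  have C: "0 \<le> C" "C0 \<le> C" "n * D \<le> C" "n * n * D' \<le> C" using C0 nn by (auto simp: C_def)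
  show ?thesis
  proof (intro exI[of _ C] conjI allI C)
    show "\<bar>\<eta> z\<bar> \<le> C" for z using C0(2)[of z] C by linarith
    show "\<bar>?F z h\<bar> \<le> C * norm h" for z h using first[of z h] mult_right_mono[OF C(3), of "norm h"] by simp
    show "\<bar>\<eta> (z + h) - \<eta> z - ?F z h\<bar> \<le> C * (norm h)\<^sup>2" for z h
      using taylor[of z h] mult_right_mono[OF C(4), of "(norm h)\<^sup>2"] by simp
  qed
qed

text \<open>The smooth kernel carries the variable z, so all differences and derivatives fall on it
  and U may be merely bounded and measurable.\<close>

definition conv :: "('a::euclidean_space \<Rightarrow> real) \<Rightarrow> ('a \<Rightarrow> real) \<Rightarrow> 'a \<Rightarrow> real" where
  "conv U \<eta> z = (\<integral>z'. U z' * \<eta> (z - z') \<partial>lborel)"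

lemma
  fixes U \<phi> :: "'a::euclidean_space \<Rightarrow> real"
  assumes [measurable]: "U \<in> borel_measurable borel" "\<phi> \<in> borel_measurable borel"
    and U: "\<And>z. \<bar>U z\<bar> \<le> A" and \<phi>: "\<And>z. \<bar>\<phi> z\<bar> \<le> C" and supp: "\<And>z. r < norm z \<Longrightarrow> \<phi> z = 0"
  shows conv_integrable: "integrable lborel (\<lambda>z'. U z' * \<phi> (z - z'))"
    and abs_conv_le: "\<bar>conv U \<phi> z\<bar> \<le> A * C * measure lborel (cball (0::'a) r)"
proof -
  have nn: "0 \<le> A" "0 \<le> C" using U[of 0] \<phi>[of 0] by auto
  have meas: "measure lborel (cball z r) = measure lborel (cball (0::'a) r)"
    by (cases "0 \<le> r") (simp_all add: content_cball)
  have bd: "\<bar>U z' * \<phi> (z - z')\<bar> \<le> A * C * indicator (cball z r) z'" for z'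
    using supp[of "z - z'"] mult_mono[OF U[of z'] \<phi>[of "z - z'"]] nn
    by (cases "z' \<in> cball z r") (auto simp: dist_norm abs_mult)
  have int: "integrable lborel (\<lambda>z'. A * C * indicator (cball z r) z')"
    by (intro integrable_mult_right integrable_real_indicator) (use emeasure_bounded_finite[OF bounded_cball, of z r] in auto)
  show i: "integrable lborel (\<lambda>z'. U z' * \<phi> (z - z'))"
    by (rule Bochner_Integration.integrable_bound[OF int]) (use bd nn in \<open>auto intro!: AE_I2\<close>)
  have "\<bar>conv U \<phi> z\<bar> \<le> (\<integral>z'. \<bar>U z' * \<phi> (z - z')\<bar> \<partial>lborel)"
    unfolding conv_def by (rule integral_abs_bound)
  also have "\<dots> \<le> (\<integral>z'. A * C * indicator (cball z r) z' \<partial>lborel)"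
    by (intro integral_mono int integrable_abs i bd)
  also have "\<dots> = A * C * measure lborel (cball (0::'a) r)" by (simp add: meas)
  finally show "\<bar>conv U \<phi> z\<bar> \<le> A * C * measure lborel (cball (0::'a) r)" .
qed

lemma smooth_measurable: "C_k_on 0 UNIV \<eta> \<Longrightarrow> \<eta> \<in> borel_measurable borel"
  by (simp add: borel_measurable_continuous_onI)

lemma smooth_derivative_measurable:
  fixes \<eta> :: "'a::euclidean_space \<Rightarrow> real"
  assumes "\<And>k. C_k_on k UNIV \<eta>"
  shows "(\<lambda>z. frechet_derivative \<eta> (at z) h) \<in> borel_measurable borel"
proof -
  note E = C_k_on_SucD[OF assms]
  have "frechet_derivative \<eta> (at z) h = (\<Sum>b\<in>Basis. (h \<bullet> b) * frechet_derivative \<eta> (at z) b)" for z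
  proof -
    have "linear (frechet_derivative \<eta> (at z))" using E(1) has_derivative_linear by blast
    then have "frechet_derivative \<eta> (at z) (\<Sum>b\<in>Basis. (h \<bullet> b) *\<^sub>R b) = (\<Sum>b\<in>Basis. (h \<bullet> b) * frechet_derivative \<eta> (at z) b)"
      by (simp add: linear_sum linear_scale)
    then show ?thesis by (simp add: euclidean_representation)
  qed
  moreover have "(\<lambda>z. frechet_derivative \<eta> (at z) b) \<in> borel_measurable borel" if "b \<in> Basis" for b
    using E(2)[OF that, of 0] by (rule smooth_measurable)
  ultimately show ?thesis by (simp add: borel_measurable_sum)
qed

text \<open>The Taylor remainder of the kernel is quadratic and, for steps of norm at most 1,
  supported in the ball of radius r + 1; integrating it against U yields derivative and second
  difference bound. For longer steps the sup bound is already quadratic.\<close>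

lemma
  fixes U \<eta> :: "'a::euclidean_space \<Rightarrow> real"
  assumes Um [measurable]: "U \<in> borel_measurable borel" and U: "\<And>z. \<bar>U z\<bar> \<le> A"
    and smooth: "\<And>k. C_k_on k UNIV \<eta>" and supp: "\<And>z. r < norm z \<Longrightarrow> \<eta> z = 0"
  shows conv_has_derivative:
      "(conv U \<eta> has_derivative (\<lambda>h. conv U (\<lambda>z. frechet_derivative \<eta> (at z) h) z)) (at z)"
    and conv_D2_bound: "\<exists>Q. \<forall>z h. \<bar>D2 (conv U \<eta>) z h\<bar> \<le> Q * (norm h)\<^sup>2"
    and conv_bounded: "\<exists>P. \<forall>z. \<bar>conv U \<eta> z\<bar> \<le> P"
    and conv_D2: "D2 (conv U \<eta>) z h = conv U (\<lambda>z. D2 \<eta> z h) z"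
proof -
  let ?F = "\<lambda>z. frechet_derivative \<eta> (at z)"
  have A: "0 \<le> A" using U[of 0] by simp
  obtain C where C: "0 \<le> C" "\<And>z. \<bar>\<eta> z\<bar> \<le> C" "\<And>z h. \<bar>?F z h\<bar> \<le> C * norm h"
    "\<And>z h. \<bar>\<eta> (z + h) - \<eta> z - ?F z h\<bar> \<le> C * (norm h)\<^sup>2"
    using smooth_compact_support_taylor[OF smooth supp] by blast
  note E = C_k_on_SucD[OF smooth]
  have lin: "linear (?F z)" for z using E(1)[of z] has_derivative_linear by blast
  have [measurable]: "\<eta> \<in> borel_measurable borel" using smooth by (rule smooth_measurable)
  note [measurable] = smooth_derivative_measurable[OF smooth]
  have F0: "?F z h = 0" if "r < norm z" for z h using frechet_derivative_eq_0_outside[OF supp that] by simp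
  define V where "V = measure lborel (cball (0::'a) (r + 1))"
  have shift0: "\<eta> (z + h) = 0" if "r + 1 < norm z" "norm h \<le> 1" for z h
    using that norm_triangle_ineq2[of z "- h"] by (intro supp) auto
  have i0: "integrable lborel (\<lambda>z'. U z' * \<eta> (z - z'))" for z
    by (rule conv_integrable[OF _ _ U C(2) supp]) auto
  have ih: "integrable lborel (\<lambda>z'. U z' * \<eta> (z + h - z'))" for z h using i0[of "z + h"] .
  have iF: "integrable lborel (\<lambda>z'. U z' * ?F (z - z') h)" for z h
    by (rule conv_integrable[OF _ _ U C(3) F0]) auto
  have bl: "bounded_linear (\<lambda>h. conv U (\<lambda>z. ?F z h) z)"
  proof (rule bounded_linear_intro)
    show "conv U (\<lambda>z. ?F z (h + k)) z = conv U (\<lambda>z. ?F z h) z + conv U (\<lambda>z. ?F z k) z" for h k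
      unfolding conv_def by (simp add: linear_add[OF lin] distrib_left iF)
    show "conv U (\<lambda>z. ?F z (c *\<^sub>R h)) z = c *\<^sub>R conv U (\<lambda>z. ?F z h) z" for c h
      unfolding conv_def by (simp add: linear_scale[OF lin] mult.left_commute)
    show "norm (conv U (\<lambda>z. ?F z h) z) \<le> norm h * (A * C * measure lborel (cball (0::'a) r))" for h
    proof -
      have "\<bar>conv U (\<lambda>z. ?F z h) z\<bar> \<le> A * (C * norm h) * measure lborel (cball (0::'a) r)"
        by (rule abs_conv_le[OF _ _ U C(3) F0]) auto
      then show ?thesis by (simp add: mult_ac)
    qed
  qed
  have rem: "\<bar>conv U \<eta> (z + h) - conv U \<eta> z - conv U (\<lambda>z. ?F z h) z\<bar> \<le> A * C * V * (norm h)\<^sup>2" if h: "norm h \<le> 1" for h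
  proof -
    have "conv U \<eta> (z + h) - conv U \<eta> z - conv U (\<lambda>z. ?F z h) z
      = conv U (\<lambda>z. \<eta> (z + h) - \<eta> z - ?F z h) z"
      unfolding conv_def using i0[of z] ih[of z h] iF[of z h]
      by (simp add: right_diff_distrib diff_add_eq[symmetric] del: diff_add_eq)
    also have "\<bar>\<dots>\<bar> \<le> A * (C * (norm h)\<^sup>2) * V"
      unfolding V_def by (rule abs_conv_le[OF _ _ U C(4)]) (use shift0[OF _ h] supp F0 in auto)
    finally show ?thesis by (simp add: mult_ac)
  qed
  show "(conv U \<eta> has_derivative (\<lambda>h. conv U (\<lambda>z. ?F z h) z)) (at z)"
    unfolding has_derivative_at
  proof (intro conjI bl)
    show "(\<lambda>h. norm (conv U \<eta> (z + h) - conv U \<eta> z - conv U (\<lambda>z. ?F z h) z) / norm h) \<midarrow>0\<rightarrow> 0"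
    proof (rule Lim_null_comparison)
      show "eventually (\<lambda>h. norm (norm (conv U \<eta> (z + h) - conv U \<eta> z - conv U (\<lambda>z. ?F z h) z) / norm h) \<le> A * C * V * norm h) (at 0)"
        unfolding eventually_at
      proof (intro exI[of _ 1] conjI ballI impI)
        fix h :: 'a assume "h \<noteq> 0 \<and> dist h 0 < 1"
        then have h: "norm h \<le> 1" "0 < norm h" by auto
        show "norm (norm (conv U \<eta> (z + h) - conv U \<eta> z - conv U (\<lambda>z. ?F z h) z) / norm h) \<le> A * C * V * norm h"
          using rem[OF h(1)] h(2) by (simp add: divide_le_eq power2_eq_square mult_ac)
      qed simp
      show "((\<lambda>h. A * C * V * norm h) \<longlongrightarrow> 0) (at 0)"
        by (rule tendsto_eq_rhs[OF tendsto_mult[OF tendsto_const tendsto_norm[OF tendsto_ident_at]]]) simp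
    qed
  qed
  show D2c: "D2 (conv U \<eta>) z h = conv U (\<lambda>z. D2 \<eta> z h) z" for z h
  proof -
    have "conv U (\<lambda>z. D2 \<eta> z h) z
      = (\<integral>z'. U z' * \<eta> (z + h - z') + U z' * \<eta> (z + - h - z') - 2 * (U z' * \<eta> (z - z')) \<partial>lborel)"
      unfolding conv_def D2_def by (rule Bochner_Integration.integral_cong) (simp_all add: algebra_simps)
    also have "\<dots> = conv U \<eta> (z + h) + conv U \<eta> (z + - h) - 2 * conv U \<eta> z"
      unfolding conv_def
      by (subst Bochner_Integration.integral_diff Bochner_Integration.integral_add | intro Bochner_Integration.integrable_add integrable_mult_right ih i0 | simp)+
    finally show ?thesis by (simp add: D2_def)
  qed
  define P where "P = A * C * measure lborel (cball (0::'a) r)"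
  have P: "\<bar>conv U \<eta> z\<bar> \<le> P" for z
    unfolding P_def by (rule abs_conv_le[OF _ _ U C(2) supp]) auto
  then show "\<exists>P. \<forall>z. \<bar>conv U \<eta> z\<bar> \<le> P" by blast
  have "\<bar>D2 (conv U \<eta>) z h\<bar> \<le> (2 * A * C * V + 4 * P) * (norm h)\<^sup>2" for z h
  proof (cases "norm h \<le> 1")
    case True
    have D2h: "\<bar>D2 \<eta> z h\<bar> \<le> 2 * (C * (norm h)\<^sup>2)" for z
    proof -
      have "D2 \<eta> z h = (\<eta> (z + h) - \<eta> z - ?F z h) + (\<eta> (z + - h) - \<eta> z - ?F z (- h))"
        by (simp add: D2_def linear_neg[OF lin])
      then show ?thesis using C(4)[of z h] C(4)[of z "- h"] by (simp add: abs_le_iff)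
    qed
    have "\<bar>D2 (conv U \<eta>) z h\<bar> \<le> A * (2 * (C * (norm h)\<^sup>2)) * V"
      unfolding D2c V_def
    proof (rule abs_conv_le[OF _ _ U D2h])
      show "(\<lambda>z. D2 \<eta> z h) \<in> borel_measurable borel" unfolding D2_def by measurable
      show "D2 \<eta> z h = 0" if "r + 1 < norm z" for z
        using shift0[OF that True] shift0[OF that, of "- h"] True supp[of z] that by (simp add: D2_def)
    qed simp
    moreover have "0 \<le> 4 * P * (norm h)\<^sup>2" using P[of 0] by simp
    ultimately show ?thesis by (simp add: algebra_simps)
  next
    case False
    have "\<bar>D2 (conv U \<eta>) z h\<bar> \<le> 4 * P * 1"
      using P[of z] P[of "z + h"] P[of "z - h"] unfolding D2_def by (simp add: abs_le_iff)
    also have "\<dots> \<le> (2 * A * C * V + 4 * P) * (norm h)\<^sup>2"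
      using False A C(1) P[of 0] by (intro mult_mono) (auto simp: V_def)
    finally show ?thesis .
  qed
  then show "\<exists>Q. \<forall>z h. \<bar>D2 (conv U \<eta>) z h\<bar> \<le> Q * (norm h)\<^sup>2" by blast
qed

text \<open>The absolute values stand inside the integral, as Fubini requires. The bound by K and K
  |h|^2 has the shape of \<open>kernel_majorant\<close>, which makes it integrable against the jump
  kernel.\<close>

lemma conv_abs_D2_bound:
  fixes U \<eta> :: "'a::euclidean_space \<Rightarrow> real"
  assumes Um [measurable]: "U \<in> borel_measurable borel" and U: "\<And>z. \<bar>U z\<bar> \<le> A"
    and smooth: "\<And>k. C_k_on k UNIV \<eta>" and supp: "\<And>z. r < norm z \<Longrightarrow> \<eta> z = 0"
  shows "\<exists>K\<ge>0. \<forall>z h. integrable lborel (\<lambda>z'. U z' * D2 \<eta> (z - z') h) \<and>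
    (\<integral>z'. \<bar>U z' * D2 \<eta> (z - z') h\<bar> \<partial>lborel) \<le> K \<and>
    (norm h \<le> 1 \<longrightarrow> (\<integral>z'. \<bar>U z' * D2 \<eta> (z - z') h\<bar> \<partial>lborel) \<le> K * (norm h)\<^sup>2)"
proof -
  let ?F = "\<lambda>z. frechet_derivative \<eta> (at z)"
  have A: "0 \<le> A" using U[of 0] by simp
  obtain C where C: "0 \<le> C" "\<And>z. \<bar>\<eta> z\<bar> \<le> C" "\<And>z h. \<bar>?F z h\<bar> \<le> C * norm h"
    "\<And>z h. \<bar>\<eta> (z + h) - \<eta> z - ?F z h\<bar> \<le> C * (norm h)\<^sup>2"
    using smooth_compact_support_taylor[OF smooth supp] by blast
  note E = C_k_on_SucD[OF smooth]
  have lin: "linear (?F z)" for z using E(1)[of z] has_derivative_linear by blast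
  have [measurable]: "\<eta> \<in> borel_measurable borel" using smooth by (rule smooth_measurable)
  have aU: "\<bar>\<bar>U z\<bar>\<bar> \<le> A" for z using U[of z] by simp
  have a\<eta>: "\<bar>\<bar>\<eta> z\<bar>\<bar> \<le> C" for z using C(2)[of z] by simp
  have as: "\<bar>\<eta> z\<bar> = 0" if "r < norm z" for z using supp[OF that] by simp
  define V0 where "V0 = measure lborel (cball (0::'a) r)"
  define V1 where "V1 = measure lborel (cball (0::'a) (r + 1))"
  have i: "integrable lborel (\<lambda>z'. \<bar>U z'\<bar> * \<bar>\<eta> (z - z')\<bar>)" for z
    by (rule conv_integrable[OF _ _ aU a\<eta> as]) auto
  have le: "(\<integral>z'. \<bar>U z'\<bar> * \<bar>\<eta> (z - z')\<bar> \<partial>lborel) \<le> A * C * V0" for z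
  proof -
    have "\<bar>conv (\<lambda>z. \<bar>U z\<bar>) (\<lambda>z. \<bar>\<eta> z\<bar>) z\<bar> \<le> A * C * V0"
      unfolding V0_def by (rule abs_conv_le[OF _ _ aU a\<eta> as]) auto
    then show ?thesis unfolding conv_def by simp
  qed
  have ieta: "integrable lborel (\<lambda>z'. U z' * \<eta> (z - z'))" for z
    by (rule conv_integrable[OF _ _ U C(2) supp]) auto
  have split: "U z' * D2 \<eta> (z - z') h = U z' * \<eta> (z + h - z') + U z' * \<eta> (z - h - z') - 2 * (U z' * \<eta> (z - z'))" for z z' h
    by (simp add: D2_def algebra_simps)
  have iD: "integrable lborel (\<lambda>z'. U z' * D2 \<eta> (z - z') h)" for z h
    unfolding split using ieta
    by (intro Bochner_Integration.integrable_diff Bochner_Integration.integrable_add integrable_mult_right)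
  have big: "(\<integral>z'. \<bar>U z' * D2 \<eta> (z - z') h\<bar> \<partial>lborel) \<le> 4 * (A * C * V0)" for z h
  proof -
    have "(\<integral>z'. \<bar>U z' * D2 \<eta> (z - z') h\<bar> \<partial>lborel) \<le>
      (\<integral>z'. \<bar>U z'\<bar> * \<bar>\<eta> (z + h - z')\<bar> + \<bar>U z'\<bar> * \<bar>\<eta> (z - h - z')\<bar> + 2 * (\<bar>U z'\<bar> * \<bar>\<eta> (z - z')\<bar>) \<partial>lborel)"
    proof (rule integral_mono)
      show "integrable lborel (\<lambda>z'. \<bar>U z'\<bar> * \<bar>\<eta> (z + h - z')\<bar> + \<bar>U z'\<bar> * \<bar>\<eta> (z - h - z')\<bar> + 2 * (\<bar>U z'\<bar> * \<bar>\<eta> (z - z')\<bar>))"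
        using i by (intro Bochner_Integration.integrable_add integrable_mult_right)
      show "\<bar>U z' * D2 \<eta> (z - z') h\<bar> \<le> \<bar>U z'\<bar> * \<bar>\<eta> (z + h - z')\<bar> + \<bar>U z'\<bar> * \<bar>\<eta> (z - h - z')\<bar> + 2 * (\<bar>U z'\<bar> * \<bar>\<eta> (z - z')\<bar>)" for z'
        unfolding split abs_mult[symmetric] by linarith
    qed (intro integrable_abs iD)
    also have "\<dots> = (\<integral>z'. \<bar>U z'\<bar> * \<bar>\<eta> (z + h - z')\<bar> \<partial>lborel) + (\<integral>z'. \<bar>U z'\<bar> * \<bar>\<eta> (z - h - z')\<bar> \<partial>lborel) + 2 * (\<integral>z'. \<bar>U z'\<bar> * \<bar>\<eta> (z - z')\<bar> \<partial>lborel)"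
      using i[of "z + h"] i[of "z - h"] i[of z] by simp
    also have "\<dots> \<le> 4 * (A * C * V0)" using le[of "z + h"] le[of "z - h"] le[of z] by linarith
    finally show ?thesis .
  qed
  have small: "(\<integral>z'. \<bar>U z' * D2 \<eta> (z - z') h\<bar> \<partial>lborel) \<le> 2 * A * C * V1 * (norm h)\<^sup>2" if h: "norm h \<le> 1" for z h
  proof -
    have D2h: "\<bar>\<bar>D2 \<eta> z h\<bar>\<bar> \<le> 2 * (C * (norm h)\<^sup>2)" for z
    proof -
      have "D2 \<eta> z h = (\<eta> (z + h) - \<eta> z - ?F z h) + (\<eta> (z + - h) - \<eta> z - ?F z (- h))"
        by (simp add: D2_def linear_neg[OF lin])
      then show ?thesis using C(4)[of z h] C(4)[of z "- h"] by (simp add: abs_le_iff)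
    qed
    have D20: "\<bar>D2 \<eta> z h\<bar> = 0" if "r + 1 < norm z" for z
      using that h norm_triangle_ineq2[of z "- h"] norm_triangle_ineq2[of z h] supp[of "z + h"] supp[of "z - h"] supp[of z]
      by (simp add: D2_def)
    have "\<bar>conv (\<lambda>z. \<bar>U z\<bar>) (\<lambda>z. \<bar>D2 \<eta> z h\<bar>) z\<bar> \<le> A * (2 * (C * (norm h)\<^sup>2)) * V1"
      unfolding V1_def by (rule abs_conv_le[OF _ _ aU D2h D20]) (unfold D2_def, measurable)
    then show ?thesis unfolding conv_def by (simp add: abs_mult mult_ac)
  qed
  define K where "K = max (4 * (A * C * V0)) (2 * A * C * V1)"
  have K: "0 \<le> K" using A C by (simp add: K_def V1_def le_max_iff_disj)
  show ?thesis
  proof (intro exI[of _ K] conjI K allI impI iD)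
    show "(\<integral>z'. \<bar>U z' * D2 \<eta> (z - z') h\<bar> \<partial>lborel) \<le> K" for z h
      using big[of z h] by (simp add: K_def)
    show "(\<integral>z'. \<bar>U z' * D2 \<eta> (z - z') h\<bar> \<partial>lborel) \<le> K * (norm h)\<^sup>2" if "norm h \<le> 1" for z h
    proof -
      have "2 * A * C * V1 * (norm h)\<^sup>2 \<le> K * (norm h)\<^sup>2" unfolding K_def by (intro mult_right_mono) auto
      then show ?thesis using small[OF that, of z] by linarith
    qed
  qed
qed

lemma (in finite_measure) integrable_pair_of_snd:
  fixes k :: "real \<Rightarrow> real"
  assumes "integrable lborel k"
  shows "integrable (M \<Otimes>\<^sub>M lborel) (\<lambda>(\<theta>, r). k r)"
proof -
  interpret pair_sigma_finite M "lborel :: real measure" ..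
  have [measurable]: "k \<in> borel_measurable borel" using assms by (auto dest: borel_measurable_integrable)
  show ?thesis by (rule Fubini_integrable) (use assms in auto)
qed

text \<open>The operator is an integral of second differences, and these commute with convolution.
  What has to be justified is exchanging the integral over z' with the integrals over directions and
  jumps, done by Fubini on the product of three measures.\<close>

lemma conv_stable_op:
  fixes U \<eta> :: "real \<times> 'a::euclidean_space \<Rightarrow> real"
  assumes Um [measurable]: "U \<in> borel_measurable borel" and U: "\<And>z. \<bar>U z\<bar> \<le> A"
    and smooth: "\<And>k. C_k_on k UNIV \<eta>" and supp: "\<And>z. r < norm z \<Longrightarrow> \<eta> z = 0"
    and s: "0 < s" "s < 1" and sp: "spectral_measure s lam Lam \<mu>" and Lam: "0 \<le> Lam"
  shows "integrable lborel (\<lambda>z'. U z' * stable_op s \<mu> \<eta> (z - z'))"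
    "conv U (stable_op s \<mu> \<eta>) z = stable_op s \<mu> (conv U \<eta>) z"
proof -
  note S = spectral_measureD[OF sp Lam]
  interpret \<mu>: finite_measure \<mu> by (rule S)
  interpret P: pair_sigma_finite \<mu> "lborel :: real measure" ..
  define P where "P = \<mu> \<Otimes>\<^sub>M (lborel :: real measure)"
  have "sigma_finite_measure P" unfolding P_def by (rule P.sigma_finite_measure_axioms)
  then interpret Q: pair_sigma_finite P "lborel :: (real \<times> 'a) measure"
    by (simp add: pair_sigma_finite_def sigma_finite_lborel)
  have [measurable]: "\<eta> \<in> borel_measurable borel" using smooth by (rule smooth_measurable)
  note idm [measurable] = spectral_measure_id_measurable[OF sp]
  have space_P: "\<And>p. p \<in> space P \<Longrightarrow> norm (fst p) = 1" by (auto simp: P_def space_pair_measure S)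
  have fst_m [measurable]: "(\<lambda>p. fst p) \<in> borel_measurable P"
    unfolding P_def using measurable_compose[OF measurable_fst idm] by simp
  have snd_m [measurable]: "(\<lambda>p. snd p) \<in> borel_measurable P"
    unfolding P_def using measurable_snd[of \<mu> "lborel :: real measure"] by simp
  define k where "k = (\<lambda>p :: 'a \<times> real. \<bar>snd p\<bar> powr (1 + 2 * s))"
  define F where "F = (\<lambda>p z'. U z' * D2 \<eta> (z - z') (0, snd p *\<^sub>R fst p) / k p)"
  have Fm: "case_prod F \<in> borel_measurable (P \<Otimes>\<^sub>M lborel)"
    unfolding F_def k_def D2_def case_prod_beta by measurable
  obtain K where K: "0 \<le> K" "\<And>z h. integrable lborel (\<lambda>z'. U z' * D2 \<eta> (z - z') h)"
    "\<And>z h. (\<integral>z'. \<bar>U z' * D2 \<eta> (z - z') h\<bar> \<partial>lborel) \<le> K"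
    "\<And>z h. norm h \<le> 1 \<Longrightarrow> (\<integral>z'. \<bar>U z' * D2 \<eta> (z - z') h\<bar> \<partial>lborel) \<le> K * (norm h)\<^sup>2"
    using conv_abs_D2_bound[OF Um U smooth supp] by blast
  have Fint: "integrable lborel (F p)" for p
    unfolding F_def by (intro integrable_divide K)
  have Fle: "(\<integral>z'. norm (F p z') \<partial>lborel) \<le> kernel_majorant s 1 K K 0 (snd p)" if "p \<in> space P" for p
  proof -
    have n: "norm (0 :: real, snd p *\<^sub>R fst p) = \<bar>snd p\<bar>" using space_P[OF that] by (simp add: norm_Pair)
    have "(\<integral>z'. norm (F p z') \<partial>lborel) = (\<integral>z'. \<bar>U z' * D2 \<eta> (z - z') (0, snd p *\<^sub>R fst p)\<bar> \<partial>lborel) / k p"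
      by (simp add: F_def abs_mult k_def)
    also have "\<dots> \<le> kernel_majorant s 1 K K 0 (snd p)"
    proof (cases "\<bar>snd p\<bar> \<le> 1")
      case True
      then have "(\<integral>z'. \<bar>U z' * D2 \<eta> (z - z') (0, snd p *\<^sub>R fst p)\<bar> \<partial>lborel) \<le> K * (snd p)\<^sup>2"
        using K(4)[of "(0, snd p *\<^sub>R fst p)" z] unfolding n by simp
      then have "(\<integral>z'. \<bar>U z' * D2 \<eta> (z - z') (0, snd p *\<^sub>R fst p)\<bar> \<partial>lborel) / k p \<le> K * (snd p)\<^sup>2 / k p"
        by (rule divide_right_mono) (simp add: k_def)
      then show ?thesis using True by (simp add: kernel_majorant_def k_def)
    next
      case False
      have "(\<integral>z'. \<bar>U z' * D2 \<eta> (z - z') (0, snd p *\<^sub>R fst p)\<bar> \<partial>lborel) / k p \<le> K / k p"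
        using K(3) by (rule divide_right_mono) (simp add: k_def)
      then show ?thesis using False by (simp add: kernel_majorant_def k_def)
    qed
    finally show ?thesis .
  qed
  have kint: "integrable P (\<lambda>p. kernel_majorant s 1 K K 0 (snd p))"
  proof -
    have "integrable lborel (kernel_majorant s 1 K K 0)"
      using kernel_majorant_integral[of s 1 K K 0] s K(1) by (simp add: has_bochner_integral_iff)
    from \<mu>.integrable_pair_of_snd[OF this] show ?thesis by (simp add: P_def split_beta')
  qed
  have Fi: "integrable (P \<Otimes>\<^sub>M lborel) (case_prod F)"
  proof (rule Q.Fubini_integrable[OF Fm])
    show "integrable P (\<lambda>p. \<integral>z'. norm (case_prod F (p, z')) \<partial>lborel)"
    proof (rule Bochner_Integration.integrable_bound[OF kint])
      show "(\<lambda>p. \<integral>z'. norm (case_prod F (p, z')) \<partial>lborel) \<in> borel_measurable P"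
        using Fm by (intro lborel.borel_measurable_lebesgue_integral) (simp add: split_beta')
      show "AE p in P. norm (\<integral>z'. norm (case_prod F (p, z')) \<partial>lborel) \<le> norm (kernel_majorant s 1 K K 0 (snd p))"
      proof (rule AE_I2)
        fix p assume "p \<in> space P"
        from order_trans[OF Fle[OF this] abs_ge_self]
        show "norm (\<integral>z'. norm (case_prod F (p, z')) \<partial>lborel) \<le> norm (kernel_majorant s 1 K K 0 (snd p))" by simp
      qed
    qed
  qed (simp add: Fint)
  have FD: "(\<integral>z'. F p z' \<partial>lborel) = D2 (conv U \<eta>) z (0, snd p *\<^sub>R fst p) / k p" for p
  proof -
    have "(\<integral>z'. F p z' \<partial>lborel) = conv U (\<lambda>z. D2 \<eta> z (0, snd p *\<^sub>R fst p)) z / k p"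
      by (simp add: F_def conv_def)
    also have "\<dots> = D2 (conv U \<eta>) z (0, snd p *\<^sub>R fst p) / k p"
      using conv_D2[OF Um U smooth supp, where z = z and h = "(0, snd p *\<^sub>R fst p)"] by simp
    finally show ?thesis .
  qed
  \<comment> \<open>Fubini makes the section in p integrable only for almost every z', so the
    identity with the operator is an almost everywhere statement.\<close>
  have inner: "AE z' in lborel. (\<integral>p. F p z' \<partial>P) = U z' * stable_op s \<mu> \<eta> (z - z')"
    using Q.AE_integrable_snd[OF Fi]
  proof eventually_elim
    fix z' assume i: "integrable P (\<lambda>p. F p z')"
    have "(\<integral>p. F p z' \<partial>P) = (\<integral>\<theta>. (\<integral>r. F (\<theta>, r) z' \<partial>lborel) \<partial>\<mu>)"
      using P.integral_fst'[of "\<lambda>p. F p z'"] i by (simp add: P_def)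
    also have "\<dots> = (\<integral>\<theta>. U z' * (\<integral>r. D2 \<eta> (z - z') (0, r *\<^sub>R \<theta>) / \<bar>r\<bar> powr (1 + 2 * s) \<partial>lborel) \<partial>\<mu>)"
      by (simp add: F_def k_def times_divide_eq_right[symmetric] del: times_divide_eq_right)
    also have "\<dots> = U z' * stable_op s \<mu> \<eta> (z - z')"
      by (cases "z - z'") (simp add: stable_op_def D2_def)
    finally show "(\<integral>p. F p z' \<partial>P) = U z' * stable_op s \<mu> \<eta> (z - z')" .
  qed
  have st_m [measurable]: "stable_op s \<mu> \<eta> \<in> borel_measurable borel"
  proof -
    have "(\<lambda>z. \<integral>\<theta>. (\<integral>r. (\<eta> (z + (0, r *\<^sub>R \<theta>)) + \<eta> (z - (0, r *\<^sub>R \<theta>)) - 2 * \<eta> z)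
               / \<bar>r\<bar> powr (1 + 2 * s) \<partial>lborel) \<partial>\<mu>) \<in> borel_measurable borel"
      by measurable
    moreover have "stable_op s \<mu> \<eta> = (\<lambda>z. \<integral>\<theta>. (\<integral>r. (\<eta> (z + (0, r *\<^sub>R \<theta>)) + \<eta> (z - (0, r *\<^sub>R \<theta>)) - 2 * \<eta> z)
               / \<bar>r\<bar> powr (1 + 2 * s) \<partial>lborel) \<partial>\<mu>)"
      by (auto simp: stable_op_def)
    ultimately show ?thesis by simp
  qed
  have meas: "(\<lambda>z'. U z' * stable_op s \<mu> \<eta> (z - z')) \<in> borel_measurable lborel" by measurable
  have meas2: "(\<lambda>z'. \<integral>p. F p z' \<partial>P) \<in> borel_measurable lborel"
    using Q.integrable_snd[OF Fi] by (rule borel_measurable_integrable)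
  show "integrable lborel (\<lambda>z'. U z' * stable_op s \<mu> \<eta> (z - z'))"
    using Q.integrable_snd[OF Fi] inner meas meas2 by (subst (asm) integrable_cong_AE) auto
  have "conv U (stable_op s \<mu> \<eta>) z = (\<integral>z'. (\<integral>p. F p z' \<partial>P) \<partial>lborel)"
    unfolding conv_def using inner meas meas2 by (intro integral_cong_AE) auto
  also have "\<dots> = (\<integral>p. (\<integral>z'. F p z' \<partial>lborel) \<partial>P)"
    by (rule Q.Fubini_integral[OF Fi])
  also have "\<dots> = (\<integral>p. D2 (conv U \<eta>) z (0, snd p *\<^sub>R fst p) / k p \<partial>P)"
    unfolding FD ..
  also have "\<dots> = (\<integral>\<theta>. (\<integral>r. D2 (conv U \<eta>) z (0, r *\<^sub>R \<theta>) / \<bar>r\<bar> powr (1 + 2 * s) \<partial>lborel) \<partial>\<mu>)"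
  proof -
    have "integrable P (\<lambda>p. \<integral>z'. F p z' \<partial>lborel)" using Q.integrable_fst[OF Fi] by simp
    then have "integrable P (\<lambda>p. D2 (conv U \<eta>) z (0, snd p *\<^sub>R fst p) / k p)"
      unfolding FD .
    from P.integral_fst'[OF this[unfolded P_def]] show ?thesis by (simp add: P_def k_def)
  qed
  also have "\<dots> = stable_op s \<mu> (conv U \<eta>) z"
    by (cases z) (simp add: stable_op_def D2_def)
  finally show "conv U (stable_op s \<mu> \<eta>) z = stable_op s \<mu> (conv U \<eta>) z" .
qed

section \<open>Mollified weak solutions\<close>

lemma integral_reflect_translate:
  fixes \<phi> :: "'a::euclidean_space \<Rightarrow> real"
  assumes [measurable]: "\<phi> \<in> borel_measurable borel"
  shows "(\<integral>z'. \<phi> (z - z') \<partial>lborel) = (\<integral>z'. \<phi> z' \<partial>lborel)"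
proof -
  have "(\<integral>z'. \<phi> z' \<partial>lborel) = (\<integral>z'. \<phi> z' \<partial>(density (distr lborel borel (\<lambda>x. z + (-1) *\<^sub>R x)) (\<lambda>_. \<bar>- 1 :: real\<bar> ^ DIM('a))))"
    by (subst lborel_affine[of "-1" z]) auto
  also have "\<dots> = (\<integral>z'. \<phi> (z - z') \<partial>lborel)"
    by (subst integral_density) (simp_all add: integral_distr)
  finally show ?thesis by simp
qed

definition mollifier :: "real \<Rightarrow> 'a::euclidean_space \<Rightarrow> real" where
  "mollifier \<epsilon> z = 1 / (\<integral>z'. bump \<epsilon> (z' :: 'a) \<partial>lborel) * bump \<epsilon> z"

lemma C_k_on_cmult: "C_k_on k UNIV f \<Longrightarrow> C_k_on k UNIV (\<lambda>z. c * f z)"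
  by (intro C_k_on_mult C_k_on_const)

lemma mollifier_C_k: "C_k_on k UNIV (mollifier \<epsilon>)"
  unfolding mollifier_def by (intro C_k_on_cmult bump_C_k)

lemma mollifier_measurable [measurable]: "mollifier \<epsilon> \<in> borel_measurable borel"
  using mollifier_C_k by (rule smooth_measurable)

lemma mollifier_eq_0: "0 < \<epsilon> \<Longrightarrow> \<epsilon> \<le> norm z \<Longrightarrow> mollifier \<epsilon> z = 0"
  by (simp add: mollifier_def bump_eq_0)

lemma compact_support_integrable:
  fixes \<eta> :: "'a::euclidean_space \<Rightarrow> real"
  assumes "continuous_on UNIV \<eta>" "\<And>z. r < norm z \<Longrightarrow> \<eta> z = 0"
  shows "integrable lborel (\<lambda>z'. \<eta> (z - z'))"
proof -
  obtain C where "\<And>z. \<bar>\<eta> z\<bar> \<le> C" using continuous_compact_support_bounded[OF assms] by blast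
  have "integrable lborel (\<lambda>z'. 1 * \<eta> (z - z'))"
    by (rule conv_integrable[where A = 1, OF _ _ _ \<open>\<And>z. \<bar>\<eta> z\<bar> \<le> C\<close> assms(2)])
      (use assms(1) in \<open>auto intro: borel_measurable_continuous_onI\<close>)
  then show ?thesis by simp
qed

lemma bump_integral_pos:
  assumes "0 < \<epsilon>"
  shows "0 < (\<integral>z. bump \<epsilon> (z :: 'a::euclidean_space) \<partial>lborel)"
proof -
  have cont: "continuous_on UNIV (bump \<epsilon> :: 'a \<Rightarrow> real)" using bump_C_k[of 0 \<epsilon>] by simp
  have [measurable]: "(bump \<epsilon> :: 'a \<Rightarrow> real) \<in> borel_measurable borel"
    using bump_C_k by (rule smooth_measurable)
  have "integrable lborel (\<lambda>z'. bump \<epsilon> (0 - z' :: 'a))"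
    by (rule compact_support_integrable[OF cont bump_eq_0[OF assms less_imp_le]])
  moreover have "(\<lambda>z'. bump \<epsilon> (0 - z' :: 'a)) = bump \<epsilon>" by (rule ext) (simp add: bump_def)
  ultimately have int: "integrable lborel (bump \<epsilon> :: 'a \<Rightarrow> real)" by simp
  have "(\<integral>z. bump \<epsilon> (z :: 'a) \<partial>lborel) \<noteq> 0"
  proof
    assume "(\<integral>z. bump \<epsilon> (z :: 'a) \<partial>lborel) = 0"
    then have "AE z in lborel. bump \<epsilon> (z :: 'a) = 0"
      using integral_nonneg_eq_0_iff_AE[OF int] bump_nonneg by auto
    then have "AE z in lborel. (z :: 'a) \<notin> ball 0 \<epsilon>"
      by eventually_elim (use bump_pos_iff[OF assms] in force)
    then have "ball (0::'a) \<epsilon> \<in> null_sets lborel" by (subst AE_iff_null_sets) auto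
    then have "negligible (ball (0::'a) \<epsilon>)" by (simp add: negligible_iff_null_sets null_sets_completionI)
    then show False using open_not_negligible[of "ball (0::'a) \<epsilon>"] assms by simp
  qed
  moreover have "0 \<le> (\<integral>z. bump \<epsilon> (z :: 'a) \<partial>lborel)"
    using bump_nonneg by (intro Bochner_Integration.integral_nonneg) auto
  ultimately show ?thesis by simp
qed

lemma mollifier_nonneg: "0 < \<epsilon> \<Longrightarrow> 0 \<le> mollifier \<epsilon> (z :: 'a::euclidean_space)"
  using bump_integral_pos[of \<epsilon>, where 'a = 'a] bump_nonneg[of \<epsilon> z] by (simp add: mollifier_def)

lemma mollifier_has_integral:
  assumes "0 < \<epsilon>"
  shows "has_bochner_integral lborel (\<lambda>z'. mollifier \<epsilon> (z - z' :: 'a::euclidean_space)) 1"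
proof -
  have "integrable lborel (\<lambda>z'. mollifier \<epsilon> (z - z' :: 'a))"
    by (rule compact_support_integrable[OF _ mollifier_eq_0[OF assms less_imp_le]]) (use mollifier_C_k[of 0] in auto)
  moreover have "(\<integral>z'. mollifier \<epsilon> (z - z' :: 'a) \<partial>lborel) = 1"
    using bump_integral_pos[OF assms, where 'a = 'a] integral_reflect_translate[OF mollifier_measurable, of \<epsilon> z]
    by (simp add: mollifier_def[abs_def])
  ultimately show ?thesis by (simp add: has_bochner_integral_iff)
qed

lemma abs_conv_mollifier_le:
  fixes U :: "'a::euclidean_space \<Rightarrow> real"
  assumes Um [measurable]: "U \<in> borel_measurable borel" and U: "\<And>z. \<bar>U z\<bar> \<le> A" and \<epsilon>: "0 < \<epsilon>"
  shows "\<bar>conv U (mollifier \<epsilon>) z\<bar> \<le> A"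
proof -
  note M = mollifier_has_integral[OF \<epsilon>, of z]
  have "\<bar>conv U (mollifier \<epsilon>) z\<bar> \<le> (\<integral>z'. \<bar>U z' * mollifier \<epsilon> (z - z')\<bar> \<partial>lborel)"
    unfolding conv_def by (rule integral_abs_bound)
  also have "\<dots> \<le> (\<integral>z'. A * mollifier \<epsilon> (z - z') \<partial>lborel)"
  proof (rule integral_mono')
    show "integrable lborel (\<lambda>z'. A * mollifier \<epsilon> (z - z'))" using M by (simp add: has_bochner_integral_iff)
    show "\<bar>U z' * mollifier \<epsilon> (z - z')\<bar> \<le> A * mollifier \<epsilon> (z - z')" for z'
      using U[of z'] mollifier_nonneg[OF \<epsilon>, of "z - z'"] by (simp add: abs_mult mult_right_mono)
    show "0 \<le> A * mollifier \<epsilon> (z - z')" for z'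
      using U[of z'] mollifier_nonneg[OF \<epsilon>, of "z - z'"] by simp
  qed
  also have "\<dots> = A" using M by (simp add: has_bochner_integral_iff)
  finally show ?thesis .
qed

lemma C_k_on_reflect: "C_k_on k UNIV g \<Longrightarrow> C_k_on k UNIV (\<lambda>z'. g (z - z'))"
proof (induction k arbitrary: g)
  case 0
  then have "continuous_on UNIV g" by simp
  then show ?case by (auto intro!: continuous_on_compose2[of UNIV g] continuous_intros)
next
  case (Suc k)
  note E = C_k_on_SucD[OF Suc.prems]
  have lin: "linear (frechet_derivative g (at x))" for x using E(1) has_derivative_linear by blast
  have "((\<lambda>z'. g (z - z')) has_derivative (\<lambda>h. (-1) * frechet_derivative g (at (z - x)) h)) (at x)" for x
  proof -
    have "((\<lambda>z'. z - z') has_derivative (\<lambda>h. - h)) (at x)" by (auto intro!: derivative_eq_intros)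
    from has_derivative_compose[OF this E(1)] show ?thesis by (simp add: linear_neg[OF lin])
  qed
  then show ?case by (rule C_k_on_SucI) (intro C_k_on_cmult Suc.IH[OF E(2)])
qed

lemma test_function_mollifier:
  assumes "0 < \<epsilon>" "cball z \<epsilon> \<subseteq> S"
  shows "test_function S (\<lambda>z'. mollifier \<epsilon> (z - z'))"
proof -
  have "{z'. mollifier \<epsilon> (z - z') \<noteq> 0} \<subseteq> cball z \<epsilon>"
    using mollifier_eq_0[OF assms(1)] by (force simp: dist_norm)
  then have "closure {z'. mollifier \<epsilon> (z - z') \<noteq> 0} \<subseteq> cball z \<epsilon>"
    by (intro closure_minimal) auto
  then show ?thesis unfolding test_function_def
    using assms(2) C_k_on_reflect[OF mollifier_C_k] \<open>{z'. mollifier \<epsilon> (z - z') \<noteq> 0} \<subseteq> cball z \<epsilon>\<close>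
    by (auto simp: compact_closure intro: bounded_subset[OF bounded_cball])
qed

text \<open>Extending u by 0 to times outside I is harmless: both terms of the operator applied to a test function
vanish at such times.\<close>

lemma mollified_equation:
  fixes u f :: "real \<times> 'a::euclidean_space \<Rightarrow> real"
  assumes s: "0 < s" "s < 1" and sp: "spectral_measure s lam Lam \<mu>" and Lam: "0 \<le> Lam"
    and weak: "weak_solution (stable_op s \<mu>) I D u f" and I: "open I" and D: "open D"
    and Um [measurable]: "U \<in> borel_measurable borel" and U: "\<And>z. \<bar>U z\<bar> \<le> A"
    and Uu: "AE z in lborel. U z = (if z \<in> I \<times> UNIV then u z else 0)"
    and f: "AE z in lebesgue_on (I \<times> D). \<bar>f z\<bar> \<le> B" and B: "0 \<le> B"
    and \<epsilon>: "0 < \<epsilon>" "cball (t, x) \<epsilon> \<subseteq> I \<times> D"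
  shows "\<exists>F. \<bar>F\<bar> \<le> B \<and> ((\<lambda>t. conv U (mollifier \<epsilon>) (t, x)) has_real_derivative
     (slice_op s \<mu> (\<lambda>y. conv U (mollifier \<epsilon>) (t, y)) x + F)) (at t)"
proof -
  define z where "z = (t, x)"
  define \<eta> where "\<eta> = (mollifier \<epsilon> :: real \<times> 'a \<Rightarrow> real)"
  let ?F = "\<lambda>z. frechet_derivative \<eta> (at z)"
  have smooth: "\<And>k. C_k_on k UNIV \<eta>" unfolding \<eta>_def by (rule mollifier_C_k)
  have supp: "\<And>z. \<epsilon> < norm z \<Longrightarrow> \<eta> z = 0"
    unfolding \<eta>_def using mollifier_eq_0[OF \<epsilon>(1) less_imp_le] .
  note E = C_k_on_SucD(1)[OF smooth]
  have lin: "linear (?F z)" for z using E has_derivative_linear by blast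
  \<comment> \<open>Testing with the mollifier reflected and centred at z turns the weak formulation
    into the pointwise equation of the convolution at z.\<close>
  let ?T = "\<lambda>z'. \<eta> (z - z')"
  have "test_function (I \<times> D) ?T" unfolding \<eta>_def z_def by (rule test_function_mollifier[OF \<epsilon>])
  with weak have
    int1: "integrable (lebesgue_on (I \<times> UNIV)) (\<lambda>(t, x). u (t, x) * (- deriv (\<lambda>\<tau>. ?T (\<tau>, x)) t - stable_op s \<mu> ?T (t, x)))" and
    int2: "integrable (lebesgue_on (I \<times> D)) (\<lambda>z. f z * ?T z)" and
    eq: "(\<integral>(t, x). u (t, x) * (- deriv (\<lambda>\<tau>. ?T (\<tau>, x)) t - stable_op s \<mu> ?T (t, x)) \<partial>lebesgue_on (I \<times> UNIV))
          = (\<integral>z. f z * ?T z \<partial>lebesgue_on (I \<times> D))"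
    unfolding weak_solution_def by blast+
  \<comment> \<open>The reflection reverses the sign in time, so minus the time derivative of the
    test function is plus the time derivative of the mollifier.\<close>
  have dT: "- deriv (\<lambda>\<tau>. ?T (\<tau>, x')) t' = ?F (z - (t', x')) (1, 0)" for t' x'
  proof -
    have a: "((\<lambda>\<tau>. z - (\<tau>, x')) has_derivative (\<lambda>h. (- h, 0))) (at t')"
      by (auto intro!: derivative_eq_intros)
    have "((\<lambda>\<tau>. ?T (\<tau>, x')) has_derivative (\<lambda>h. ?F (z - (t', x')) (- h, 0))) (at t')"
      by (rule has_derivative_compose[OF a E])
    moreover have "(\<lambda>h. ?F (z - (t', x')) (- h, 0)) = (*) (- ?F (z - (t', x')) (1, 0))"
    proof
      fix h
      have "(- h, 0) = (- h) *\<^sub>R (1 :: real, 0 :: 'a)" by simp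
      then show "?F (z - (t', x')) (- h, 0) = - ?F (z - (t', x')) (1, 0) * h"
        by (metis linear_scale[OF lin] real_scaleR_def mult.commute mult_minus_left)
    qed
    ultimately have "((\<lambda>\<tau>. ?T (\<tau>, x')) has_real_derivative - ?F (z - (t', x')) (1, 0)) (at t')"
      by (simp add: has_field_derivative_def)
    then show ?thesis by (simp add: DERIV_imp_deriv)
  qed
  \<comment> \<open>The operator is even in the jumps, hence unaffected by the spatial
    reflection.\<close>
  have sT: "stable_op s \<mu> ?T z' = stable_op s \<mu> \<eta> (z - z')" for z'
  proof -
    obtain t' x' where z': "z' = (t', x')" by fastforce
    show ?thesis using slice_op_affine[of "-1" s \<mu> "\<lambda>y. \<eta> (t - t', y)" x x']
      by (simp add: z' z_def stable_op_eq_slice_op)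
  qed
  have [measurable]: "\<eta> \<in> borel_measurable borel" using smooth by (rule smooth_measurable)
  note [measurable] = smooth_derivative_measurable[OF smooth]
  obtain C where C: "\<And>z h. \<bar>?F z h\<bar> \<le> C * norm h" "\<And>z. \<bar>\<eta> z\<bar> \<le> C"
    using smooth_compact_support_taylor[OF smooth supp] by blast
  have F0: "?F z h = 0" if "\<epsilon> < norm z" for z h using frechet_derivative_eq_0_outside[OF supp that] by simp
  have i1: "integrable lborel (\<lambda>z'. U z' * ?F (z - z') (1, 0))"
    by (rule conv_integrable[OF _ _ U C(1) F0]) auto
  note i2 = conv_stable_op[OF Um U smooth supp s sp Lam, where z = z]
  define H where "H = (\<lambda>z'. U z' * ?F (z - z') (1, 0) - U z' * stable_op s \<mu> \<eta> (z - z'))"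
  have Hi: "integrable lborel H" unfolding H_def using i1 i2(1) by (rule Bochner_Integration.integrable_diff)
  have IU: "I \<times> (UNIV :: 'a set) \<in> sets lebesgue"
    by (rule sets_completionI_sets) (simp only: sets_lborel borel_open open_Times[OF I open_UNIV])
  have ID: "I \<times> D \<in> sets lebesgue"
    by (rule sets_completionI_sets) (simp only: sets_lborel borel_open open_Times[OF I D])
  define G where "G = (\<lambda>(t, x). u (t, x) * (- deriv (\<lambda>\<tau>. ?T (\<tau>, x)) t - stable_op s \<mu> ?T (t, x)))"
  have "(\<integral>z. G z \<partial>lebesgue_on (I \<times> UNIV)) = (\<integral>z. indicator (I \<times> UNIV) z *\<^sub>R G z \<partial>lebesgue)"
    using IU by (subst integral_restrict_space) auto
  also have "\<dots> = (\<integral>z. H z \<partial>lebesgue)"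
  proof (rule integral_cong_AE)
    show "(\<lambda>z. indicator (I \<times> UNIV) z *\<^sub>R G z) \<in> borel_measurable lebesgue"
      using int1 IU unfolding G_def[symmetric]
      by (subst (asm) integrable_restrict_space) (auto intro: borel_measurable_integrable)
    show "H \<in> borel_measurable lebesgue" using Hi by (intro measurable_completion borel_measurable_integrable)
    show "AE z in lebesgue. indicator (I \<times> UNIV) z *\<^sub>R G z = H z"
      using AE_completion[OF Uu]
    proof eventually_elim
      fix z' assume *: "U z' = (if z' \<in> I \<times> UNIV then u z' else 0)"
      obtain t' x' where z': "z' = (t', x')" by fastforce
      show "indicator (I \<times> UNIV) z' *\<^sub>R G z' = H z'"
        unfolding G_def H_def z' prod.case dT sT using * by (auto simp: z' indicator_def algebra_simps)
    qed
  qed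
  also have "\<dots> = (\<integral>z. H z \<partial>lborel)"
    using Hi by (intro integral_completion borel_measurable_integrable)
  also have "\<dots> = conv U (\<lambda>w. ?F w (1, 0)) z - conv U (stable_op s \<mu> \<eta>) z"
    unfolding H_def conv_def using i1 i2(1) by simp
  finally have lhs: "(\<integral>z. G z \<partial>lebesgue_on (I \<times> UNIV)) = conv U (\<lambda>w. ?F w (1, 0)) z - stable_op s \<mu> (conv U \<eta>) z"
    by (simp add: i2(2))
  \<comment> \<open>The source of the mollified equation: an average of f against a kernel of total
    mass 1, so it inherits the bound B.\<close>
  define R where "R = (\<integral>z. f z * ?T z \<partial>lebesgue_on (I \<times> D))"
  have T0: "0 \<le> ?T z'" for z' unfolding \<eta>_def by (rule mollifier_nonneg[OF \<epsilon>(1)])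
  have Tint: "has_bochner_integral lborel ?T 1" unfolding \<eta>_def by (rule mollifier_has_integral[OF \<epsilon>(1)])
  have Tleb: "integrable lebesgue ?T" "(\<integral>z. ?T z \<partial>lebesgue) = 1"
    using Tint by (auto simp: has_bochner_integral_iff integrable_completion integral_completion)
  have Tr: "integrable lebesgue (\<lambda>z. indicator (I \<times> D) z *\<^sub>R ?T z)"
    by (rule Bochner_Integration.integrable_bound[OF Tleb(1)])
      (use ID T0 Tleb(1) in \<open>auto simp: indicator_def intro!: AE_I2 borel_measurable_scaleR borel_measurable_indicator\<close>)
  then have TI: "integrable (lebesgue_on (I \<times> D)) ?T" using ID by (subst integrable_restrict_space) auto
  have "\<bar>R\<bar> \<le> (\<integral>z. \<bar>f z * ?T z\<bar> \<partial>lebesgue_on (I \<times> D))"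
    unfolding R_def by (rule integral_abs_bound)
  also have "\<dots> \<le> (\<integral>z. B * ?T z \<partial>lebesgue_on (I \<times> D))"
  proof (rule integral_mono_AE)
    show "AE z in lebesgue_on (I \<times> D). \<bar>f z * ?T z\<bar> \<le> B * ?T z"
      using f by eventually_elim (simp add: abs_mult T0 mult_right_mono)
  qed (use int2 TI in auto)
  also have "\<dots> = B * (\<integral>z. indicator (I \<times> D) z *\<^sub>R ?T z \<partial>lebesgue)"
    using ID by (simp add: integral_restrict_space)
  also have "\<dots> \<le> B * (\<integral>z. ?T z \<partial>lebesgue)"
    using Tr Tleb T0 B by (intro mult_left_mono integral_mono) (auto simp: indicator_def)
  finally have R: "\<bar>R\<bar> \<le> B" by (simp add: Tleb)
  have der: "((\<lambda>t. conv U \<eta> (t, x)) has_real_derivative conv U (\<lambda>w. ?F w (1, 0)) z) (at t)"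
  proof -
    note cd = conv_has_derivative[OF Um U smooth supp, where z = z]
    have bl: "linear (\<lambda>h. conv U (\<lambda>w. ?F w h) z)" using cd has_derivative_linear by blast
    have "((\<lambda>\<tau>. (\<tau>, x)) has_derivative (\<lambda>h. (h, 0))) (at t)" by (auto intro!: derivative_eq_intros)
    then have "((\<lambda>t. conv U \<eta> (t, x)) has_derivative (\<lambda>h. conv U (\<lambda>w. ?F w (h, 0)) z)) (at t)"
      by (rule has_derivative_compose) (use cd in \<open>simp add: z_def\<close>)
    moreover have "(\<lambda>h. conv U (\<lambda>w. ?F w (h, 0)) z) = (*) (conv U (\<lambda>w. ?F w (1, 0)) z)"
    proof
      fix h :: real
      have "(h, 0) = h *\<^sub>R (1 :: real, 0 :: 'a)" by simp
      then show "conv U (\<lambda>w. ?F w (h, 0)) z = conv U (\<lambda>w. ?F w (1, 0)) z * h"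
        by (metis linear_scale[OF bl] real_scaleR_def mult.commute)
    qed
    ultimately show ?thesis by (simp add: has_field_derivative_def)
  qed
  have "(\<integral>z. G z \<partial>lebesgue_on (I \<times> UNIV)) = R" unfolding G_def R_def by (rule eq)
  moreover have "stable_op s \<mu> (conv U \<eta>) z = slice_op s \<mu> (\<lambda>y. conv U \<eta> (t, y)) x"
    unfolding z_def by (rule stable_op_eq_slice_op)
  ultimately have "conv U (\<lambda>w. ?F w (1, 0)) z = slice_op s \<mu> (\<lambda>y. conv U \<eta> (t, y)) x + R"
    using lhs by linarith
  from der[unfolded this] R show ?thesis unfolding \<eta>_def by blast
qed

section \<open>Convergence of mollifications almost everywhere\<close>

lemma cball_measurable [measurable]: "cball x r \<in> sets (borel :: 'a::euclidean_space measure)"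
  by (simp add: borel_closed)

lemma mollifier_swap: "mollifier \<epsilon> (z - z' :: 'a::euclidean_space) = mollifier \<epsilon> (z' - z)"
proof -
  have "mollifier \<epsilon> (- w) = mollifier \<epsilon> w" for w :: 'a by (simp add: mollifier_def bump_def)
  from this[of "z' - z"] show ?thesis by simp
qed

lemma nn_integral_mollifier: "0 < \<epsilon> \<Longrightarrow> (\<integral>\<^sup>+z. ennreal (mollifier \<epsilon> (z - z' :: 'a::euclidean_space)) \<partial>lborel) = 1"
  using mollifier_has_integral[of \<epsilon> z'] mollifier_nonneg[of \<epsilon>]
  by (subst mollifier_swap, subst nn_integral_eq_integral) (auto simp: has_bochner_integral_iff)

lemma conv_mollifier_measurable:
  fixes h :: "'a::euclidean_space \<Rightarrow> real"
  assumes [measurable]: "h \<in> borel_measurable borel"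
  shows "conv h (mollifier \<epsilon>) \<in> borel_measurable borel"
  unfolding conv_def by measurable

lemma conv_mollifier_integrable:
  fixes h :: "'a::euclidean_space \<Rightarrow> real"
  assumes [measurable]: "h \<in> borel_measurable borel" and B: "\<And>z. \<bar>h z\<bar> \<le> B" and \<epsilon>: "0 < \<epsilon>"
  shows "integrable lborel (\<lambda>z'. h z' * mollifier \<epsilon> (z - z'))"
proof -
  have "continuous_on UNIV (mollifier \<epsilon> :: 'a \<Rightarrow> real)" using mollifier_C_k[of 0 \<epsilon>] by simp
  then obtain C where C: "\<And>z :: 'a. \<bar>mollifier \<epsilon> z\<bar> \<le> C"
    using continuous_compact_support_bounded[of "mollifier \<epsilon> :: 'a \<Rightarrow> real" \<epsilon>] mollifier_eq_0[OF \<epsilon> less_imp_le] by blast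
  show ?thesis by (rule conv_integrable[OF _ _ B C mollifier_eq_0[OF \<epsilon> less_imp_le]]) auto
qed

text \<open>A local form of Young's inequality for a kernel of mass 1. The radius grows from 1 to 2
  because the mollifier looks at points up to distance \<epsilon> \<le> 1.\<close>

lemma conv_mollifier_L1_le:
  fixes h :: "'a::euclidean_space \<Rightarrow> real"
  assumes [measurable]: "h \<in> borel_measurable borel" and B: "\<And>z. \<bar>h z\<bar> \<le> B" and \<epsilon>: "0 < \<epsilon>" "\<epsilon> \<le> 1"
  shows "(\<integral>\<^sup>+z. ennreal (indicator (cball 0 1) z * \<bar>conv h (mollifier \<epsilon>) z\<bar>) \<partial>lborel)
    \<le> (\<integral>\<^sup>+z. ennreal (indicator (cball 0 2) z * \<bar>h z\<bar>) \<partial>lborel)"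
proof -
  have nn: "0 \<le> mollifier \<epsilon> z" for z :: 'a using mollifier_nonneg[OF \<epsilon>(1)] .
  have "(\<integral>\<^sup>+z. ennreal (indicator (cball 0 1) z * \<bar>conv h (mollifier \<epsilon>) z\<bar>) \<partial>lborel)
    \<le> (\<integral>\<^sup>+z. \<integral>\<^sup>+z'. ennreal (indicator (cball 0 2) z' * \<bar>h z'\<bar>) * ennreal (mollifier \<epsilon> (z - z')) \<partial>lborel \<partial>lborel)"
  proof (rule nn_integral_mono)
    fix z :: 'a
    show "ennreal (indicator (cball 0 1) z * \<bar>conv h (mollifier \<epsilon>) z\<bar>) \<le>
      (\<integral>\<^sup>+z'. ennreal (indicator (cball 0 2) z' * \<bar>h z'\<bar>) * ennreal (mollifier \<epsilon> (z - z')) \<partial>lborel)"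
    proof (cases "z \<in> cball 0 1")
      case True
      have "ennreal (norm (conv h (mollifier \<epsilon>) z)) \<le> (\<integral>\<^sup>+z'. ennreal (norm (h z' * mollifier \<epsilon> (z - z'))) \<partial>lborel)"
        unfolding conv_def by (rule integral_norm_bound_ennreal[OF conv_mollifier_integrable[OF _ B \<epsilon>(1)]]) auto
      also have "\<dots> \<le> (\<integral>\<^sup>+z'. ennreal (indicator (cball 0 2) z' * \<bar>h z'\<bar>) * ennreal (mollifier \<epsilon> (z - z')) \<partial>lborel)"
      proof (rule nn_integral_mono)
        fix z' :: 'a
        show "ennreal (norm (h z' * mollifier \<epsilon> (z - z'))) \<le> ennreal (indicator (cball 0 2) z' * \<bar>h z'\<bar>) * ennreal (mollifier \<epsilon> (z - z'))"
        proof (cases "z' \<in> cball 0 2")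
          case True
          then show ?thesis using nn by (simp add: abs_mult ennreal_mult)
        next
          case False
          have "\<epsilon> \<le> norm (z - z')"
            using False \<open>z \<in> cball 0 1\<close> \<epsilon> norm_triangle_ineq2[of z' z]
            by (simp add: norm_minus_commute)
          then have "mollifier \<epsilon> (z - z') = 0" by (rule mollifier_eq_0[OF \<epsilon>(1)])
          then show ?thesis by simp
        qed
      qed
      finally show ?thesis using True by simp
    qed simp
  qed
  also have "\<dots> = (\<integral>\<^sup>+z'. \<integral>\<^sup>+z. ennreal (indicator (cball 0 2) z' * \<bar>h z'\<bar>) * ennreal (mollifier \<epsilon> (z - z')) \<partial>lborel \<partial>lborel)"
    by (rule lborel_pair.Fubini') measurable
  also have "\<dots> = (\<integral>\<^sup>+z'. ennreal (indicator (cball 0 2) z' * \<bar>h z'\<bar>) \<partial>lborel)"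
    by (subst nn_integral_cmult) (simp_all add: nn_integral_mollifier[OF \<epsilon>(1)])
  finally show ?thesis .
qed

text \<open>A Lebesgue measurable function is an almost everywhere limit of continuous ones.
  Truncating these at height A supplies the dominating function on the bounded ball.\<close>

lemma continuous_L1_approximation:
  fixes U :: "'a::euclidean_space \<Rightarrow> real"
  assumes [measurable]: "U \<in> borel_measurable borel" and U: "\<And>z. \<bar>U z\<bar> \<le> A" and e: "0 < e"
  shows "\<exists>\<phi>. continuous_on UNIV \<phi> \<and> (\<forall>z. \<bar>\<phi> z\<bar> \<le> A) \<and>
    (\<integral>\<^sup>+z. ennreal (indicator (cball 0 2) z * \<bar>U z - \<phi> z\<bar>) \<partial>lborel) < ennreal e"
proof -
  have A: "0 \<le> A" using U[of 0] by simp
  have "U measurable_on UNIV"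
    by (rule lebesgue_measurable_imp_measurable_on) (auto intro: measurable_completion)
  then obtain N g where N: "negligible N" and g: "\<And>n. continuous_on UNIV (g n)"
     and lim: "\<And>z. z \<notin> N \<Longrightarrow> (\<lambda>n. g n z) \<longlonglongrightarrow> U z"
    unfolding measurable_on_def by auto
  define \<phi> where "\<phi> = (\<lambda>n z. max (- A) (min A (g n z)))"
  have \<phi>c: "continuous_on UNIV (\<phi> n)" for n unfolding \<phi>_def by (intro continuous_intros g)
  then have [measurable]: "\<phi> n \<in> borel_measurable borel" for n by (rule borel_measurable_continuous_onI)
  have \<phi>A: "\<bar>\<phi> n z\<bar> \<le> A" for n z using A by (auto simp: \<phi>_def)
  have AE: "AE z in lborel. (\<lambda>n. \<phi> n z) \<longlonglongrightarrow> U z"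
  proof -
    have "AE z in lebesgue. z \<notin> N" using N by (simp add: negligible_iff_null_sets AE_not_in)
    then have "AE z in lborel. z \<notin> N" by (simp add: AE_completion_iff)
    then show ?thesis
    proof eventually_elim
      fix z assume "z \<notin> N"
      then have "(\<lambda>n. max (- A) (min A (g n z))) \<longlonglongrightarrow> max (- A) (min A (U z))"
        by (intro tendsto_max tendsto_min tendsto_const lim)
      moreover have "max (- A) (min A (U z)) = U z" using U[of z] by (auto simp: max_def min_def)
      ultimately show "(\<lambda>n. \<phi> n z) \<longlonglongrightarrow> U z" by (simp add: \<phi>_def)
    qed
  qed
  have fin: "integrable lborel (\<lambda>z :: 'a. indicator (cball 0 2) z * (2 * A))"
    by (intro integrable_mult_left integrable_real_indicator) (use emeasure_bounded_finite[OF bounded_cball, of "0::'a" 2] in auto)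
  have "(\<lambda>n. \<integral>z. indicator (cball 0 2) z * \<bar>U z - \<phi> n z\<bar> \<partial>lborel) \<longlonglongrightarrow> (\<integral>z. (0 :: real) \<partial>(lborel :: 'a measure))"
  proof (rule integral_dominated_convergence[OF _ _ fin])
    show "AE z in lborel. (\<lambda>n. indicator (cball 0 2) z * \<bar>U z - \<phi> n z\<bar>) \<longlonglongrightarrow> 0"
      using AE
    proof eventually_elim
      fix z assume "(\<lambda>n. \<phi> n z) \<longlonglongrightarrow> U z"
      then have "(\<lambda>n. indicator (cball 0 2) z * \<bar>U z - \<phi> n z\<bar>) \<longlonglongrightarrow> indicator (cball 0 2) z * \<bar>U z - U z\<bar>"
        by (intro tendsto_intros)
      then show "(\<lambda>n. indicator (cball 0 2) z * \<bar>U z - \<phi> n z\<bar>) \<longlonglongrightarrow> 0" by simp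
    qed
    show "AE z in lborel. norm (indicator (cball 0 2) z * \<bar>U z - \<phi> n z\<bar>) \<le> indicator (cball 0 2) z * (2 * A)" for n
    proof (rule AE_I2)
      fix z :: 'a
      have "\<bar>U z - \<phi> n z\<bar> \<le> 2 * A" using U[of z] \<phi>A[of n z] by linarith
      then show "norm (indicator (cball 0 2) z * \<bar>U z - \<phi> n z\<bar>) \<le> indicator (cball 0 2) z * (2 * A)"
        by (simp add: indicator_def)
    qed
  qed auto
  then have "eventually (\<lambda>n. (\<integral>z. indicator (cball 0 2) z * \<bar>U z - \<phi> n z\<bar> \<partial>lborel) < e) sequentially"
    using e by (intro order_tendstoD) auto
  then obtain n where n: "(\<integral>z. indicator (cball 0 2) z * \<bar>U z - \<phi> n z\<bar> \<partial>lborel) < e"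
    by (auto simp: eventually_sequentially)
  have "integrable lborel (\<lambda>z. indicator (cball 0 2) z * \<bar>U z - \<phi> n z\<bar>)"
  proof (rule Bochner_Integration.integrable_bound[OF fin])
    show "AE z in lborel. norm (indicator (cball 0 2) z * \<bar>U z - \<phi> n z\<bar>) \<le> norm (indicator (cball 0 2) z * (2 * A))"
    proof (rule AE_I2)
      fix z :: 'a
      have "\<bar>U z - \<phi> n z\<bar> \<le> 2 * A" using U[of z] \<phi>A[of n z] by linarith
      then show "norm (indicator (cball 0 2) z * \<bar>U z - \<phi> n z\<bar>) \<le> norm (indicator (cball 0 2) z * (2 * A))"
        using A by (simp add: indicator_def)
    qed
  qed measurable
  then have "(\<integral>\<^sup>+z. ennreal (indicator (cball 0 2) z * \<bar>U z - \<phi> n z\<bar>) \<partial>lborel) = ennreal (\<integral>z. indicator (cball 0 2) z * \<bar>U z - \<phi> n z\<bar> \<partial>lborel)"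
    by (intro nn_integral_eq_integral) auto
  also have "\<dots> < ennreal e" using n e by (simp add: ennreal_lessI)
  finally show ?thesis using \<phi>c \<phi>A by blast
qed

lemma conv_mollifier_near:
  fixes \<phi> :: "'a::euclidean_space \<Rightarrow> real"
  assumes cont: "continuous_on UNIV \<phi>" and B: "\<And>z. \<bar>\<phi> z\<bar> \<le> B" and e: "0 < e"
  shows "\<exists>d>0. \<forall>\<epsilon> z. 0 < \<epsilon> \<longrightarrow> \<epsilon> < d \<longrightarrow> z \<in> cball 0 1 \<longrightarrow> \<bar>conv \<phi> (mollifier \<epsilon>) z - \<phi> z\<bar> \<le> e"
proof -
  have "uniformly_continuous_on (cball 0 2) \<phi>"
    by (intro compact_uniformly_continuous continuous_on_subset[OF cont]) auto
  then obtain d0 where d0: "0 < d0" "\<And>z z'. z \<in> cball 0 2 \<Longrightarrow> z' \<in> cball 0 2 \<Longrightarrow> dist z' z < d0 \<Longrightarrow> \<bar>\<phi> z' - \<phi> z\<bar> < e"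
    unfolding uniformly_continuous_on_def dist_real_def using e by metis
  have [measurable]: "\<phi> \<in> borel_measurable borel" using cont by (rule borel_measurable_continuous_onI)
  show ?thesis
  proof (intro exI[of _ "min d0 1"] conjI allI impI)
    fix \<epsilon> and z :: 'a assume \<epsilon>: "0 < \<epsilon>" "\<epsilon> < min d0 1" and z: "z \<in> cball 0 1"
    note M = mollifier_has_integral[OF \<epsilon>(1), of z]
    have i: "integrable lborel (\<lambda>z'. \<phi> z' * mollifier \<epsilon> (z - z'))"
      by (rule conv_mollifier_integrable[OF _ B \<epsilon>(1)]) simp
    have iM: "integrable lborel (\<lambda>z'. c * mollifier \<epsilon> (z - z'))" for c using M
      by (simp add: has_bochner_integral_iff)
    have "conv \<phi> (mollifier \<epsilon>) z - \<phi> z = (\<integral>z'. \<phi> z' * mollifier \<epsilon> (z - z') - \<phi> z * mollifier \<epsilon> (z - z') \<partial>lborel)"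
      unfolding conv_def using i iM[of "\<phi> z"] M by (simp add: has_bochner_integral_iff)
    also have "\<bar>\<dots>\<bar> \<le> (\<integral>z'. \<bar>\<phi> z' * mollifier \<epsilon> (z - z') - \<phi> z * mollifier \<epsilon> (z - z')\<bar> \<partial>lborel)"
      by (rule integral_abs_bound)
    also have "\<dots> \<le> (\<integral>z'. e * mollifier \<epsilon> (z - z') \<partial>lborel)"
    proof (rule integral_mono[OF _ iM])
      show "integrable lborel (\<lambda>z'. \<bar>\<phi> z' * mollifier \<epsilon> (z - z') - \<phi> z * mollifier \<epsilon> (z - z')\<bar>)"
        using i iM by (intro integrable_abs Bochner_Integration.integrable_diff)
      fix z' :: 'a
      show "\<bar>\<phi> z' * mollifier \<epsilon> (z - z') - \<phi> z * mollifier \<epsilon> (z - z')\<bar> \<le> e * mollifier \<epsilon> (z - z')"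
      proof (cases "norm (z - z') < \<epsilon>")
        case True
        have "norm z' \<le> 2" using True \<epsilon> z norm_triangle_ineq2[of z' z] by (simp add: norm_minus_commute)
        then have "\<bar>\<phi> z' - \<phi> z\<bar> \<le> e"
          using d0(2)[of z z'] z True \<epsilon> by (simp add: dist_norm norm_minus_commute)
        then have "\<bar>\<phi> z' - \<phi> z\<bar> * mollifier \<epsilon> (z - z') \<le> e * mollifier \<epsilon> (z - z')"
          using mollifier_nonneg[OF \<epsilon>(1)] by (intro mult_right_mono) auto
        then show ?thesis using mollifier_nonneg[OF \<epsilon>(1), of "z - z'"]
          by (simp add: left_diff_distrib[symmetric] abs_mult)
      next
        case False
        then show ?thesis using mollifier_eq_0[OF \<epsilon>(1), of "z - z'"] by simp
      qed
    qed
    also have "\<dots> = e" using M by (simp add: has_bochner_integral_iff)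
    finally show "\<bar>conv \<phi> (mollifier \<epsilon>) z - \<phi> z\<bar> \<le> e" .
  qed (use d0 in auto)
qed

text \<open>U is replaced by a continuous \<phi>, whose mollifications converge uniformly on the
  ball; the difference U - \<phi> is small in L1 both before and after mollification.\<close>

lemma conv_mollifier_L1_tendsto:
  fixes U :: "'a::euclidean_space \<Rightarrow> real"
  assumes Um [measurable]: "U \<in> borel_measurable borel" and U: "\<And>z. \<bar>U z\<bar> \<le> A"
    and \<epsilon>: "\<And>n. 0 < \<epsilon> n" "\<epsilon> \<longlonglongrightarrow> 0"
  shows "(\<lambda>n. \<integral>z. norm (indicator (cball 0 1) z * (conv U (mollifier (\<epsilon> n)) z - U z)) \<partial>lborel) \<longlonglongrightarrow> 0"
    and "integrable lborel (\<lambda>z. indicator (cball 0 1) z * (conv U (mollifier (\<epsilon> n)) z - U z))"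
proof -
  note cm [measurable] = conv_mollifier_measurable
  have A: "0 \<le> A" using U[of 0] by simp
  have fin: "integrable lborel (\<lambda>z :: 'a. indicator (cball 0 1) z * c)" for c :: real
    by (intro integrable_mult_left integrable_real_indicator) (use emeasure_bounded_finite[OF bounded_cball, of "0::'a" 1] in auto)
  show int: "integrable lborel (\<lambda>z. indicator (cball 0 1) z * (conv U (mollifier (\<epsilon> n)) z - U z))" for n
  proof (rule Bochner_Integration.integrable_bound[OF fin])
    show "AE z in lborel. norm (indicator (cball 0 1) z * (conv U (mollifier (\<epsilon> n)) z - U z)) \<le> norm (indicator (cball 0 1) z * (2 * A))"
    proof (rule AE_I2)
      fix z :: 'a
      have "\<bar>conv U (mollifier (\<epsilon> n)) z - U z\<bar> \<le> 2 * A"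
        using U[of z] abs_conv_mollifier_le[OF Um U \<epsilon>(1), of n z] by linarith
      then show "norm (indicator (cball 0 1) z * (conv U (mollifier (\<epsilon> n)) z - U z)) \<le> norm (indicator (cball 0 1) z * (2 * A))"
        using A by (simp add: indicator_def)
    qed
  qed measurable
  define V where "V = measure lborel (cball (0::'a) 1)"
  show "(\<lambda>n. \<integral>z. norm (indicator (cball 0 1) z * (conv U (mollifier (\<epsilon> n)) z - U z)) \<partial>lborel) \<longlonglongrightarrow> 0"
  proof (rule LIMSEQ_I)
    fix r :: real assume r: "0 < r"
    \<comment> \<open>The three errors are e for the mollified difference, V e for the uniform
      convergence and e for the difference itself; the extra 1 in the denominator is slack.\<close>
    define e where "e = r / (2 * (2 + V + 1))"
    have V: "0 \<le> V" by (simp add: V_def)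
    have e: "0 < e" using r V by (simp add: e_def)
    obtain \<phi> where \<phi>: "continuous_on UNIV \<phi>" "\<And>z. \<bar>\<phi> z\<bar> \<le> A"
      "(\<integral>\<^sup>+z. ennreal (indicator (cball 0 2) z * \<bar>U z - \<phi> z\<bar>) \<partial>lborel) < ennreal e"
      using continuous_L1_approximation[OF Um U e] by (elim exE conjE) simp
    have [measurable]: "\<phi> \<in> borel_measurable borel" using \<phi>(1) by (rule borel_measurable_continuous_onI)
    obtain d where d: "0 < d" "\<And>\<epsilon> z. 0 < \<epsilon> \<Longrightarrow> \<epsilon> < d \<Longrightarrow> z \<in> cball 0 1 \<Longrightarrow> \<bar>conv \<phi> (mollifier \<epsilon>) z - \<phi> z\<bar> \<le> e"
      using conv_mollifier_near[OF \<phi>(1,2) e] by (elim exE conjE) simp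
    have "eventually (\<lambda>n. \<epsilon> n < min d 1) sequentially" using \<epsilon>(2) d by (intro order_tendstoD) auto
    then obtain n0 where n0: "\<And>n. n0 \<le> n \<Longrightarrow> \<epsilon> n < min d 1"
      by (auto simp: eventually_sequentially)
    show "\<exists>n0. \<forall>n\<ge>n0. norm ((\<integral>z. norm (indicator (cball 0 1) z * (conv U (mollifier (\<epsilon> n)) z - U z)) \<partial>lborel) - 0) < r"
    proof (intro exI[of _ n0] allI impI)
      fix n assume "n0 \<le> n"
      then have en: "\<epsilon> n < d" "\<epsilon> n \<le> 1" using n0[of n] by auto
      have b2: "\<bar>U z - \<phi> z\<bar> \<le> 2 * A" for z using U[of z] \<phi>(2)[of z] by linarith
      have iU: "integrable lborel (\<lambda>z'. U z' * mollifier (\<epsilon> n) (z - z'))" for z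
        by (rule conv_mollifier_integrable[OF _ U \<epsilon>(1)]) simp
      have i\<phi>: "integrable lborel (\<lambda>z'. \<phi> z' * mollifier (\<epsilon> n) (z - z'))" for z
        by (rule conv_mollifier_integrable[OF _ \<phi>(2) \<epsilon>(1)]) simp
      have lin: "conv (\<lambda>z. U z - \<phi> z) (mollifier (\<epsilon> n)) z = conv U (mollifier (\<epsilon> n)) z - conv \<phi> (mollifier (\<epsilon> n)) z" for z
        unfolding conv_def using iU[of z] i\<phi>[of z] by (simp add: left_diff_distrib)
      have "ennreal (\<integral>z. norm (indicator (cball 0 1) z * (conv U (mollifier (\<epsilon> n)) z - U z)) \<partial>lborel)
         = (\<integral>\<^sup>+z. ennreal (norm (indicator (cball 0 1) z * (conv U (mollifier (\<epsilon> n)) z - U z))) \<partial>lborel)"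
        using int by (intro nn_integral_eq_integral[symmetric] integrable_norm) auto
      also have "\<dots> \<le> (\<integral>\<^sup>+z. ennreal (indicator (cball 0 1) z * \<bar>conv (\<lambda>z. U z - \<phi> z) (mollifier (\<epsilon> n)) z\<bar>)
          + (ennreal (indicator (cball 0 1) z * e) + ennreal (indicator (cball 0 2) z * \<bar>U z - \<phi> z\<bar>)) \<partial>lborel)"
      proof (rule nn_integral_mono)
        fix z :: 'a
        show "ennreal (norm (indicator (cball 0 1) z * (conv U (mollifier (\<epsilon> n)) z - U z)))
          \<le> ennreal (indicator (cball 0 1) z * \<bar>conv (\<lambda>z. U z - \<phi> z) (mollifier (\<epsilon> n)) z\<bar>)
          + (ennreal (indicator (cball 0 1) z * e) + ennreal (indicator (cball 0 2) z * \<bar>U z - \<phi> z\<bar>))"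
        proof (cases "z \<in> cball 0 1")
          case True
          then have z2: "z \<in> cball 0 2" by auto
          have "\<bar>conv U (mollifier (\<epsilon> n)) z - U z\<bar> \<le> \<bar>conv (\<lambda>z. U z - \<phi> z) (mollifier (\<epsilon> n)) z\<bar> + (e + \<bar>U z - \<phi> z\<bar>)"
            using d(2)[OF \<epsilon>(1) en(1) True] unfolding lin by linarith
          then show ?thesis using True z2 e by (simp add: ennreal_plus[symmetric] ennreal_leI del: ennreal_plus)
        qed simp
      qed
      also have "\<dots> = (\<integral>\<^sup>+z. ennreal (indicator (cball 0 1) z * \<bar>conv (\<lambda>z. U z - \<phi> z) (mollifier (\<epsilon> n)) z\<bar>) \<partial>lborel)
          + ((\<integral>\<^sup>+z. ennreal (indicator (cball (0::'a) 1) z * e) \<partial>lborel) + (\<integral>\<^sup>+z. ennreal (indicator (cball 0 2) z * \<bar>U z - \<phi> z\<bar>) \<partial>lborel))"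
        by (simp add: nn_integral_add)
      also have "\<dots> \<le> ennreal e + (ennreal (V * e) + ennreal e)"
      proof (intro add_mono)
        show "(\<integral>\<^sup>+z. ennreal (indicator (cball 0 1) z * \<bar>conv (\<lambda>z. U z - \<phi> z) (mollifier (\<epsilon> n)) z\<bar>) \<partial>lborel) \<le> ennreal e"
          by (rule order_trans[OF conv_mollifier_L1_le[OF _ b2 \<epsilon>(1) en(2)] less_imp_le[OF \<phi>(3)]]) simp
        have "(\<integral>\<^sup>+z. ennreal (indicator (cball (0::'a) 1) z * e) \<partial>lborel) = ennreal (\<integral>z. indicator (cball (0::'a) 1) z * e \<partial>lborel)"
          using fin e by (intro nn_integral_eq_integral) auto
        then show "(\<integral>\<^sup>+z. ennreal (indicator (cball (0::'a) 1) z * e) \<partial>lborel) \<le> ennreal (V * e)" by (simp add: V_def)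
      qed (use \<phi>(3) in simp)
      also have "\<dots> = ennreal (e + (V * e + e))" using e V by (simp add: ennreal_plus[symmetric] del: ennreal_plus)
      finally have "(\<integral>z. norm (indicator (cball 0 1) z * (conv U (mollifier (\<epsilon> n)) z - U z)) \<partial>lborel) \<le> e + (V * e + e)"
        by (subst (asm) ennreal_le_iff) (use e V in auto)
      also have "\<dots> = (2 + V) * e" by (simp add: algebra_simps)
      also have "\<dots> < r"
      proof -
        have "(2 + V) * e \<le> (2 + V + 1) * e" using e by (intro mult_right_mono) auto
        also have "\<dots> = r / 2" using V by (simp add: e_def field_simps)
        finally show ?thesis using r by simp
      qed
      finally show "norm ((\<integral>z. norm (indicator (cball 0 1) z * (conv U (mollifier (\<epsilon> n)) z - U z)) \<partial>lborel) - 0) < r"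
        by simp
    qed
  qed
qed

lemma conv_mollifier_AE_subseq:
  fixes U :: "'a::euclidean_space \<Rightarrow> real"
  assumes Um: "U \<in> borel_measurable borel" and U: "\<And>z. \<bar>U z\<bar> \<le> A"
  shows "\<exists>\<epsilon>. (\<forall>n. 0 < \<epsilon> n) \<and> \<epsilon> \<longlonglongrightarrow> 0 \<and>
    (AE z in lborel. z \<in> cball 0 1 \<longrightarrow> (\<lambda>n. conv U (mollifier (\<epsilon> n)) z) \<longlonglongrightarrow> U z)"
proof -
  define \<epsilon> :: "nat \<Rightarrow> real" where "\<epsilon> = (\<lambda>n. 1 / Suc n)"
  have \<epsilon>: "0 < \<epsilon> n" "\<epsilon> \<longlonglongrightarrow> 0" for n
    using LIMSEQ_inverse_real_of_nat by (auto simp: \<epsilon>_def divide_inverse)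
  obtain r :: "nat \<Rightarrow> nat" where r: "strict_mono r"
    "AE z in lborel. (\<lambda>n. indicator (cball 0 1) z * (conv U (mollifier (\<epsilon> (r n))) z - U z)) \<longlonglongrightarrow> 0"
    using tendsto_L1_AE_subseq[OF conv_mollifier_L1_tendsto(2)[OF Um U \<epsilon>] conv_mollifier_L1_tendsto(1)[OF Um U \<epsilon>]] by auto
  show ?thesis
  proof (intro exI[of _ "\<epsilon> \<circ> r"] conjI allI)
    show "0 < (\<epsilon> \<circ> r) n" for n using \<epsilon> by simp
    show "(\<epsilon> \<circ> r) \<longlonglongrightarrow> 0" using LIMSEQ_subseq_LIMSEQ[OF \<epsilon>(2) r(1)] .
    show "AE z in lborel. z \<in> cball 0 1 \<longrightarrow> (\<lambda>n. conv U (mollifier ((\<epsilon> \<circ> r) n)) z) \<longlonglongrightarrow> U z"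
      using r(2)
    proof eventually_elim
      fix z assume *: "(\<lambda>n. indicator (cball 0 1) z * (conv U (mollifier (\<epsilon> (r n))) z - U z)) \<longlonglongrightarrow> 0"
      show "z \<in> cball 0 1 \<longrightarrow> (\<lambda>n. conv U (mollifier ((\<epsilon> \<circ> r) n)) z) \<longlonglongrightarrow> U z"
      proof
        assume "z \<in> cball 0 1"
        with * have "(\<lambda>n. conv U (mollifier (\<epsilon> (r n))) z - U z) \<longlonglongrightarrow> 0"
          by (simp del: mem_cball mem_cball_0)
        then show "(\<lambda>n. conv U (mollifier ((\<epsilon> \<circ> r) n)) z) \<longlonglongrightarrow> U z"
          by (simp add: LIM_zero_iff)
      qed
    qed
  qed
qed

section \<open>Hoelder norms\<close>

text \<open>The dyadic difference quotients 2^k (w(x + h/2^k) - w(x)) converge to F h. Consecutive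
  ones differ by a second difference times 2^k, hence by a geometric sequence of ratio
  2^(1-\<gamma>), and \<gamma> > 1 makes it summable.\<close>

lemma taylor_of_D2:
  fixes w :: "'a::real_normed_vector \<Rightarrow> real"
  assumes der: "(w has_derivative F) (at x)" and \<gamma>: "1 < \<gamma>" and H: "0 \<le> H"
    and D: "\<And>y k. norm (y - x) \<le> norm h \<Longrightarrow> norm k \<le> norm h \<Longrightarrow> \<bar>D2 w y k\<bar> \<le> H * norm k powr \<gamma>"
  shows "\<bar>w (x + h) - w x - F h\<bar> \<le> H / (1 - 2 powr (1 - \<gamma>)) * norm h powr \<gamma>"
proof -
  define q where "q = (2 :: real) powr (1 - \<gamma>)"
  have q: "0 < q" "q < 1" using \<gamma> powr_less_mono[of "1 - \<gamma>" 0 2] by (auto simp: q_def)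
  define a where "a = (\<lambda>k::nat. 2 ^ k * (w (x + (1 / 2 ^ k) *\<^sub>R h) - w x))"
  have step: "\<bar>a (Suc k) - a k\<bar> \<le> H * norm h powr \<gamma> * q ^ k" for k
  proof -
    define g where "g = (1 / 2 ^ Suc k) *\<^sub>R h"
    have g2: "(1 / 2 ^ k) *\<^sub>R h = g + g" by (simp add: g_def scaleR_add_left[symmetric])
    have ng: "norm g = norm h / 2 ^ Suc k" by (simp add: g_def)
    have "(1::real) \<le> 2 ^ Suc k" by (rule one_le_power) simp
    then have ngh: "norm g \<le> norm h" unfolding ng by (simp add: divide_le_eq mult_le_cancel_left1 del: power_Suc)
    have "a (Suc k) - a k = - (2 ^ k * D2 w (x + g) g)"
      unfolding a_def g2 g_def[symmetric] D2_def by (simp add: algebra_simps)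
    then have "\<bar>a (Suc k) - a k\<bar> = 2 ^ k * \<bar>D2 w (x + g) g\<bar>" by (simp add: abs_mult)
    also have "\<dots> \<le> 2 ^ k * (H * norm g powr \<gamma>)" using D[of "x + g" g] ngh by simp
    also have "norm g powr \<gamma> = norm h powr \<gamma> * (2 powr (- \<gamma>)) ^ Suc k"
    proof -
      have "(2 ^ Suc k) powr \<gamma> = (2 powr \<gamma> :: real) ^ Suc k"
        by (simp only: powr_realpow[symmetric] zero_less_numeral powr_powr powr_gt_zero) (simp add: mult.commute)
      then show ?thesis unfolding ng
        by (simp only: powr_divide powr_minus) (simp add: field_simps)
    qed
    also have "2 ^ k * (H * (norm h powr \<gamma> * (2 powr (- \<gamma>)) ^ Suc k)) = 2 powr (- \<gamma>) * (H * norm h powr \<gamma> * q ^ k)"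
    proof -
      have "q = 2 * 2 powr (- \<gamma>)" by (simp add: q_def powr_diff powr_minus field_simps)
      then show ?thesis by (simp add: power_mult_distrib algebra_simps)
    qed
    also have "\<dots> \<le> 1 * (H * norm h powr \<gamma> * q ^ k)"
      using \<gamma> H q powr_mono[of "- \<gamma>" 0 2] by (intro mult_right_mono) auto
    finally show ?thesis by simp
  qed
  have bound: "\<bar>a n - a 0\<bar> \<le> H * norm h powr \<gamma> / (1 - q)" for n
  proof -
    have "\<bar>a n - a 0\<bar> \<le> (\<Sum>k<n. H * norm h powr \<gamma> * q ^ k)"
    proof (induction n)
      case (Suc n)
      then show ?case using step[of n] by simp
    qed simp
    also have "\<dots> = H * norm h powr \<gamma> * ((1 - q ^ n) / (1 - q))"
      using q by (simp add: sum_distrib_left[symmetric] sum_gp_strict)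
    also have "\<dots> \<le> H * norm h powr \<gamma> * (1 / (1 - q))"
      using q H by (intro mult_left_mono divide_right_mono) auto
    finally show ?thesis by simp
  qed
  have "a \<longlonglongrightarrow> F h"
  proof (cases "h = 0")
    case True
    then show ?thesis using linear_0[OF has_derivative_linear[OF der]] by (simp add: a_def)
  next
    case False
    have lin: "linear F" using has_derivative_linear[OF der] .
    have lim: "((\<lambda>k. norm (w (x + k) - w x - F k) / norm k) \<longlongrightarrow> 0) (at 0)"
      using der unfolding has_derivative_at by simp
    have "filterlim (\<lambda>k::nat. (1 / 2 ^ k) *\<^sub>R h) (at 0) sequentially"
      unfolding filterlim_at
    proof
      show "eventually (\<lambda>k. (1 / 2 ^ k) *\<^sub>R h \<in> UNIV \<and> (1 / 2 ^ k) *\<^sub>R h \<noteq> 0) sequentially" using False by simp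
      have "(\<lambda>k. (1 / 2 :: real) ^ k *\<^sub>R h) \<longlonglongrightarrow> 0 *\<^sub>R h"
        by (intro tendsto_scaleR LIMSEQ_realpow_zero tendsto_const) auto
      then show "(\<lambda>k. (1 / 2 ^ k) *\<^sub>R h) \<longlonglongrightarrow> 0" by (simp add: power_one_over)
    qed
    from filterlim_compose[OF lim this]
    have "(\<lambda>k. norm (w (x + (1 / 2 ^ k) *\<^sub>R h) - w x - F ((1 / 2 ^ k) *\<^sub>R h)) / norm ((1 / 2 ^ k) *\<^sub>R h)) \<longlonglongrightarrow> 0" .
    moreover have "norm (w (x + (1 / 2 ^ k) *\<^sub>R h) - w x - F ((1 / 2 ^ k) *\<^sub>R h)) / norm ((1 / 2 ^ k) *\<^sub>R h) = \<bar>a k - F h\<bar> / norm h" for k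
    proof -
      have "a k - F h = 2 ^ k * (w (x + (1 / 2 ^ k) *\<^sub>R h) - w x - F ((1 / 2 ^ k) *\<^sub>R h))"
        unfolding a_def linear_scale[OF lin] by (simp add: algebra_simps)
      then show ?thesis unfolding \<open>a k - F h = _\<close> abs_mult by simp
    qed
    ultimately have "(\<lambda>k. \<bar>a k - F h\<bar> / norm h) \<longlonglongrightarrow> 0" by (simp only:)
    then have "(\<lambda>k. \<bar>a k - F h\<bar> / norm h * norm h) \<longlonglongrightarrow> 0 * norm h"
      by (intro tendsto_mult tendsto_const)
    then show ?thesis using False by (simp add: LIM_zero_iff tendsto_rabs_zero_iff)
  qed
  then have "(\<lambda>n. \<bar>a n - a 0\<bar>) \<longlonglongrightarrow> \<bar>F h - a 0\<bar>" by (intro tendsto_intros)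
  then have "\<bar>F h - a 0\<bar> \<le> H * norm h powr \<gamma> / (1 - q)"
    by (rule LIMSEQ_le_const2) (use bound in auto)
  then show ?thesis by (simp add: a_def q_def abs_minus_commute)
qed

lemma holder_continuous_on:
  fixes g :: "'a::real_normed_vector \<Rightarrow> real"
  assumes \<alpha>: "0 < \<alpha>" and B: "\<And>x y. x \<in> D \<Longrightarrow> y \<in> D \<Longrightarrow> \<bar>g x - g y\<bar> \<le> B * norm (x - y) powr \<alpha>"
  shows "continuous_on D g"
  unfolding continuous_on_def
proof
  fix x assume x: "x \<in> D"
  have "((\<lambda>y. B * norm (y - x) powr \<alpha>) \<longlongrightarrow> B * 0 powr \<alpha>) (at x within D)"
    using \<alpha> by (intro tendsto_mult tendsto_const tendsto_powr') (auto intro!: tendsto_eq_intros eventually_at_topological[THEN iffD2] exI[of _ UNIV])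
  then have "((\<lambda>y. B * norm (y - x) powr \<alpha>) \<longlongrightarrow> 0) (at x within D)" by simp
  then have "((\<lambda>y. g y - g x) \<longlongrightarrow> 0) (at x within D)"
    by (rule Lim_null_comparison[rotated]) (use B[OF _ x] in \<open>auto simp: eventually_at_topological\<close>)
  then show "(g \<longlongrightarrow> g x) (at x within D)" by (simp add: LIM_zero_iff)
qed

lemma holder_seminorm_le:
  assumes "\<And>x y. x \<in> D \<Longrightarrow> y \<in> D \<Longrightarrow> x \<noteq> y \<Longrightarrow> \<bar>g x - g y\<bar> \<le> B * norm (x - y) powr \<alpha>"
  shows "holder_seminorm \<alpha> D g \<le> ennreal B"
  unfolding holder_seminorm_def
proof (intro SUP_least ennreal_leI)
  fix x y assume "x \<in> D" "y \<in> D - {x}"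
  then show "\<bar>g x - g y\<bar> / dist x y powr \<alpha> \<le> B"
    using assms[of x y] by (auto simp: dist_norm divide_le_eq)
qed

lemma holder_norm_le_0:
  fixes g :: "'a::euclidean_space \<Rightarrow> real"
  assumes \<alpha>: "0 < \<alpha>" "\<alpha> < 1" and A: "\<And>x. x \<in> D \<Longrightarrow> \<bar>g x\<bar> \<le> A" "0 \<le> A" "0 \<le> B"
    and B: "\<And>x y. x \<in> D \<Longrightarrow> y \<in> D \<Longrightarrow> \<bar>g x - g y\<bar> \<le> B * norm (x - y) powr \<alpha>"
  shows "holder_norm \<alpha> D g \<le> ennreal (A + B)"
proof -
  have fl: "nat \<lfloor>\<alpha>\<rfloor> = 0" using \<alpha> by (simp add: floor_eq_iff)
  have empty: "{bs :: 'a list. set bs \<subseteq> Basis \<and> bs = []} = {[]}" by auto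
  have "(SUP x\<in>D. ennreal \<bar>g x\<bar>) \<le> ennreal A" using A by (intro SUP_least ennreal_leI)
  moreover have "holder_seminorm \<alpha> D g \<le> ennreal B" by (rule holder_seminorm_le) (use B in auto)
  ultimately have "(SUP x\<in>D. ennreal \<bar>g x\<bar>) + holder_seminorm \<alpha> D g \<le> ennreal (A + B)"
    using A by (simp add: add_mono)
  then show ?thesis
    using holder_continuous_on[OF \<alpha>(1) B] by (simp add: holder_norm_def Let_def fl empty)
qed

text \<open>Uniform Taylor expansions identify p x as the gradient and make it Hoelder continuous:
  subtract the expansions at x and y evaluated at a common third point. The hypothesis has order
  \<gamma> strictly above \<gamma>0, so the gradient is continuous even for \<gamma>0 = 1, where the
  seminorm is only an oscillation.\<close>

lemma holder_norm_le_1: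
  fixes g :: "'a::euclidean_space \<Rightarrow> real"
  assumes \<gamma>: "1 \<le> \<gamma>0" "\<gamma>0 < \<gamma>" "\<gamma> < 2" and r: "0 < r" and d: "0 < d" "d \<le> 1"
    and A: "\<And>x. x \<in> ball 0 r \<Longrightarrow> \<bar>g x\<bar> \<le> A" "0 \<le> A"
    and T: "\<And>x. x \<in> ball 0 (r + d) \<Longrightarrow> \<exists>p. norm p \<le> P \<and>
      (\<forall>y\<in>ball 0 (r + d). norm (y - x) \<le> 2 * d \<longrightarrow> \<bar>g y - g x - p \<bullet> (y - x)\<bar> \<le> P * norm (y - x) powr \<gamma>)"
  shows "holder_norm \<gamma>0 (ball 0 r) g \<le> ennreal (A + (1 + 6 + 2 / d) * P)"
proof -
  obtain p where p: "\<And>x. x \<in> ball 0 (r + d) \<Longrightarrow> norm (p x) \<le> P"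
    and T: "\<And>x y. x \<in> ball 0 (r + d) \<Longrightarrow> y \<in> ball 0 (r + d) \<Longrightarrow> norm (y - x) \<le> 2 * d \<Longrightarrow>
      \<bar>g y - g x - p x \<bullet> (y - x)\<bar> \<le> P * norm (y - x) powr \<gamma>"
    using T by metis
  have P: "0 \<le> P" using p[of 0] r d by (simp add: order_trans[OF norm_ge_zero])
  have sub: "x \<in> ball 0 (r + d)" if "x \<in> ball 0 r" for x :: 'a using that d by auto
  have der: "(g has_derivative (\<lambda>h. p x \<bullet> h)) (at x)" if x: "x \<in> ball 0 (r + d)" for x
    unfolding has_derivative_at
  proof
    show "bounded_linear (\<lambda>h. p x \<bullet> h)" by (rule bounded_linear_inner_right)
    define e where "e = min (2 * d) (r + d - norm x)"
    have e: "0 < e" using x d by (simp add: e_def)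
    show "(\<lambda>h. norm (g (x + h) - g x - p x \<bullet> h) / norm h) \<midarrow>0\<rightarrow> 0"
    proof (rule Lim_null_comparison)
      show "eventually (\<lambda>h. norm (norm (g (x + h) - g x - p x \<bullet> h) / norm h) \<le> P * norm h powr (\<gamma> - 1)) (at 0)"
        unfolding eventually_at
      proof (intro exI[of _ e] conjI e ballI impI)
        fix h :: 'a assume "h \<noteq> 0 \<and> dist h 0 < e"
        then have h: "0 < norm h" "norm h \<le> 2 * d" "norm h < r + d - norm x" by (auto simp: e_def)
        have "x + h \<in> ball 0 (r + d)" using h norm_triangle_ineq[of x h] by simp
        from T[OF x this] h(2) have "\<bar>g (x + h) - g x - p x \<bullet> h\<bar> \<le> P * norm h powr \<gamma>" by simp
        also have "norm h powr \<gamma> = norm h powr (\<gamma> - 1) * norm h" using h by (simp add: powr_diff)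
        finally show "norm (norm (g (x + h) - g x - p x \<bullet> h) / norm h) \<le> P * norm h powr (\<gamma> - 1)"
          using h by (simp add: divide_le_eq mult.assoc)
      qed
      have "((\<lambda>h :: 'a. P * norm h powr (\<gamma> - 1)) \<longlongrightarrow> P * 0 powr (\<gamma> - 1)) (at 0)"
        using \<gamma> by (intro tendsto_mult tendsto_const tendsto_powr') (auto intro!: tendsto_eq_intros)
      then show "((\<lambda>h :: 'a. P * norm h powr (\<gamma> - 1)) \<longlongrightarrow> 0) (at 0)" by simp
    qed
  qed
  have fd: "frechet_derivative g (at x) = (\<lambda>h. p x \<bullet> h)" if "x \<in> ball 0 (r + d)" for x
    using der[OF that] by (rule frechet_derivative_at[symmetric])
  have pb: "\<bar>p x \<bullet> b\<bar> \<le> P" if "x \<in> ball 0 (r + d)" "b \<in> Basis" for x b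
    using p[OF that(1)] Basis_le_norm[OF that(2), of "p x"] by linarith
  \<comment> \<open>The exponent is left free because it is used at \<gamma> - 1 for continuity and
    at \<gamma>0 - 1 for the seminorm. The constant 6 = 1 + 4 + 1 sums three Taylor remainders, one
    of them at distance up to twice |x - y|; the summand 2/d covers points farther apart than
    d.\<close>
  have hol: "\<bar>p x \<bullet> b - p y \<bullet> b\<bar> \<le> (6 + 2 / d) * P * norm (x - y) powr \<alpha>"
    if x: "x \<in> ball 0 r" and y: "y \<in> ball 0 r" and b: "b \<in> Basis" and xy: "x \<noteq> y" and \<alpha>: "0 \<le> \<alpha>" "\<alpha> \<le> \<gamma> - 1" for x y b \<alpha>
  proof -
    define \<delta> where "\<delta> = norm (x - y)"
    have \<delta>: "0 < \<delta>" using xy by (simp add: \<delta>_def)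
    show ?thesis
    proof (cases "\<delta> < d")
      case True
      \<comment> \<open>The third point y + h lies at distance |x - y| from y in the coordinate
        direction b; this balances the remainders against the difference of the two gradients along
        b.\<close>
      define h where "h = \<delta> *\<^sub>R b"
      have nh: "norm h = \<delta>" using b \<delta> by (simp add: h_def)
      have yh: "y + h \<in> ball 0 (r + d)" using y True nh norm_triangle_ineq[of y h] by simp
      have n1: "norm (y + h - x) \<le> 2 * \<delta>"
        using norm_triangle_ineq[of "y - x" h] nh by (simp add: \<delta>_def norm_minus_commute algebra_simps)
      have a1: "\<bar>g (y + h) - g y - p y \<bullet> h\<bar> \<le> P * \<delta> powr \<gamma>"
        using T[OF sub[OF y] yh] nh True d by simp
      have a2: "\<bar>g (y + h) - g x - p x \<bullet> (y + h - x)\<bar> \<le> P * norm (y + h - x) powr \<gamma>"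
        using T[OF sub[OF x] yh] n1 True by simp
      have a3: "\<bar>g y - g x - p x \<bullet> (y - x)\<bar> \<le> P * \<delta> powr \<gamma>"
        using T[OF sub[OF x] sub[OF y]] True d by (simp add: \<delta>_def norm_minus_commute)
      have "norm (y + h - x) powr \<gamma> \<le> (2 * \<delta>) powr \<gamma>" using n1 \<gamma> by (intro powr_mono2) auto
      also have "\<dots> = 2 powr \<gamma> * \<delta> powr \<gamma>" using \<delta> by (simp add: powr_mult)
      also have "\<dots> \<le> 4 * \<delta> powr \<gamma>"
        using \<gamma> powr_mono[of \<gamma> 2 2] by (intro mult_right_mono) auto
      finally have "P * norm (y + h - x) powr \<gamma> \<le> 4 * (P * \<delta> powr \<gamma>)"
        using P mult_left_mono by fastforce
      then have a2': "\<bar>g (y + h) - g x - p x \<bullet> (y + h - x)\<bar> \<le> 4 * (P * \<delta> powr \<gamma>)"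
        using a2 by linarith
      have "p x \<bullet> (y + h - x) = p x \<bullet> (y - x) + p x \<bullet> h" by (simp add: inner_simps)
      then have "\<bar>p x \<bullet> h - p y \<bullet> h\<bar> \<le> 6 * (P * \<delta> powr \<gamma>)"
        using a1 a2' a3 unfolding abs_le_iff by linarith
      moreover have "p x \<bullet> h - p y \<bullet> h = \<delta> * (p x \<bullet> b - p y \<bullet> b)"
        by (simp add: h_def algebra_simps)
      moreover have "\<delta> powr \<gamma> = \<delta> * \<delta> powr (\<gamma> - 1)"
        using \<delta> by (simp add: powr_diff)
      ultimately have "\<delta> * \<bar>p x \<bullet> b - p y \<bullet> b\<bar> \<le> \<delta> * (6 * P * \<delta> powr (\<gamma> - 1))"
        using \<delta> by (simp add: abs_mult mult_ac)
      then have "\<bar>p x \<bullet> b - p y \<bullet> b\<bar> \<le> 6 * P * \<delta> powr (\<gamma> - 1)"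
        using \<delta> by (rule mult_left_le_imp_le)
      also have "\<dots> \<le> 6 * P * \<delta> powr \<alpha>"
        using P \<delta> \<alpha> True d by (intro mult_left_mono powr_mono') auto
      also have "\<dots> \<le> (6 + 2 / d) * P * \<delta> powr \<alpha>" using P d by (intro mult_right_mono) auto
      finally show ?thesis by (simp add: \<delta>_def)
    next
      case False
      have "\<bar>p x \<bullet> b - p y \<bullet> b\<bar> \<le> 2 * P"
        using pb[OF sub[OF x] b] pb[OF sub[OF y] b] by linarith
      also have "\<dots> = (2 / d) * P * d" using d by simp
      also have "\<dots> \<le> (2 / d) * P * \<delta> powr \<alpha>"
      proof (rule mult_left_mono)
        have "d = d powr 1" using d by simp
        also have "\<dots> \<le> d powr \<alpha>" using d \<alpha> \<gamma> by (intro powr_mono') auto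
        also have "\<dots> \<le> \<delta> powr \<alpha>" using False d \<alpha> by (intro powr_mono2) auto
        finally show "d \<le> \<delta> powr \<alpha>" .
      qed (use P d in simp)
      also have "\<dots> \<le> (6 + 2 / d) * P * \<delta> powr \<alpha>" using P d by (intro mult_right_mono) auto
      finally show ?thesis by (simp add: \<delta>_def)
    qed
  qed
  have fl: "nat \<lfloor>\<gamma>0\<rfloor> = Suc 0" using \<gamma> by (simp add: floor_eq_iff nat_eq_iff)
  have single: "\<exists>b\<in>Basis. bs = [b]" if "set bs \<subseteq> (Basis :: 'a set)" "length bs = Suc 0" for bs
    using that by (cases bs) auto
  have "C_k_on (Suc 0) (ball 0 r) g"
  proof -
    have "continuous_on (ball 0 r) (\<lambda>x. frechet_derivative g (at x) b)" if b: "b \<in> Basis" for b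
    proof -
      have "continuous_on (ball 0 r) (\<lambda>x. p x \<bullet> b)"
      proof (rule holder_continuous_on)
        show "0 < \<gamma> - 1" using \<gamma> by simp
        show "\<bar>p x \<bullet> b - p y \<bullet> b\<bar> \<le> (6 + 2 / d) * P * norm (x - y) powr (\<gamma> - 1)" if "x \<in> ball 0 r" "y \<in> ball 0 r" for x y
          using hol[OF that b, of "\<gamma> - 1"] \<gamma> by (cases "x = y") auto
      qed
      then show ?thesis by (rule continuous_on_eq) (use fd sub in auto)
    qed
    moreover have "g differentiable (at x)" if "x \<in> ball 0 r" for x
      using der[OF sub[OF that]] unfolding differentiable_def by blast
    ultimately show ?thesis by simp
  qed
  then have "holder_norm \<gamma>0 (ball 0 r) g =
      (\<Sum>j\<le>Suc 0. SUP bs\<in>{bs. set bs \<subseteq> Basis \<and> length bs = j}. SUP x\<in>ball 0 r. ennreal \<bar>partial_deriv bs g x\<bar>)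
       + (SUP bs\<in>{bs. set bs \<subseteq> Basis \<and> length bs = Suc 0}.
            holder_seminorm (\<gamma>0 - real (Suc 0)) (ball 0 r) (partial_deriv bs g))"
    by (simp only: holder_norm_def Let_def fl if_True)
  also have "\<dots> \<le> (ennreal A + ennreal P) + ennreal ((6 + 2 / d) * P)"
  proof (intro add_mono)
    have "(SUP bs\<in>{bs. set bs \<subseteq> Basis \<and> length bs = 0}. SUP x\<in>ball 0 r. ennreal \<bar>partial_deriv bs g x\<bar>) \<le> ennreal A"
      using A by (intro SUP_least ennreal_leI) auto
    moreover have "(SUP bs\<in>{bs. set bs \<subseteq> Basis \<and> length bs = Suc 0}. SUP x\<in>ball 0 r. ennreal \<bar>partial_deriv bs g x\<bar>) \<le> ennreal P"
    proof (intro SUP_least ennreal_leI)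
      fix bs and x :: 'a assume bs: "bs \<in> {bs. set bs \<subseteq> (Basis :: 'a set) \<and> length bs = Suc 0}" and x: "x \<in> ball 0 r"
      then obtain b where b: "b \<in> Basis" "bs = [b]" using single by blast
      show "\<bar>partial_deriv bs g x\<bar> \<le> P" using fd[OF sub[OF x]] pb[OF sub[OF x] b(1)] b by simp
    qed
    ultimately show "(\<Sum>j\<le>Suc 0. SUP bs\<in>{bs. set bs \<subseteq> Basis \<and> length bs = j}. SUP x\<in>ball 0 r. ennreal \<bar>partial_deriv bs g x\<bar>)
      \<le> ennreal A + ennreal P"
      by (simp only: sum.atMost_Suc atMost_0 sum.insert finite.emptyI empty_iff not_False_eq_True sum.empty add_0_right) (rule add_mono)
    show "(SUP bs\<in>{bs. set bs \<subseteq> Basis \<and> length bs = Suc 0}.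
            holder_seminorm (\<gamma>0 - real (Suc 0)) (ball 0 r) (partial_deriv bs g)) \<le> ennreal ((6 + 2 / d) * P)"
    proof (rule SUP_least)
      fix bs assume bs: "bs \<in> {bs. set bs \<subseteq> (Basis :: 'a set) \<and> length bs = Suc 0}"
      then obtain b where b: "b \<in> Basis" "bs = [b]" using single by blast
      show "holder_seminorm (\<gamma>0 - real (Suc 0)) (ball 0 r) (partial_deriv bs g) \<le> ennreal ((6 + 2 / d) * P)"
        by (rule holder_seminorm_le) (use hol[OF _ _ b(1)] fd sub b \<gamma> in auto)
    qed
  qed
  also have "\<dots> = ennreal (A + (1 + 6 + 2 / d) * P)"
  proof -
    have "A + (1 + 6 + 2 / d) * P = (A + P) + (6 + 2 / d) * P" by (simp add: algebra_simps)
    moreover have "0 \<le> (6 + 2 / d) * P" using P d by simp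
    ultimately show ?thesis using A P by (simp only: ennreal_plus add_nonneg_nonneg)
  qed
  finally show ?thesis .
qed

lemma linear_functional_representation:
  fixes F :: "'a::euclidean_space \<Rightarrow> real"
  assumes "linear F"
  obtains p where "\<And>h. F h = p \<bullet> h"
proof
  fix h
  have "F h = F (\<Sum>b\<in>Basis. (h \<bullet> b) *\<^sub>R b)" by (simp add: euclidean_representation)
  also have "\<dots> = (\<Sum>b\<in>Basis. F b *\<^sub>R b) \<bullet> h"
    using assms by (simp add: linear_sum linear_scale inner_sum_left inner_commute[of h] mult.commute)
  finally show "F h = (\<Sum>b\<in>Basis. F b *\<^sub>R b) \<bullet> h" .
qed

section \<open>A priori estimates and passage to the limit\<close>

text \<open>All three conclusions come from the one bound on second differences. The restriction to
  radius 9/16 leaves room 1/16 inside the ball of radius 5/8 on which that bound holds.\<close>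

theorem smooth_solution_estimates:
  fixes s \<gamma> \<beta> lam Lam :: real
  assumes s: "0 < s" "s < 1" and \<gamma>: "0 < \<gamma>" "\<gamma> < 2 * s" and lam: "0 < lam" "lam \<le> Lam"
    and \<beta>: "0 < \<beta>" "\<beta> < 1" "\<beta> \<le> \<gamma>"
  shows "\<exists>K>0. \<forall>(\<mu> :: 'a::euclidean_space measure) W f A Q b.
    spectral_measure s lam Lam \<mu> \<longrightarrow> smooth_solution s \<mu> W f A Q b \<longrightarrow>
    (\<forall>t x. -1/2 \<le> t \<longrightarrow> t \<le> b \<longrightarrow> norm x \<le> 9/16 \<longrightarrow>
      (\<forall>t'. t \<le> t' \<longrightarrow> t' \<le> b \<longrightarrow> \<bar>W t' x - W t x\<bar> \<le> K * A * (t' - t) powr (\<gamma> / (2 * s))) \<and>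
      (\<forall>y. norm (y - x) \<le> 1/32 \<longrightarrow> \<bar>W t y - W t x\<bar> \<le> K * A * norm (y - x) powr \<beta>) \<and>
      (1 < \<gamma> \<longrightarrow> (\<exists>p. norm p \<le> K * A \<and>
        (\<forall>y. norm (y - x) \<le> 1/16 \<longrightarrow> \<bar>W t y - W t x - p \<bullet> (y - x)\<bar> \<le> K * A * norm (y - x) powr \<gamma>))))"
proof -
  obtain K0 where K0: "0 < K0" and est: "\<And>(\<mu> :: 'a measure) W f A Q b t x h.
    spectral_measure s lam Lam \<mu> \<Longrightarrow> smooth_solution s \<mu> W f A Q b \<Longrightarrow>
    -5/8 \<le> t \<Longrightarrow> t \<le> b \<Longrightarrow> norm x \<le> 5/8 \<Longrightarrow> \<bar>D2 (W t) x h\<bar> \<le> K0 * A * norm h powr \<gamma>"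
    using interior_D2_estimate[OF s \<gamma> lam, where 'a = 'a] by blast
  \<comment> \<open>The 512 serves time gaps with \<rho> > 1/16: there \<rho>^\<gamma> \<ge> 1/256
    because \<gamma> < 2, and the increment is at most 2 A. In K2, 128 is 4 / (1/32). In K, 16 (2 +
    K3) bounds the gradient, found by testing the Taylor expansion at a step of length 1/16 parallel
    to it.\<close>
  define K1 where "K1 = K0 / 2 + Lam * time_const s \<gamma> * K0 + 1 + 512"
  define K2 where "K2 = 128 + K0 / (2 - 2 powr \<beta>)"
  define K3 where "K3 = \<bar>K0 / (1 - 2 powr (1 - \<gamma>))\<bar>"
  define K where "K = K1 + K2 + 16 * (2 + K3)"
  have Lam: "0 \<le> Lam" using lam by simp
  have "2 powr \<beta> < (2::real)" using powr_less_mono[of \<beta> 1 2] \<beta> by simp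
  then have K2: "0 \<le> K2" using K0 by (simp add: K2_def)
  have K3: "0 \<le> K3" by (simp add: K3_def)
  have K1: "513 \<le> K1" using K0 Lam time_const_nonneg[OF s \<gamma>(2)] by (simp add: K1_def)
  have K: "0 < K" "K1 \<le> K" "K2 \<le> K" "K3 \<le> K" "16 * (2 + K3) \<le> K" using K1 K2 K3 by (auto simp: K_def)
  show ?thesis
  proof (rule exI[of _ K], intro conjI allI impI K(1))
    fix \<mu> :: "'a measure" and W f :: "real \<Rightarrow> 'a \<Rightarrow> real" and A Q b t :: real and x :: 'a
    assume sp: "spectral_measure s lam Lam \<mu>" and sol: "smooth_solution s \<mu> W f A Q b"
      and t: "-1/2 \<le> t" "t \<le> b" and x: "norm x \<le> 9/16"
    from sol have b: "b < 0"
      and contW: "continuous_on UNIV (\<lambda>(t, x). W t x)" and c11W: "\<forall>t. c11 (W t)"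
      and dW: "\<forall>t x. W t differentiable (at x)" and W_le: "\<forall>t x. \<bar>W t x\<bar> \<le> A"
      and eqW: "\<forall>t x. -3/4 < t \<longrightarrow> t \<le> b \<longrightarrow> norm x < 3/4 \<longrightarrow>
        ((\<lambda>t. W t x) has_real_derivative (slice_op s \<mu> (W t) x + f t x)) (at t) \<and> \<bar>f t x\<bar> \<le> A"
      unfolding smooth_solution_def by blast+
    note D = est[OF sp sol]
    have A: "0 \<le> A" using W_le abs_ge_zero order_trans by blast
    have diffA: "\<bar>W t x - W t' x'\<bar> \<le> 2 * A" for t x t' x'
      using W_le[rule_format, of t x] W_le[rule_format, of t' x'] by linarith
    show "\<bar>W t' x - W t x\<bar> \<le> K * A * (t' - t) powr (\<gamma> / (2 * s))" if t': "t \<le> t'" "t' \<le> b" for t'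
    proof (cases "t' = t \<or> A = 0")
      case True
      then show ?thesis using diffA[of t' x t x] by auto
    next
      case False
      define \<rho> where "\<rho> = (t' - t) powr (1 / (2 * s))"
      have tt: "0 < t' - t" "t' - t \<le> 1" using False t' t b by auto
      have \<rho>: "0 < \<rho>" "\<rho> \<le> 1" using tt s by (auto simp: \<rho>_def intro!: powr_le1)
      have \<rho>s: "\<rho> powr (2 * s) = t' - t" "\<rho> powr \<gamma> = (t' - t) powr (\<gamma> / (2 * s))"
        using tt s by (auto simp: \<rho>_def powr_powr)
      have "\<bar>W t' x - W t x\<bar> \<le> K1 * A * \<rho> powr \<gamma>"
      proof (cases "\<rho> \<le> 1/16")
        case True
        have H: "0 < K0 * A" using K0 A False by auto
        have "\<bar>W t' x - W t x\<bar> \<le> (K0 * A) * \<rho> powr \<gamma> / 2 + (Lam * time_const s \<gamma> * (K0 * A) * \<rho> powr (\<gamma> - 2 * s) + A) * (t' - t)"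
        proof (rule time_increment_bound[OF s \<gamma> sp Lam t'(1) \<rho>(1) H])
          show "continuous_on ({t..t'} \<times> UNIV) (\<lambda>(t, x). W t x)" by (rule continuous_on_subset[OF contW]) auto
          fix \<tau> y assume "\<tau> \<in> {t..t'}" "y \<in> cball x \<rho>"
          then have a: "-5/8 \<le> \<tau>" "\<tau> \<le> b" "norm y \<le> 5/8"
            using t t' x True norm_triangle_ineq2[of y x] by (auto simp: dist_norm norm_minus_commute)
          then have a': "-3/4 < \<tau>" "norm y < 3/4" by auto
          show "((\<lambda>t. W t y) has_real_derivative (slice_op s \<mu> (W \<tau>) y + f \<tau> y)) (at \<tau>)" "\<bar>f \<tau> y\<bar> \<le> A"
            using eqW a a' by blast+
          show "\<bar>D2 (W \<tau>) y h\<bar> \<le> K0 * A * norm h powr \<gamma>" for h by (rule D[OF a])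
        qed (use c11W in auto)
        also have "\<dots> = A * ((K0 / 2) * \<rho> powr \<gamma> + Lam * time_const s \<gamma> * K0 * (\<rho> powr (\<gamma> - 2 * s) * \<rho> powr (2 * s)) + \<rho> powr (2 * s))"
          unfolding \<rho>s(1)[symmetric] by (simp add: algebra_simps)
        also have "\<rho> powr (\<gamma> - 2 * s) * \<rho> powr (2 * s) = \<rho> powr \<gamma>"
          by (simp add: powr_add[symmetric])
        also have "A * ((K0 / 2) * \<rho> powr \<gamma> + Lam * time_const s \<gamma> * K0 * \<rho> powr \<gamma> + \<rho> powr (2 * s))
           \<le> A * ((K0 / 2) * \<rho> powr \<gamma> + Lam * time_const s \<gamma> * K0 * \<rho> powr \<gamma> + \<rho> powr \<gamma>)"
          using A \<rho> \<gamma> by (intro mult_left_mono add_left_mono powr_mono') auto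
        also have "\<dots> = (K1 - 512) * A * \<rho> powr \<gamma>" by (simp add: K1_def algebra_simps)
        also have "\<dots> \<le> K1 * A * \<rho> powr \<gamma>" using A by (intro mult_right_mono) auto
        finally show ?thesis .
      next
        case False
        have "(1/16) powr 2 \<le> \<rho> powr 2" using False \<rho> by (intro powr_mono2) auto
        also have "\<rho> powr 2 \<le> \<rho> powr \<gamma>" using \<rho> \<gamma> s by (intro powr_mono') auto
        finally have "1 / 256 \<le> \<rho> powr \<gamma>" by (simp add: power2_eq_square)
        then have "512 * A * (1 / 256) \<le> K1 * A * \<rho> powr \<gamma>"
          using A K1 by (intro mult_mono) auto
        then show ?thesis using diffA[of t' x t x] by simp
      qed
      also have "\<dots> \<le> K * A * \<rho> powr \<gamma>" using K A by (intro mult_right_mono) auto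
      finally show ?thesis by (simp add: \<rho>s(2))
    qed
    have Dx: "\<bar>D2 (W t) y h\<bar> \<le> K0 * A * norm h powr \<gamma>" if "norm (y - x) \<le> 1/16" for y h
      using t x that norm_triangle_ineq2[of y x] by (intro D) auto
    show "\<bar>W t y - W t x\<bar> \<le> K * A * norm (y - x) powr \<beta>" if y: "norm (y - x) \<le> 1/32" for y
    proof -
      have "\<bar>W t (x + (y - x)) - W t x\<bar> \<le> (4 * A / (1/32) + (K0 * A) / (2 - 2 powr \<beta>)) * norm (y - x) powr \<beta>"
        by (rule holder_of_D2[OF \<beta>]) (use y W_le Dx K0 A in \<open>auto simp: dist_norm norm_minus_commute\<close>)
      also have "4 * A / (1/32) + (K0 * A) / (2 - 2 powr \<beta>) = K2 * A" by (simp add: K2_def algebra_simps)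
      also have "K2 * A * norm (y - x) powr \<beta> \<le> K * A * norm (y - x) powr \<beta>"
        using K A by (intro mult_right_mono) auto
      finally show ?thesis by simp
    qed
    show "\<exists>p. norm p \<le> K * A \<and>
        (\<forall>y. norm (y - x) \<le> 1/16 \<longrightarrow> \<bar>W t y - W t x - p \<bullet> (y - x)\<bar> \<le> K * A * norm (y - x) powr \<gamma>)" if \<gamma>1: "1 < \<gamma>"
    proof -
      obtain F where F: "(W t has_derivative F) (at x)" using dW unfolding differentiable_def by blast
      obtain p where p: "\<And>h. F h = p \<bullet> h"
        using linear_functional_representation[OF has_derivative_linear[OF F]] by blast
      have T: "\<bar>W t (x + h) - W t x - p \<bullet> h\<bar> \<le> K3 * A * norm h powr \<gamma>" if h: "norm h \<le> 1/16" for h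
      proof -
        have "\<bar>W t (x + h) - W t x - F h\<bar> \<le> K0 * A / (1 - 2 powr (1 - \<gamma>)) * norm h powr \<gamma>"
          by (rule taylor_of_D2[OF F \<gamma>1]) (use Dx h K0 A in auto)
        also have "\<dots> \<le> K3 * A * norm h powr \<gamma>"
        proof (rule mult_right_mono)
          have "K0 * A / (1 - 2 powr (1 - \<gamma>)) = (K0 / (1 - 2 powr (1 - \<gamma>))) * A" by simp
          also have "\<dots> \<le> K3 * A" unfolding K3_def using A by (rule mult_right_mono[OF abs_ge_self])
          finally show "K0 * A / (1 - 2 powr (1 - \<gamma>)) \<le> K3 * A" .
        qed simp
        finally show ?thesis by (simp add: p)
      qed
      have "norm p \<le> 16 * (2 + K3) * A"
      proof (cases "p = 0")
        case False
        define h where "h = (1 / (16 * norm p)) *\<^sub>R p"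
        have h: "norm h = 1/16" using False by (simp add: h_def)
        have "p \<bullet> h = norm p / 16" using False by (simp add: h_def power2_norm_eq_inner[symmetric] power2_eq_square)
        then have "norm p / 16 \<le> 2 * A + K3 * A * norm h powr \<gamma>"
          using T[of h] diffA[of t "x + h" t x] h unfolding abs_le_iff by linarith
        also have "K3 * A * norm h powr \<gamma> \<le> K3 * A * 1"
          using h K3 A \<gamma> by (intro mult_left_mono powr_le1) auto
        finally show ?thesis by (simp add: algebra_simps)
      qed (use K3 A in simp)
      also have "\<dots> \<le> K * A" using K A by (intro mult_right_mono) auto
      finally have "norm p \<le> K * A" .
      moreover have "\<bar>W t y - W t x - p \<bullet> (y - x)\<bar> \<le> K * A * norm (y - x) powr \<gamma>" if "norm (y - x) \<le> 1/16" for y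
      proof -
        have "K3 * A * norm (y - x) powr \<gamma> \<le> K * A * norm (y - x) powr \<gamma>"
          using K A by (intro mult_right_mono) auto
        then show ?thesis using T[OF that] by simp
      qed
      ultimately show ?thesis by blast
    qed
  qed
qed

text \<open>Convolution and Fubini are carried out for Borel functions with a bound at every point.
  Truncation makes the essential bound pointwise and changes the function only on a null
  set.\<close>

lemma lebesgue_bounded_borel_representative:
  fixes u :: "'a::euclidean_space \<Rightarrow> real"
  assumes u: "u \<in> borel_measurable (lebesgue_on S)" and S: "S \<in> sets lebesgue"
    and A: "AE z in lebesgue_on S. \<bar>u z\<bar> \<le> A" "0 \<le> A"
  obtains U where "U \<in> borel_measurable borel" "\<And>z. \<bar>U z\<bar> \<le> A" "AE z in lborel. U z = (if z \<in> S then u z else 0)"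
proof -
  have "(\<lambda>z. if z \<in> S then u z else 0) \<in> borel_measurable lebesgue"
    using u S by (simp add: borel_measurable_if)
  then obtain U0 where U0: "U0 \<in> borel_measurable lborel" "AE z in lborel. (if z \<in> S then u z else 0) = U0 z"
    by (auto dest: completion_ex_borel_measurable_real)
  have "AE z in lebesgue. z \<in> S \<longrightarrow> \<bar>u z\<bar> \<le> A" using A S by (simp add: AE_restrict_space_iff)
  then have le: "AE z in lborel. z \<in> S \<longrightarrow> \<bar>u z\<bar> \<le> A" by (simp only: AE_completion_iff)
  have [measurable]: "U0 \<in> borel_measurable borel" using U0(1) by simp
  show ?thesis
  proof (rule that[of "\<lambda>z. max (- A) (min A (U0 z))"])
    show "AE z in lborel. max (- A) (min A (U0 z)) = (if z \<in> S then u z else 0)"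
      using U0(2) le by eventually_elim (use A(2) in \<open>auto split: if_splits\<close>)
  qed (use A(2) in auto)
qed

text \<open>The equation survives mollification only at points whose \<epsilon>-ball fits into the
  cylinder. This is why it stops at the negative time -2 \<epsilon> and why the smaller cylinder
  starts at -3/4 with radius 3/4.\<close>

lemma mollified_smooth_solution:
  fixes u f :: "real \<times> 'a::euclidean_space \<Rightarrow> real"
  assumes s: "0 < s" "s < 1" and sp: "spectral_measure s lam Lam \<mu>" and Lam: "0 \<le> Lam"
    and weak: "weak_solution (stable_op s \<mu>) {-1<..<0} (ball 0 1) u f"
    and Um: "U \<in> borel_measurable borel" and U: "\<And>z. \<bar>U z\<bar> \<le> A"
    and Uu: "AE z in lborel. U z = (if z \<in> {-1<..<0} \<times> UNIV then u z else 0)"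
    and f: "AE z in lebesgue_on ({-1<..<0} \<times> ball 0 1). \<bar>f z\<bar> \<le> A"
    and \<epsilon>: "0 < \<epsilon>" "\<epsilon> \<le> 1/16"
  shows "\<exists>F Q. smooth_solution s \<mu> (\<lambda>t x. conv U (mollifier \<epsilon>) (t, x)) F A Q (- 2 * \<epsilon>)"
proof -
  define w where "w = conv U (mollifier \<epsilon>)"
  have A: "0 \<le> A" using U[of "(0, 0)"] by simp
  note cd = conv_has_derivative[OF Um U mollifier_C_k mollifier_eq_0[OF \<epsilon>(1) less_imp_le], folded w_def]
  obtain Q where Q: "\<And>z h. \<bar>D2 w z h\<bar> \<le> Q * (norm h)\<^sup>2"
    using conv_D2_bound[OF Um U mollifier_C_k mollifier_eq_0[OF \<epsilon>(1) less_imp_le]] unfolding w_def by blast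
  have wA: "\<bar>w z\<bar> \<le> A" for z unfolding w_def by (rule abs_conv_mollifier_le[OF Um U \<epsilon>(1)])
  have cont: "continuous_on UNIV w"
    using cd by (intro differentiable_imp_continuous_on) (auto simp: differentiable_on_def differentiable_def)
  have D2w: "D2 (\<lambda>x. w (t, x)) x h = D2 w (t, x) (0, h)" for t x h by (simp add: D2_def)
  have Qw: "\<bar>D2 (\<lambda>x. w (t, x)) x h\<bar> \<le> Q * (norm h)\<^sup>2" for t x h
    unfolding D2w using Q[of "(t, x)" "(0, h)"] by (simp add: norm_Pair)
  have contx: "continuous_on UNIV (\<lambda>x. w (t, x))" for t
    by (rule continuous_on_compose2[OF cont]) (auto intro!: continuous_intros)
  have c11: "c11 (\<lambda>x. w (t, x))" for t unfolding c11_def using contx wA Qw by blast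
  have dx: "(\<lambda>x. w (t, x)) differentiable (at x)" for t x
  proof -
    have "((\<lambda>x. (t, x)) has_derivative (\<lambda>h. (0, h))) (at x)" by (auto intro!: derivative_eq_intros)
    from has_derivative_compose[OF this cd] show ?thesis unfolding differentiable_def by blast
  qed
  have "\<exists>F. \<bar>F\<bar> \<le> A \<and> ((\<lambda>t. w (t, x)) has_real_derivative (slice_op s \<mu> (\<lambda>y. w (t, y)) x + F)) (at t)"
    if "-3/4 < t" "t \<le> - 2 * \<epsilon>" "norm x < 3/4" for t x
    unfolding w_def
  proof (rule mollified_equation[OF s sp Lam weak _ _ Um U Uu f A \<epsilon>(1)])
    show "cball (t, x) \<epsilon> \<subseteq> {-1<..<0} \<times> ball 0 1"
    proof
      fix z assume "z \<in> cball (t, x) \<epsilon>"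
      moreover obtain t' x' where z: "z = (t', x')" by fastforce
      ultimately have d: "dist (t, x) (t', x') \<le> \<epsilon>" by simp
      have "\<bar>t - t'\<bar> \<le> \<epsilon>" using dist_fst_le[of "(t, x)" "(t', x')"] d by (simp add: dist_real_def)
      moreover have "norm (x - x') \<le> \<epsilon>" using dist_snd_le[of "(t, x)" "(t', x')"] d by (simp add: dist_norm)
      ultimately show "z \<in> {-1<..<0} \<times> ball 0 1"
        using that \<epsilon> norm_triangle_ineq2[of x' x] by (auto simp: z norm_minus_commute abs_le_iff)
    qed
  qed auto
  then obtain F where "\<And>t x. -3/4 < t \<Longrightarrow> t \<le> - 2 * \<epsilon> \<Longrightarrow> norm x < 3/4 \<Longrightarrow>
     \<bar>F t x\<bar> \<le> A \<and> ((\<lambda>t. w (t, x)) has_real_derivative (slice_op s \<mu> (\<lambda>y. w (t, y)) x + F t x)) (at t)"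
    by metis
  then have "smooth_solution s \<mu> (\<lambda>t x. w (t, x)) F A Q (- 2 * \<epsilon>)"
    unfolding smooth_solution_def using \<epsilon> cont c11 dx Qw wA by (simp add: case_prod_beta)
  then show ?thesis unfolding w_def by blast
qed

text \<open>Upgrades almost everywhere convergence of the mollifications to convergence everywhere, which singles out
the regular representative of the weak solution.\<close>

lemma equicontinuous_AE_convergent:
  fixes w :: "nat \<Rightarrow> 'a::euclidean_space \<Rightarrow> real"
  assumes S: "open S" and z: "z \<in> S" and AE: "AE y in lborel. y \<in> S \<longrightarrow> convergent (\<lambda>n. w n y)"
    and equi: "\<And>e. 0 < e \<Longrightarrow> \<exists>d>0. \<forall>y\<in>S. dist y z < d \<longrightarrow> (\<forall>\<^sub>F n in sequentially. \<bar>w n y - w n z\<bar> \<le> e)"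
  shows "convergent (\<lambda>n. w n z)"
proof -
  have "Cauchy (\<lambda>n. w n z)"
    unfolding Cauchy_altdef2
  proof (intro allI impI)
    fix e :: real assume e: "0 < e"
    then obtain d where d: "0 < d" "\<And>y. y \<in> S \<Longrightarrow> dist y z < d \<Longrightarrow> \<forall>\<^sub>F n in sequentially. \<bar>w n y - w n z\<bar> \<le> e / 4"
      using equi[of "e / 4"] by auto
    have "\<exists>y\<in>S \<inter> ball z d. convergent (\<lambda>n. w n y)"
    proof (rule ccontr)
      assume "\<not> ?thesis"
      then have "AE y in lborel. y \<notin> S \<inter> ball z d" using AE by (auto elim!: eventually_mono)
      moreover have "open (S \<inter> ball z d)" using S by auto
      ultimately have "S \<inter> ball z d \<in> null_sets lborel" by (subst AE_iff_null_sets) auto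
      then have "negligible (S \<inter> ball z d)" by (simp add: negligible_iff_null_sets null_sets_completionI)
      moreover have "z \<in> S \<inter> ball z d" using z d by simp
      ultimately show False using open_not_negligible[OF \<open>open (S \<inter> ball z d)\<close>] by blast
    qed
    then obtain y where y: "y \<in> S" "dist y z < d" "convergent (\<lambda>n. w n y)" by (auto simp: dist_commute)
    have "Cauchy (\<lambda>n. w n y)" using y(3) by (rule convergent_Cauchy)
    then obtain M where M: "\<And>n. n \<ge> M \<Longrightarrow> dist (w n y) (w M y) < e / 4"
      unfolding Cauchy_altdef2 using e by (metis divide_pos_pos zero_less_numeral)
    obtain M' where M': "\<And>n. n \<ge> M' \<Longrightarrow> \<bar>w n y - w n z\<bar> \<le> e / 4"
      using d(2)[OF y(1,2)] by (auto simp: eventually_sequentially)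
    define L where "L = max M M'"
    show "\<exists>N. \<forall>n\<ge>N. dist (w n z) (w N z) < e"
    proof (intro exI[of _ L] allI impI)
      fix n assume n: "L \<le> n"
      then show "dist (w n z) (w L z) < e"
        using M[of n] M[of L] M'[of n] M'[of L] unfolding dist_real_def L_def by linarith
    qed
  qed
  then show ?thesis by (rule Cauchy_convergent)
qed

text \<open>With A any common essential bound of u and f, the analysis stays within the reals;
  extended norms enter only through the Hoelder norms of the conclusion.\<close>

theorem parabolic_regularity:
  fixes s \<epsilon> lam Lam :: real
  assumes s: "0 < s" "s < 1" and lam: "0 < lam" "lam \<le> Lam" and \<epsilon>: "0 < \<epsilon>" "\<epsilon> < 2 * s"
  shows "\<exists>C>0. \<forall>(\<mu> :: 'a::euclidean_space measure) u f A.
    spectral_measure s lam Lam \<mu> \<longrightarrow> weak_solution (stable_op s \<mu>) {-1<..<0} (ball 0 1) u f \<longrightarrow> 0 \<le> A \<longrightarrow>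
    (AE z in lebesgue_on ({-1<..<0} \<times> UNIV). \<bar>u z\<bar> \<le> A) \<longrightarrow>
    (AE z in lebesgue_on ({-1<..<0} \<times> ball 0 1). \<bar>f z\<bar> \<le> A) \<longrightarrow>
    (\<exists>v. (AE z in lebesgue_on ({-1<..<0} \<times> UNIV). v z = u z) \<and>
      holder_norm_t (1 - \<epsilon> / (2 * s)) {-1/2<..<0} (ball 0 (1/2)) v
        + holder_norm_x (2 * s - \<epsilon>) {-1/2<..<0} (ball 0 (1/2)) v \<le> ennreal (C * A))"
proof -
  define \<gamma>0 where "\<gamma>0 = 2 * s - \<epsilon>"
  \<comment> \<open>Strictly between \<gamma>0 and 2s. In particular \<gamma>0 \<ge> 1 implies
    \<gamma> > 1, so Taylor expansions are available also for \<gamma>0 = 1.\<close>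
  define \<gamma> where "\<gamma> = (\<gamma>0 + 2 * s) / 2"
  \<comment> \<open>For \<gamma>0 < 1 this is the exponent of the claim. Otherwise it provides only
    equicontinuity in space, and 1/2 is an arbitrary choice.\<close>
  define \<beta> where "\<beta> = (if \<gamma>0 < 1 then \<gamma>0 else 1/2)"
  define \<alpha> where "\<alpha> = 1 - \<epsilon> / (2 * s)"
  have \<gamma>0: "0 < \<gamma>0" "\<gamma>0 < \<gamma>" using \<epsilon> by (auto simp: \<gamma>0_def \<gamma>_def)
  have \<gamma>: "0 < \<gamma>" "\<gamma> < 2 * s" "\<gamma> < 2"
    using \<epsilon> s by (auto simp: \<gamma>0_def \<gamma>_def)
  have \<beta>: "0 < \<beta>" "\<beta> < 1" "\<beta> \<le> \<gamma>" using \<gamma>0 by (auto simp: \<beta>_def)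
  have \<alpha>: "0 < \<alpha>" "\<alpha> < 1" "\<alpha> \<le> \<gamma> / (2 * s)"
  proof -
    have "\<alpha> = \<gamma>0 / (2 * s)" using s by (simp add: \<alpha>_def \<gamma>0_def diff_divide_distrib)
    then show "0 < \<alpha>" "\<alpha> \<le> \<gamma> / (2 * s)" using \<gamma>0 s by (auto intro: divide_right_mono)
    show "\<alpha> < 1" using \<epsilon> s by (simp add: \<alpha>_def)
  qed
  have Lam: "0 \<le> Lam" using lam by simp
  obtain K where K: "0 < K" and est: "\<forall>(\<mu> :: 'a measure) W f A Q b.
    spectral_measure s lam Lam \<mu> \<longrightarrow> smooth_solution s \<mu> W f A Q b \<longrightarrow> (\<forall>t x. -1/2 \<le> t \<longrightarrow> t \<le> b \<longrightarrow> norm x \<le> 9/16 \<longrightarrow>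
      (\<forall>t'. t \<le> t' \<longrightarrow> t' \<le> b \<longrightarrow> \<bar>W t' x - W t x\<bar> \<le> K * A * (t' - t) powr (\<gamma> / (2 * s))) \<and>
      (\<forall>y. norm (y - x) \<le> 1/32 \<longrightarrow> \<bar>W t y - W t x\<bar> \<le> K * A * norm (y - x) powr \<beta>) \<and>
      (1 < \<gamma> \<longrightarrow> (\<exists>p. norm p \<le> K * A \<and>
        (\<forall>y. norm (y - x) \<le> 1/16 \<longrightarrow> \<bar>W t y - W t x - p \<bullet> (y - x)\<bar> \<le> K * A * norm (y - x) powr \<gamma>))))"
    using smooth_solution_estimates[OF s \<gamma>(1,2) lam \<beta>, where 'a = 'a] by (elim exE conjE)
  \<comment> \<open>The time norm contributes A + K A, the space norm 65 A + 72 K A. There 64 A pays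
    for points farther apart than 1/32 when \<gamma>0 < 1, and 71 = 1 + 6 + 2 / (1/32) arises when
    \<gamma>0 \<ge> 1; 72 is a common upper bound.\<close>
  define C where "C = 66 + 73 * K"
  have C: "0 < C" using K by (simp add: C_def)
  show ?thesis
  proof (rule exI[of _ C], intro conjI allI impI C)
    fix \<mu> :: "'a measure" and u f :: "real \<times> 'a \<Rightarrow> real" and A :: real
    assume sp: "spectral_measure s lam Lam \<mu>" and weak: "weak_solution (stable_op s \<mu>) {-1<..<0} (ball 0 1) u f"
      and A: "0 \<le> A" and uA: "AE z in lebesgue_on ({-1<..<0} \<times> UNIV). \<bar>u z\<bar> \<le> A"
      and fA: "AE z in lebesgue_on ({-1<..<0} \<times> ball 0 1). \<bar>f z\<bar> \<le> A"
    define I where "I = {-1<..<0::real} \<times> (UNIV :: 'a set)"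
    have I: "I \<in> sets lebesgue"
      unfolding I_def by (rule sets_completionI_sets) (simp only: sets_lborel borel_open open_Times open_greaterThanLessThan open_UNIV)
    have "u \<in> borel_measurable (lebesgue_on I)" using weak by (simp add: weak_solution_def I_def)
    from lebesgue_bounded_borel_representative[OF this I uA[folded I_def] A]
    obtain U where Um: "U \<in> borel_measurable borel" and U: "\<And>z. \<bar>U z\<bar> \<le> A"
      and Uu: "AE z in lborel. U z = (if z \<in> I then u z else 0)" by blast
    obtain e :: "nat \<Rightarrow> real" where e: "\<And>n. 0 < e n" "e \<longlonglongrightarrow> 0"
      and eU: "AE z in lborel. z \<in> cball 0 1 \<longrightarrow> (\<lambda>n. conv U (mollifier (e n)) z) \<longlonglongrightarrow> U z"
      using conv_mollifier_AE_subseq[OF Um U] by blast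
    define w where "w = (\<lambda>n. conv U (mollifier (e n)))"
    have wA: "\<bar>w n z\<bar> \<le> A" for n z unfolding w_def by (rule abs_conv_mollifier_le[OF Um U e(1)])
    have KA: "0 \<le> K * A" using K A by simp
    have ev: "\<forall>\<^sub>F n in sequentially. e n < d" if "0 < d" for d using e(2) that by (rule order_tendstoD)
    have est_w: "(\<forall>t'. t \<le> t' \<longrightarrow> t' \<le> - 2 * e n \<longrightarrow> \<bar>w n (t', x) - w n (t, x)\<bar> \<le> K * A * (t' - t) powr (\<gamma> / (2 * s))) \<and>
      (\<forall>y. norm (y - x) \<le> 1/32 \<longrightarrow> \<bar>w n (t, y) - w n (t, x)\<bar> \<le> K * A * norm (y - x) powr \<beta>) \<and>
      (1 < \<gamma> \<longrightarrow> (\<exists>p. norm p \<le> K * A \<and>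
        (\<forall>y. norm (y - x) \<le> 1/16 \<longrightarrow> \<bar>w n (t, y) - w n (t, x) - p \<bullet> (y - x)\<bar> \<le> K * A * norm (y - x) powr \<gamma>)))"
      if n: "e n \<le> 1/16" and t: "-1/2 \<le> t" "t \<le> - 2 * e n" and x: "norm x \<le> 9/16" for n t x
    proof -
      obtain F Q where "smooth_solution s \<mu> (\<lambda>t x. w n (t, x)) F A Q (- 2 * e n)"
        using mollified_smooth_solution[OF s sp Lam weak Um U Uu[unfolded I_def] fA e(1) n] unfolding w_def by blast
      from est[THEN spec, THEN spec, THEN spec, THEN spec, THEN spec, THEN spec, THEN mp, OF sp, THEN mp, OF this,
          THEN spec, THEN spec, THEN mp, OF t(1), THEN mp, OF t(2), THEN mp, OF x]
      show ?thesis .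
    qed
    \<comment> \<open>Radius 9/16 rather than 1/2, because the Hoelder norm with a derivative
      requires expansions on the ball of radius 1/2 + 1/32.\<close>
    define \<Omega> where "\<Omega> = {-1/2<..<0::real} \<times> ball (0::'a) (9/16)"
    have \<Omega>: "open \<Omega>" by (auto simp: \<Omega>_def open_Times)
    have \<Omega>1: "\<Omega> \<subseteq> cball 0 1"
    proof
      fix z assume "z \<in> \<Omega>"
      then obtain t x where z: "z = (t, x)" "\<bar>t\<bar> < 1/2" "norm x < 9/16" by (auto simp: \<Omega>_def)
      have "norm z \<le> \<bar>t\<bar> + norm x"
        unfolding z norm_Pair by (rule order_trans[OF sqrt_sum_squares_le_sum_abs]) auto
      also have "\<dots> \<le> 17/16" using z by simp
      have "(norm z)\<^sup>2 = t\<^sup>2 + (norm x)\<^sup>2" by (simp add: z norm_Pair)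
      also have "\<dots> \<le> (1/2)\<^sup>2 + (9/16)\<^sup>2"
      proof (rule add_mono)
        show "t\<^sup>2 \<le> (1/2)\<^sup>2" using power_mono[of "\<bar>t\<bar>" "1/2" 2] z(2) by simp
        show "(norm x)\<^sup>2 \<le> (9/16)\<^sup>2" using power_mono[of "norm x" "9/16" 2] z(3) by simp
      qed
      also have "\<dots> \<le> (1::real)\<^sup>2" by (simp add: power2_eq_square)
      finally have "norm z \<le> 1" by (rule power2_le_imp_le) simp_all
      then show "z \<in> cball 0 1" by simp
    qed
    \<comment> \<open>The mollified solutions stop at times -2 e n, which increase to 0; every fixed
      negative time is eventually covered.\<close>
    have small: "\<forall>\<^sub>F n in sequentially. e n \<le> 1/16 \<and> t \<le> - 2 * e n" if "t < 0" for t
    proof -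
      have "0 < (1/16::real)" "0 < - t / 2" using that by auto
      from ev[OF this(1)] ev[OF this(2)] show ?thesis by eventually_elim linarith
    qed
    have conv: "convergent (\<lambda>n. w n z)" if z: "z \<in> \<Omega>" for z
    proof (rule equicontinuous_AE_convergent[OF \<Omega> z])
      show "AE y in lborel. y \<in> \<Omega> \<longrightarrow> convergent (\<lambda>n. w n y)"
        using eU by eventually_elim (use \<Omega>1 in \<open>auto simp: w_def convergent_def\<close>)
      fix r :: real assume r: "0 < r"
      obtain t x where zz: "z = (t, x)" by fastforce
      have t: "-1/2 < t" "t < 0" and x: "norm x < 9/16" using z by (auto simp: zz \<Omega>_def)
      obtain d1 where d1: "0 < d1" "d1 \<le> 1" "K * A * d1 powr (\<gamma> / (2 * s)) \<le> r / 2"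
        using exists_powr_small[of "K * A" "\<gamma> / (2 * s)" "r / 2"] KA \<gamma> s r by auto
      obtain d2 where d2: "0 < d2" "d2 \<le> 1" "K * A * d2 powr \<beta> \<le> r / 2"
        using exists_powr_small[of "K * A" \<beta> "r / 2"] KA \<beta> r by auto
      define d where "d = min (min d1 d2) (1/32)"
      show "\<exists>d>0. \<forall>y\<in>\<Omega>. dist y z < d \<longrightarrow> (\<forall>\<^sub>F n in sequentially. \<bar>w n y - w n z\<bar> \<le> r)"
      proof (intro exI[of _ d] conjI ballI impI)
        show "0 < d" using d1 d2 by (simp add: d_def)
        fix y assume y: "y \<in> \<Omega>" "dist y z < d"
        obtain t' x' where yy: "y = (t', x')" by fastforce
        have t': "-1/2 < t'" "t' < 0" and x': "norm x' < 9/16" using y by (auto simp: yy \<Omega>_def)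
        have dt: "\<bar>t' - t\<bar> < d" using dist_fst_le[of y z] y(2) by (simp add: yy zz dist_real_def)
        have dx: "norm (x' - x) < d" using dist_snd_le[of y z] y(2) by (simp add: yy zz dist_norm)
        show "\<forall>\<^sub>F n in sequentially. \<bar>w n y - w n z\<bar> \<le> r"
          using small[OF t(2)] small[OF t'(2)]
        proof eventually_elim
          fix n assume n: "e n \<le> 1/16 \<and> t \<le> - 2 * e n" "e n \<le> 1/16 \<and> t' \<le> - 2 * e n"
          have time: "\<bar>w n (t', x) - w n (t, x)\<bar> \<le> K * A * \<bar>t' - t\<bar> powr (\<gamma> / (2 * s))"
          proof (cases "t \<le> t'")
            case True
            then show ?thesis using est_w[of n t x] n t x by auto
          next
            case False
            then have "\<bar>w n (t, x) - w n (t', x)\<bar> \<le> K * A * (t - t') powr (\<gamma> / (2 * s))"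
              using est_w[of n t' x] n t' x by auto
            moreover have "\<bar>t' - t\<bar> = t - t'" using False by simp
            ultimately show ?thesis by (simp only: abs_minus_commute[of "w n (t', x)"])
          qed
          have "K * A * \<bar>t' - t\<bar> powr (\<gamma> / (2 * s)) \<le> K * A * d1 powr (\<gamma> / (2 * s))"
            using dt KA \<gamma> s by (intro mult_left_mono powr_mono2) (auto simp: d_def)
          moreover have "\<bar>w n (t', x') - w n (t', x)\<bar> \<le> K * A * norm (x' - x) powr \<beta>"
            using est_w[of n t' x] n t' x dx by (auto simp: d_def)
          moreover have "K * A * norm (x' - x) powr \<beta> \<le> K * A * d2 powr \<beta>"
            using dx KA \<beta> by (intro mult_left_mono powr_mono2) (auto simp: d_def)
          ultimately show "\<bar>w n y - w n z\<bar> \<le> r" unfolding yy zz using time d1(3) d2(3) by linarith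
        qed
      qed
    qed
    define v where "v = (\<lambda>z. if z \<in> \<Omega> then lim (\<lambda>n. w n z) else u z)"
    have v_lim: "(\<lambda>n. w n z) \<longlonglongrightarrow> v z" if "z \<in> \<Omega>" for z
      using conv[OF that] that by (simp add: v_def convergent_LIMSEQ_iff)
    have vu: "AE z in lebesgue_on I. v z = u z"
    proof -
      have "AE z in lborel. z \<in> I \<longrightarrow> v z = u z"
        using Uu eU
      proof eventually_elim
        fix z assume z: "U z = (if z \<in> I then u z else 0)" "z \<in> cball 0 1 \<longrightarrow> (\<lambda>n. conv U (mollifier (e n)) z) \<longlonglongrightarrow> U z"
        show "z \<in> I \<longrightarrow> v z = u z"
        proof
          assume zI: "z \<in> I"
          show "v z = u z"
          proof (cases "z \<in> \<Omega>")
            case True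
            then have "(\<lambda>n. w n z) \<longlonglongrightarrow> U z" using z(2) \<Omega>1 unfolding w_def by blast
            then show ?thesis using LIMSEQ_unique[OF v_lim[OF True]] z(1) zI by simp
          qed (simp add: v_def)
        qed
      qed
      then have "AE z in lebesgue. z \<in> I \<longrightarrow> v z = u z" by (simp only: AE_completion_iff)
      then show ?thesis using I by (simp add: AE_restrict_space_iff)
    qed
    have vA: "\<bar>v z\<bar> \<le> A" if "z \<in> \<Omega>" for z
      using tendsto_rabs[OF v_lim[OF that]] by (rule LIMSEQ_le_const2) (use wA in auto)
    have in\<Omega>: "(t, x) \<in> \<Omega>" if "t \<in> {-1/2<..<0}" "norm x < 9/16" for t x using that
      by (auto simp: \<Omega>_def)
    have v_time0: "\<bar>v (t', x) - v (t, x)\<bar> \<le> K * A * (t' - t) powr (\<gamma> / (2 * s))"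
      if t: "t \<in> {-1/2<..<0}" "t' \<in> {-1/2<..<0}" "t \<le> t'" and x: "norm x < 9/16" for t t' x
    proof (rule tendsto_upperbound[OF _ _ sequentially_bot])
      show "(\<lambda>n. \<bar>w n (t', x) - w n (t, x)\<bar>) \<longlonglongrightarrow> \<bar>v (t', x) - v (t, x)\<bar>"
        using in\<Omega> t x by (intro tendsto_rabs tendsto_diff v_lim) auto
      have "t < 0" "t' < 0" using t by auto
      from small[OF this(1)] small[OF this(2)]
      show "\<forall>\<^sub>F n in sequentially. \<bar>w n (t', x) - w n (t, x)\<bar> \<le> K * A * (t' - t) powr (\<gamma> / (2 * s))"
        by eventually_elim (use est_w[of _ t x] t x in auto)
    qed
    have v_space: "\<bar>v (t, y) - v (t, x)\<bar> \<le> K * A * norm (y - x) powr \<beta>"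
      if t: "t \<in> {-1/2<..<0}" and x: "norm x < 9/16" "norm y < 9/16" "norm (y - x) \<le> 1/32" for t x y
    proof (rule tendsto_upperbound[OF _ _ sequentially_bot])
      show "(\<lambda>n. \<bar>w n (t, y) - w n (t, x)\<bar>) \<longlonglongrightarrow> \<bar>v (t, y) - v (t, x)\<bar>"
        using in\<Omega> t x by (intro tendsto_rabs tendsto_diff v_lim) auto
      have "t < 0" using t by auto
      from small[OF this] show "\<forall>\<^sub>F n in sequentially. \<bar>w n (t, y) - w n (t, x)\<bar> \<le> K * A * norm (y - x) powr \<beta>"
        by eventually_elim (use est_w t x in auto)
    qed
    have v_taylor: "\<exists>p. norm p \<le> K * A \<and>
        (\<forall>y\<in>ball 0 (9/16). norm (y - x) \<le> 1/16 \<longrightarrow> \<bar>v (t, y) - v (t, x) - p \<bullet> (y - x)\<bar> \<le> K * A * norm (y - x) powr \<gamma>)"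
      if \<gamma>1: "1 < \<gamma>" and t: "t \<in> {-1/2<..<0}" and x: "norm x < 9/16" for t x
    proof -
      have "t < 0" using t by auto
      from small[OF this] obtain N where N: "\<And>n. N \<le> n \<Longrightarrow> e n \<le> 1/16 \<and> t \<le> - 2 * e n"
        by (auto simp: eventually_sequentially)
      have "\<exists>p. norm p \<le> K * A \<and>
        (\<forall>y. norm (y - x) \<le> 1/16 \<longrightarrow> \<bar>w (N + n) (t, y) - w (N + n) (t, x) - p \<bullet> (y - x)\<bar> \<le> K * A * norm (y - x) powr \<gamma>)" for n
        using est_w[of "N + n" t x] N[of "N + n"] \<gamma>1 t x by auto
      then obtain p where p: "\<And>n. norm (p n) \<le> K * A"
        "\<And>n y. norm (y - x) \<le> 1/16 \<Longrightarrow> \<bar>w (N + n) (t, y) - w (N + n) (t, x) - p n \<bullet> (y - x)\<bar> \<le> K * A * norm (y - x) powr \<gamma>"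
        by metis
      \<comment> \<open>The gradients of the mollifications at x are bounded, so a subsequence
        converges; the Taylor inequalities pass to the limit with this slope.\<close>
      have "seq_compact (cball (0::'a) (K * A))" using compact_cball compact_imp_seq_compact by blast
      moreover have "\<forall>n. p n \<in> cball 0 (K * A)" using p by simp
      ultimately obtain l r where l: "l \<in> cball 0 (K * A)" "strict_mono r" "(p \<circ> r) \<longlonglongrightarrow> l"
        unfolding seq_compact_def by metis
      show ?thesis
      proof (intro exI[of _ l] conjI ballI impI)
        show "norm l \<le> K * A" using l by simp
        fix y assume y: "y \<in> ball 0 (9/16)" "norm (y - x) \<le> 1/16"
        have sub: "(\<lambda>n. w (N + r n) (t, q)) \<longlonglongrightarrow> v (t, q)" if "norm q < 9/16" for q
        proof -
          have "(\<lambda>n. w (n + N) (t, q)) \<longlonglongrightarrow> v (t, q)"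
            using LIMSEQ_ignore_initial_segment[OF v_lim[OF in\<Omega>[OF t that]], of N] .
          from LIMSEQ_subseq_LIMSEQ[OF this l(2)] show ?thesis by (simp add: comp_def add.commute)
        qed
        have "(\<lambda>n. \<bar>w (N + r n) (t, y) - w (N + r n) (t, x) - p (r n) \<bullet> (y - x)\<bar>) \<longlonglongrightarrow> \<bar>v (t, y) - v (t, x) - l \<bullet> (y - x)\<bar>"
          using l(3) y x by (intro tendsto_rabs tendsto_diff sub tendsto_inner tendsto_const) (auto simp: comp_def)
        then show "\<bar>v (t, y) - v (t, x) - l \<bullet> (y - x)\<bar> \<le> K * A * norm (y - x) powr \<gamma>"
          by (rule LIMSEQ_le_const2) (use p(2)[OF y(2)] in auto)
      qed
    qed
    have norm_t: "holder_norm_t \<alpha> {-1/2<..<0} (ball 0 (1/2)) v \<le> ennreal (A + K * A)"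
      unfolding holder_norm_t_def
    proof (rule SUP_least, rule holder_norm_le_0[OF \<alpha>(1,2) _ A KA])
      fix x :: 'a assume "x \<in> ball 0 (1/2)"
      then have x: "norm x < 9/16" by simp
      show "\<bar>v (t, x)\<bar> \<le> A" if "t \<in> {-1/2<..<0}" for t using vA in\<Omega> that x by auto
      have main: "\<bar>v (t', x) - v (t, x)\<bar> \<le> K * A * (t' - t) powr \<alpha>" if t: "t \<in> {-1/2<..<0}" "t' \<in> {-1/2<..<0}" "t \<le> t'" for t t'
      proof -
        have "(t' - t) powr (\<gamma> / (2 * s)) \<le> (t' - t) powr \<alpha>" using t \<alpha> by (intro powr_mono') auto
        then show ?thesis using v_time0[OF t x] mult_left_mono[OF _ KA] by (meson order_trans)
      qed
      show "\<bar>v (t, x) - v (t', x)\<bar> \<le> K * A * norm (t - t') powr \<alpha>" if t: "t \<in> {-1/2<..<0}" "t' \<in> {-1/2<..<0}" for t t'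
        using main[of t t'] main[of t' t] t by (cases "t \<le> t'") (auto simp: abs_minus_commute)
    qed
    have norm_x: "holder_norm_x \<gamma>0 {-1/2<..<0} (ball 0 (1/2)) v \<le> ennreal (65 * A + 72 * (K * A))"
      unfolding holder_norm_x_def
    proof (rule SUP_least)
      fix t :: real assume t: "t \<in> {-1/2<..<0}"
      have vA': "\<bar>v (t, x)\<bar> \<le> A" if "x \<in> ball 0 (1/2)" for x using vA in\<Omega> that t by auto
      show "holder_norm \<gamma>0 (ball 0 (1/2)) (\<lambda>x. v (t, x)) \<le> ennreal (65 * A + 72 * (K * A))"
      proof (cases "\<gamma>0 < 1")
        case True
        then have \<beta>eq: "\<beta> = \<gamma>0" by (simp add: \<beta>_def)
        have "holder_norm \<gamma>0 (ball 0 (1/2)) (\<lambda>x. v (t, x)) \<le> ennreal (A + (64 * A + K * A))"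
        proof (rule holder_norm_le_0[OF \<gamma>0(1) True vA' A])
          fix x y :: 'a assume xy: "x \<in> ball 0 (1/2)" "y \<in> ball 0 (1/2)"
          show "\<bar>v (t, x) - v (t, y)\<bar> \<le> (64 * A + K * A) * norm (x - y) powr \<gamma>0"
          proof (cases "norm (x - y) \<le> 1/32")
            case True
            have "\<bar>v (t, x) - v (t, y)\<bar> \<le> K * A * norm (x - y) powr \<gamma>0"
              using v_space[OF t, of y x] xy True by (simp add: \<beta>eq)
            also have "\<dots> \<le> (64 * A + K * A) * norm (x - y) powr \<gamma>0" using A by (intro mult_right_mono) auto
            finally show ?thesis .
          next
            case False
            have "1/32 = (1/32) powr (1::real)" by simp
            also have "\<dots> \<le> (1/32) powr \<gamma>0" using True by (intro powr_mono') auto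
            also have "\<dots> \<le> norm (x - y) powr \<gamma>0" using False \<gamma>0 by (intro powr_mono2) auto
            finally have "(64 * A) * (1/32) \<le> (64 * A + K * A) * norm (x - y) powr \<gamma>0"
              using A KA by (intro mult_mono) auto
            then show ?thesis using vA'[OF xy(1)] vA'[OF xy(2)] by linarith
          qed
        qed (use A KA in auto)
        also have "\<dots> \<le> ennreal (65 * A + 72 * (K * A))"
          by (rule ennreal_leI) (use KA in linarith)
        finally show ?thesis .
      next
        case False
        then have "1 \<le> \<gamma>0" by simp
        have "holder_norm \<gamma>0 (ball 0 (1/2)) (\<lambda>x. v (t, x)) \<le> ennreal (A + (1 + 6 + 2 / (1/32)) * (K * A))"
        proof (rule holder_norm_le_1[OF \<open>1 \<le> \<gamma>0\<close> \<gamma>0(2) \<gamma>(3) _ _ _ vA' A])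
          fix x :: 'a assume "x \<in> ball 0 (1/2 + 1/32)"
          then have "norm x < 9/16" by simp
          from v_taylor[OF _ t this] obtain p where p: "norm p \<le> K * A"
            "\<And>y. y \<in> ball 0 (9/16) \<Longrightarrow> norm (y - x) \<le> 1/16 \<Longrightarrow> \<bar>v (t, y) - v (t, x) - p \<bullet> (y - x)\<bar> \<le> K * A * norm (y - x) powr \<gamma>"
            using \<open>1 \<le> \<gamma>0\<close> \<gamma>0(2) by auto
          then show "\<exists>p. norm p \<le> K * A \<and> (\<forall>y\<in>ball 0 (1/2 + 1/32). norm (y - x) \<le> 2 * (1/32) \<longrightarrow>
              \<bar>v (t, y) - v (t, x) - p \<bullet> (y - x)\<bar> \<le> K * A * norm (y - x) powr \<gamma>)"
            by (intro exI[of _ p]) auto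
        qed auto
        also have "\<dots> \<le> ennreal (65 * A + 72 * (K * A))"
        proof (rule ennreal_leI)
          have "A + (1 + 6 + 2 / (1/32)) * (K * A) = A + 71 * (K * A)" by simp
          then show "A + (1 + 6 + 2 / (1/32)) * (K * A) \<le> 65 * A + 72 * (K * A)" using A KA by linarith
        qed
        finally show ?thesis .
      qed
    qed
    have "holder_norm_t \<alpha> {-1/2<..<0} (ball 0 (1/2)) v + holder_norm_x \<gamma>0 {-1/2<..<0} (ball 0 (1/2)) v
      \<le> ennreal (A + K * A) + ennreal (65 * A + 72 * (K * A))"
      using norm_t norm_x by (rule add_mono)
    also have "\<dots> = ennreal (C * A)"
      using A KA by (simp add: ennreal_plus[symmetric] C_def algebra_simps del: ennreal_plus)
    finally show "\<exists>v. (AE z in lebesgue_on ({-1<..<0} \<times> UNIV). v z = u z) \<and>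
      holder_norm_t (1 - \<epsilon> / (2 * s)) {-1/2<..<0} (ball 0 (1/2)) v
        + holder_norm_x (2 * s - \<epsilon>) {-1/2<..<0} (ball 0 (1/2)) v \<le> ennreal (C * A)"
      using vu unfolding \<alpha>_def \<gamma>0_def I_def by blast
  qed
qed

theorem theorem1p3:
  fixes s \<epsilon> lam Lam :: real
  assumes "0 < s" and "s < 1"
    and "0 < lam" and "lam \<le> Lam"
    and "0 < \<epsilon>" and "\<epsilon> < 2 * s"
  shows "\<exists>C::real. C > 0 \<and>
    (\<forall>(L :: (real \<times> (real ^ 'n) \<Rightarrow> real) \<Rightarrow> real \<times> (real ^ 'n) \<Rightarrow> real)
       (u :: real \<times> (real ^ 'n) \<Rightarrow> real) (f :: real \<times> (real ^ 'n) \<Rightarrow> real).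
       is_stable_operator s lam Lam L \<longrightarrow>
       weak_solution L {-1<..<0} (ball 0 1) u f \<longrightarrow>
       (\<exists>v. (AE z in lebesgue_on ({-1<..<0} \<times> UNIV). v z = u z) \<and>
            holder_norm_t (1 - \<epsilon> / (2 * s)) {-1/2<..<0} (ball 0 (1/2)) v
            + holder_norm_x (2 * s - \<epsilon>) {-1/2<..<0} (ball 0 (1/2)) v
            \<le> ennreal C * (Linf_norm ({-1<..<0} \<times> UNIV) u
                           + Linf_norm ({-1<..<0} \<times> ball 0 1) f)))"
proof -
  obtain C where C: "0 < C" and reg: "\<forall>(\<mu> :: (real ^ 'n) measure) u f A.
    spectral_measure s lam Lam \<mu> \<longrightarrow> weak_solution (stable_op s \<mu>) {-1<..<0} (ball 0 1) u f \<longrightarrow> 0 \<le> A \<longrightarrow>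
    (AE z in lebesgue_on ({-1<..<0} \<times> UNIV). \<bar>u z\<bar> \<le> A) \<longrightarrow>
    (AE z in lebesgue_on ({-1<..<0} \<times> ball 0 1). \<bar>f z\<bar> \<le> A) \<longrightarrow>
    (\<exists>v. (AE z in lebesgue_on ({-1<..<0} \<times> UNIV). v z = u z) \<and>
      holder_norm_t (1 - \<epsilon> / (2 * s)) {-1/2<..<0} (ball 0 (1/2)) v
        + holder_norm_x (2 * s - \<epsilon>) {-1/2<..<0} (ball 0 (1/2)) v \<le> ennreal (C * A))"
    using parabolic_regularity[OF assms, where 'a = "real ^ 'n"] by (elim exE conjE)
  show ?thesis
  proof (rule exI[of _ C], intro conjI allI impI C)
    fix L :: "(real \<times> (real ^ 'n) \<Rightarrow> real) \<Rightarrow> real \<times> (real ^ 'n) \<Rightarrow> real" and u f :: "real \<times> (real ^ 'n) \<Rightarrow> real"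
    assume "is_stable_operator s lam Lam L" and weak: "weak_solution L {-1<..<0} (ball 0 1) u f"
    then obtain \<mu> where sp: "spectral_measure s lam Lam \<mu>" and L: "L = stable_op s \<mu>"
      unfolding is_stable_operator_def by blast
    let ?B = "Linf_norm ({-1<..<0} \<times> UNIV) u + Linf_norm ({-1<..<0} \<times> ball 0 1) f"
    show "\<exists>v. (AE z in lebesgue_on ({-1<..<0} \<times> UNIV). v z = u z) \<and>
            holder_norm_t (1 - \<epsilon> / (2 * s)) {-1/2<..<0} (ball 0 (1/2)) v
            + holder_norm_x (2 * s - \<epsilon>) {-1/2<..<0} (ball 0 (1/2)) v \<le> ennreal C * ?B"
    \<comment> \<open>With an infinite right-hand side u itself serves as v. Here C > 0 matters,
      since 0 times infinity is 0 in the extended reals.\<close>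
    proof (cases "?B = top")
      case True
      then have "ennreal C * ?B = top" using C by (simp only: ennreal_mult_top) simp
      then show ?thesis by (intro exI[of _ u]) auto
    next
      case False
      define A where "A = enn2real ?B"
      have "?B < top" using False by (rule less_top[THEN iffD1])
      then have A: "0 \<le> A" "ennreal A = ?B" unfolding A_def by (simp_all only: enn2real_nonneg ennreal_enn2real)
      have le: "AE z in lebesgue_on S. \<bar>h z\<bar> \<le> A" if "Linf_norm S h \<le> ?B" for S and h :: "real \<times> (real ^ 'n) \<Rightarrow> real"
        using esssup_AE[of "\<lambda>z. ennreal \<bar>h z\<bar>" "lebesgue_on S"]
      proof eventually_elim
        fix z assume "ennreal \<bar>h z\<bar> \<le> esssup (lebesgue_on S) (\<lambda>z. ennreal \<bar>h z\<bar>)"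
        then have "ennreal \<bar>h z\<bar> \<le> ennreal A" using that unfolding A(2) Linf_norm_def[symmetric] by (rule order_trans)
        then show "\<bar>h z\<bar> \<le> A" unfolding ennreal_le_iff[OF A(1)] .
      qed
      have eq: "ennreal (C * A) = ennreal C * ?B"
        unfolding A(2)[symmetric] using A(1) C by (intro ennreal_mult) auto
      show ?thesis
        unfolding eq[symmetric]
        by (rule reg[rule_format, OF sp weak[unfolded L] A(1) le[OF add_increasing2] le[OF add_increasing]]) (rule zero_le order_refl)+
    qed
  qed
qed

end
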